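(* Let $G$ be an abelian group, let $R$ be a commutative $G$-noetherian $G$-graded ring, and let $\mathcal{X}$ be a subcategory of $\mathsf{mod}^G R$ closed under grading shifts. (1) The following are equivalent: $\mathcal{X}$ is a Serre subcategory; $\mathcal{X}$ is a torsion class; $\mathcal{X}$ is a wide subcategory; $\mathcal{X}$ is an ICE-closed subcategory; $\mathcal{X}$ is a CE-closed subcategory. (2) The following are equivalent: $\mathcal{X}$ is a torsion-free class; $\mathcal{X}$ is an IKE-closed subcategory; $\mathcal{X}$ is an IE-closed subcategory.
   Context: A $G$-graded ring is commutative if its underlying ring is commutative, and $G$-noetherian if every ascending chain of homogeneous ideals is stationary. $\mathsf{mod}^G R$ is the abelian category of finitely generated $G$-graded $R$-modules with degree-preserving homomorphisms. $(g)$ denotes the grading shift by $g\in G$; a subcategory $\mathcal{X}$ is closed under grading shifts if $X(g)\in\mathcal{X}$ for all $X\in\mathcal{X}$, $g\in G$. All subcategories are full and closed under isomorphisms. An additive subcategory $\mathcal{X}$ of an abelian category is: closed under images (resp. kernels, cokernels) if for every morphism $f\colon X\to Y$ with $X,Y\in\mathcal{X}$ we have $\operatorname{Im} f\in\mathcal{X}$ (resp. $\operatorname{Ker} f$, $\operatorname{Cok} f\in\mathcal{X}$); a torsion-free class if closed under subobjects and extensions; a torsion class if closed under quotients and extensions; Serre if closed under subobjects, quotients and extensions; wide if closed under kernels, cokernels and extensions; IE-closed if closed under images and extensions; IKE-closed if closed under images, kernels and extensions; ICE-closed if closed under images, cokernels and extensions; CE-closed if closed under cokernels and extensions. *)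

theory Defs
  imports "HOL-Algebra.Algebra"
begin

text \<open>
  The grading group G is written multiplicatively, as always in HOL-Algebra.
  A grading of M is a family of additive subgroups of which M is the internal direct sum:
  every x is the sum of a unique finitely supported family of homogeneous components.
\<close>

definition is_grading ::
    "('g, 'c) monoid_scheme \<Rightarrow> ('b, 'd) ring_scheme \<Rightarrow> ('g \<Rightarrow> 'b set) \<Rightarrow> bool" where
  "is_grading G M D \<longleftrightarrow>
     (\<forall>g\<in>carrier G. subgroup (D g) (add_monoid M)) \<and>
     (\<forall>x\<in>carrier M. \<exists>!c. c \<in> (\<Pi>\<^sub>E g\<in>carrier G. D g) \<and>
        finite {g \<in> carrier G. c g \<noteq> \<zero>\<^bsub>M\<^esub>} \<and>
        x = finsum M c {g \<in> carrier G. c g \<noteq> \<zero>\<^bsub>M\<^esub>})"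

record ('g, 'r) graded_ring = "'r ring" +
  rgrade :: "'g \<Rightarrow> 'r set"

text \<open>
  Modules of HOL-Algebra inherit the fields \<open>mult\<close> and \<open>one\<close> from rings. These fields,
  and the values of operations outside the carriers, carry no meaning; they are not
  seen by isomorphisms.
\<close>

record ('g, 'r, 'm) graded_module = "('r, 'm) module" +
  mgrade :: "'g \<Rightarrow> 'm set"

locale graded_cring = G: comm_group G + R: cring R
  for G :: "'g monoid" and R :: "('g, 'r) graded_ring" +
  assumes ring_grading: "is_grading G R (rgrade R)"
    and rgrade_mult:
      "\<lbrakk>g \<in> carrier G; h \<in> carrier G; a \<in> rgrade R g; b \<in> rgrade R h\<rbrakk>
        \<Longrightarrow> a \<otimes>\<^bsub>R\<^esub> b \<in> rgrade R (g \<otimes>\<^bsub>G\<^esub> h)"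

locale graded_module = graded_cring G R + M: module R M
  for G :: "'g monoid" and R :: "('g, 'r) graded_ring" and M :: "('g, 'r, 'm) graded_module" +
  assumes module_grading: "is_grading G M (mgrade M)"
    and mgrade_smult:
      "\<lbrakk>g \<in> carrier G; h \<in> carrier G; a \<in> rgrade R g; x \<in> mgrade M h\<rbrakk>
        \<Longrightarrow> a \<odot>\<^bsub>M\<^esub> x \<in> mgrade M (g \<otimes>\<^bsub>G\<^esub> h)"

definition homogeneous_ideal :: "'g monoid \<Rightarrow> ('g, 'r) graded_ring \<Rightarrow> 'r set \<Rightarrow> bool" where
  "homogeneous_ideal G R I \<longleftrightarrow>
     ideal I R \<and> I = Idl\<^bsub>R\<^esub> (I \<inter> (\<Union>g\<in>carrier G. rgrade R g))"

definition graded_noetherian :: "'g monoid \<Rightarrow> ('g, 'r) graded_ring \<Rightarrow> bool" where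
  "graded_noetherian G R \<longleftrightarrow>
     (\<forall>I :: nat \<Rightarrow> 'r set.
        (\<forall>n. homogeneous_ideal G R (I n)) \<and> (\<forall>n. I n \<subseteq> I (Suc n)) \<longrightarrow>
        (\<exists>N. \<forall>n\<ge>N. I n = I N))"


subsection \<open>The category of finitely generated graded modules\<close>

definition finitely_generated ::
    "('g, 'r) graded_ring \<Rightarrow> ('g, 'r, 'm) graded_module \<Rightarrow> bool" where
  "finitely_generated R M \<longleftrightarrow>
     (\<exists>S. finite S \<and> S \<subseteq> carrier M \<and>
        (\<forall>N. submodule N R M \<and> S \<subseteq> N \<longrightarrow> N = carrier M))"

definition gmod :: "'g monoid \<Rightarrow> ('g, 'r) graded_ring \<Rightarrow> ('g, 'r, 'm) graded_module set" where
  "gmod G R = {M. graded_module G R M \<and> finitely_generated R M}"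

definition ghom ::
    "'g monoid \<Rightarrow> ('g, 'r) graded_ring \<Rightarrow> ('g, 'r, 'm) graded_module \<Rightarrow>
     ('g, 'r, 'n) graded_module \<Rightarrow> ('m \<Rightarrow> 'n) set" where
  "ghom G R M N = {f \<in> hom (add_monoid M) (add_monoid N).
     (\<forall>a\<in>carrier R. \<forall>x\<in>carrier M. f (a \<odot>\<^bsub>M\<^esub> x) = a \<odot>\<^bsub>N\<^esub> f x) \<and>
     (\<forall>g\<in>carrier G. f ` mgrade M g \<subseteq> mgrade N g)}"

definition giso ::
    "'g monoid \<Rightarrow> ('g, 'r) graded_ring \<Rightarrow> ('g, 'r, 'm) graded_module \<Rightarrow>
     ('g, 'r, 'n) graded_module \<Rightarrow> bool" where
  "giso G R M N \<longleftrightarrow> (\<exists>f\<in>ghom G R M N. bij_betw f (carrier M) (carrier N))"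

definition gshift ::
    "'g monoid \<Rightarrow> ('g, 'r, 'm) graded_module \<Rightarrow> 'g \<Rightarrow> ('g, 'r, 'm) graded_module" where
  "gshift G M g = M\<lparr>mgrade := (\<lambda>h. mgrade M (h \<otimes>\<^bsub>G\<^esub> g))\<rparr>"

definition gsub :: "('g, 'r, 'm) graded_module \<Rightarrow> 'm set \<Rightarrow> ('g, 'r, 'm) graded_module" where
  "gsub M S = M\<lparr>carrier := S, mgrade := (\<lambda>g. mgrade M g \<inter> S)\<rparr>"

definition gquot ::
    "('g, 'r, 'm) graded_module \<Rightarrow> 'm set \<Rightarrow> ('g, 'r, 'm set) graded_module" where
  "gquot M S = \<lparr>carrier = a_rcosets\<^bsub>M\<^esub> S, monoid.mult = undefined, monoid.one = undefined,
     ring.zero = S, ring.add = set_add M,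
     smult = (\<lambda>a C. \<Union>x\<in>C. S +>\<^bsub>M\<^esub> (a \<odot>\<^bsub>M\<^esub> x)),
     mgrade = (\<lambda>g. (\<lambda>x. S +>\<^bsub>M\<^esub> x) ` mgrade M g)\<rparr>"

definition gKer ::
    "('g, 'r, 'm) graded_module \<Rightarrow> ('g, 'r, 'n) graded_module \<Rightarrow> ('m \<Rightarrow> 'n) \<Rightarrow>
     ('g, 'r, 'm) graded_module" where
  "gKer M N f = gsub M (a_kernel M N f)"

definition gIm ::
    "('g, 'r, 'm) graded_module \<Rightarrow> ('g, 'r, 'n) graded_module \<Rightarrow> ('m \<Rightarrow> 'n) \<Rightarrow>
     ('g, 'r, 'n) graded_module" where
  "gIm M N f = gsub N (f ` carrier M)"

definition gCok ::
    "('g, 'r, 'm) graded_module \<Rightarrow> ('g, 'r, 'n) graded_module \<Rightarrow> ('m \<Rightarrow> 'n) \<Rightarrow>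
     ('g, 'r, 'n set) graded_module" where
  "gCok M N f = gquot N (f ` carrier M)"

definition gsum ::
    "('g, 'r, 'm) graded_module \<Rightarrow> ('g, 'r, 'n) graded_module \<Rightarrow>
     ('g, 'r, 'm \<times> 'n) graded_module" where
  "gsum M N = \<lparr>carrier = carrier M \<times> carrier N, monoid.mult = undefined, monoid.one = undefined,
     ring.zero = (\<zero>\<^bsub>M\<^esub>, \<zero>\<^bsub>N\<^esub>),
     ring.add = (\<lambda>(x, y) (x', y'). (x \<oplus>\<^bsub>M\<^esub> x', y \<oplus>\<^bsub>N\<^esub> y')),
     smult = (\<lambda>a (x, y). (a \<odot>\<^bsub>M\<^esub> x, a \<odot>\<^bsub>N\<^esub> y)),
     mgrade = (\<lambda>g. mgrade M g \<times> mgrade N g)\<rparr>"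

definition short_exact ::
    "'g monoid \<Rightarrow> ('g, 'r) graded_ring \<Rightarrow> ('g, 'r, 'm) graded_module \<Rightarrow> ('m \<Rightarrow> 'm) \<Rightarrow>
     ('g, 'r, 'm) graded_module \<Rightarrow> ('m \<Rightarrow> 'm) \<Rightarrow> ('g, 'r, 'm) graded_module \<Rightarrow> bool" where
  "short_exact G R L i M p N \<longleftrightarrow>
     i \<in> ghom G R L M \<and> p \<in> ghom G R M N \<and>
     inj_on i (carrier L) \<and> i ` carrier L = a_kernel M N p \<and> p ` carrier M = carrier N"


lemma (in module) finite_span_card:
  fixes \<iota> :: "'a \<Rightarrow> 'm"
  assumes "finite S" "S \<subseteq> carrier M" "infinite (UNIV :: 'm set)" "inj_on \<iota> (carrier R)"
  shows "\<exists>T. submodule T R M \<and> S \<subseteq> T \<and> |T| \<le>o |UNIV :: 'm set|"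
  using assms(1,2)
proof (induction S)
  case empty
  have "submodule {\<zero>\<^bsub>M\<^esub>} R M" by (rule submoduleI) auto
  moreover have "|{\<zero>\<^bsub>M\<^esub>}| \<le>o |UNIV :: 'm set|"
    by (intro card_of_singl_ordLeq) simp
  ultimately show ?case by blast
next
  case (insert s S)
  then obtain T where T: "submodule T R M" "S \<subseteq> T" "|T| \<le>o |UNIV :: 'm set|" and s: "s \<in> carrier M"
    by auto
  note E = submoduleE[OF T(1)]
  have z: "\<zero>\<^bsub>M\<^esub> \<in> T" using T(1) by (metis submodule.axioms(1) subgroup.one_closed monoid.simps(2))
  define U where "U = (\<lambda>(a, t). a \<odot>\<^bsub>M\<^esub> s \<oplus>\<^bsub>M\<^esub> t) ` (carrier R \<times> T)"
  have U: "x \<in> U \<longleftrightarrow> (\<exists>a\<in>carrier R. \<exists>t\<in>T. x = a \<odot>\<^bsub>M\<^esub> s \<oplus>\<^bsub>M\<^esub> t)" for x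
    unfolding U_def by auto
  have UI: "a \<odot>\<^bsub>M\<^esub> s \<oplus>\<^bsub>M\<^esub> t \<in> U" if "a \<in> carrier R" "t \<in> T" for a t
    using that U by blast
  have UE: "\<exists>a t. a \<in> carrier R \<and> t \<in> T \<and> x = a \<odot>\<^bsub>M\<^esub> s \<oplus>\<^bsub>M\<^esub> t" if "x \<in> U" for x
    using that U by blast
  have tc: "t \<in> carrier M" if "t \<in> T" for t using E(1) that by auto
  have "submodule U R M"
  proof (rule submoduleI)
    show "U \<subseteq> carrier M" using U tc s by auto
    show "\<zero>\<^bsub>M\<^esub> \<in> U" using UI[OF R.zero_closed z] s by simp
  next
    fix x assume "x \<in> U"
    then obtain a t where a: "a \<in> carrier R" "t \<in> T" "x = a \<odot>\<^bsub>M\<^esub> s \<oplus>\<^bsub>M\<^esub> t" using UE by blast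
    have "\<ominus>\<^bsub>M\<^esub> x = (\<ominus>\<^bsub>R\<^esub> a) \<odot>\<^bsub>M\<^esub> s \<oplus>\<^bsub>M\<^esub> (\<ominus>\<^bsub>M\<^esub> t)"
      using a s tc by (simp add: M.minus_add smult_l_minus)
    then show "\<ominus>\<^bsub>M\<^esub> x \<in> U" using UI[OF R.a_inv_closed E(3), of a t] a by simp
  next
    fix x y assume "x \<in> U" "y \<in> U"
    obtain a t where a1: "a \<in> carrier R" "t \<in> T" "x = a \<odot>\<^bsub>M\<^esub> s \<oplus>\<^bsub>M\<^esub> t" using UE[OF \<open>x \<in> U\<close>] by blast
    obtain b u where a2: "b \<in> carrier R" "u \<in> T" "y = b \<odot>\<^bsub>M\<^esub> s \<oplus>\<^bsub>M\<^esub> u" using UE[OF \<open>y \<in> U\<close>] by blast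
    note a = a1 a2
    have "x \<oplus>\<^bsub>M\<^esub> y = (a \<oplus>\<^bsub>R\<^esub> b) \<odot>\<^bsub>M\<^esub> s \<oplus>\<^bsub>M\<^esub> (t \<oplus>\<^bsub>M\<^esub> u)"
      using a s tc by (simp add: smult_l_distr M.a_ac)
    then show "x \<oplus>\<^bsub>M\<^esub> y \<in> U" using UI[OF R.a_closed E(5), of a b t u] a by simp
  next
    fix b x assume b: "b \<in> carrier R" and "x \<in> U"
    then obtain a t where a: "a \<in> carrier R" "t \<in> T" "x = a \<odot>\<^bsub>M\<^esub> s \<oplus>\<^bsub>M\<^esub> t" using UE by blast
    have "b \<odot>\<^bsub>M\<^esub> x = (b \<otimes>\<^bsub>R\<^esub> a) \<odot>\<^bsub>M\<^esub> s \<oplus>\<^bsub>M\<^esub> (b \<odot>\<^bsub>M\<^esub> t)"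
      using a b s tc by (simp add: smult_r_distr smult_assoc1)
    then show "b \<odot>\<^bsub>M\<^esub> x \<in> U" using UI[OF R.m_closed E(4), of b a b t] a b by simp
  qed
  moreover have "insert s S \<subseteq> U"
  proof -
    have "\<one>\<^bsub>R\<^esub> \<odot>\<^bsub>M\<^esub> s \<oplus>\<^bsub>M\<^esub> \<zero>\<^bsub>M\<^esub> = s" using s by simp
    then have "s \<in> U" using UI[OF R.one_closed z] by simp
    moreover have "t \<in> U" if "t \<in> T" for t using UI[OF R.zero_closed that] s tc[OF that] by simp
    ultimately show ?thesis using T(2) by blast
  qed
  moreover have "|U| \<le>o |UNIV :: 'm set|"
  proof -
    have "|carrier R| \<le>o |UNIV :: 'm set|" using assms(4) card_of_ordLeq by blast
    then have "|carrier R \<times> T| \<le>o |UNIV :: 'm set|"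
      using T(3) assms(3) by (intro card_of_Times_ordLeq_infinite_Field) (auto simp: card_of_Card_order Field_card_of)
    then show ?thesis unfolding U_def using card_of_image ordLeq_transitive by blast
  qed
  ultimately show ?case by blast
qed

lemma giso_copy_in_universe:
  fixes M :: "('g, 'r, 'n) graded_module" and \<iota> :: "'r \<Rightarrow> 'm"
  assumes M: "M \<in> gmod G R" and inf: "infinite (UNIV :: 'm set)" and \<iota>: "inj_on \<iota> (carrier R)"
  shows "\<exists>N :: ('g, 'r, 'm) graded_module. N \<in> gmod G R \<and> giso G R M N"
proof -
  interpret graded_module G R M using M by (simp add: gmod_def)
  obtain S where S: "finite S" "S \<subseteq> carrier M" "\<And>N. submodule N R M \<Longrightarrow> S \<subseteq> N \<Longrightarrow> N = carrier M"
    using M by (auto simp: gmod_def finitely_generated_def)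
  obtain j :: "'n \<Rightarrow> 'm" where j: "inj_on j (carrier M)"
    using M.finite_span_card[OF S(1,2) inf \<iota>] S(3) card_of_ordLeq by metis
  define k where "k = the_inv_into (carrier M) j"
  have kj[simp]: "k (j x) = x" if "x \<in> carrier M" for x
    unfolding k_def using the_inv_into_f_f[OF j that] .
  define N :: "('g, 'r, 'm) graded_module" where
    "N = \<lparr>carrier = j ` carrier M, monoid.mult = undefined, monoid.one = undefined,
      ring.zero = j \<zero>\<^bsub>M\<^esub>, ring.add = (\<lambda>x y. j (k x \<oplus>\<^bsub>M\<^esub> k y)),
      smult = (\<lambda>a x. j (a \<odot>\<^bsub>M\<^esub> k x)), mgrade = (\<lambda>g. j ` mgrade M g)\<rparr>"
  have sel[simp]: "carrier N = j ` carrier M" "\<zero>\<^bsub>N\<^esub> = j \<zero>\<^bsub>M\<^esub>"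
      "x \<oplus>\<^bsub>N\<^esub> y = j (k x \<oplus>\<^bsub>M\<^esub> k y)" "a \<odot>\<^bsub>N\<^esub> x = j (a \<odot>\<^bsub>M\<^esub> k x)" "mgrade N g = j ` mgrade M g"
    for x y a g by (simp_all add: N_def)
  have ag: "abelian_group N"
  proof (rule abelian_groupI)
    fix x assume "x \<in> carrier N"
    then obtain u where "u \<in> carrier M" "x = j u" by auto
    then show "\<exists>y\<in>carrier N. y \<oplus>\<^bsub>N\<^esub> x = \<zero>\<^bsub>N\<^esub>"
      by (intro bexI[of _ "j (\<ominus>\<^bsub>M\<^esub> u)"]) (auto simp: M.M.l_neg)
  qed (auto simp: M.M.a_ac)
  have md: "module R N"
    by (rule moduleI) (use ag R.is_cring in \<open>auto simp: M.smult_l_distr M.smult_r_distr M.smult_assoc1\<close>)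
  interpret N: module R N by (rule md)
  have Dsub: "subgroup (mgrade M g) (add_monoid M)" if "g \<in> carrier G" for g
    using module_grading that by (simp add: is_grading_def)
  have Dc: "mgrade M g \<subseteq> carrier M" if "g \<in> carrier G" for g
    using subgroup.subset[OF Dsub[OF that]] by simp
  have fin: "finsum N (\<lambda>g. j (c g)) A = j (finsum M c A)" if "finite A" "c \<in> A \<rightarrow> carrier M" for A and c :: "'g \<Rightarrow> 'n"
    using that
  proof (induction A)
    case (insert a A)
    then have "finsum N (\<lambda>g. j (c g)) (insert a A) = j (c a) \<oplus>\<^bsub>N\<^esub> finsum N (\<lambda>g. j (c g)) A"
      by (intro N.finsum_insert) auto
    also have "\<dots> = j (finsum M c (insert a A))" using insert by (auto simp: Pi_def)
    finally show ?case .
  qed simp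
  have homj: "j \<in> hom (add_monoid M) (add_monoid N)" by (auto simp: hom_def)
  have gh: "group_hom (add_monoid M) (add_monoid N) j"
    using homj M.a_comm_group N.a_comm_group comm_group.axioms(2)
    by (intro group_hom.intro group_hom_axioms.intro) blast+
  have gr: "is_grading G N (mgrade N)"
    unfolding is_grading_def
  proof (intro conjI ballI)
    fix g assume "g \<in> carrier G"
    then show "subgroup (mgrade N g) (add_monoid N)"
      using group_hom.subgroup_img_is_subgroup[OF gh Dsub] by simp
  next
    fix x assume "x \<in> carrier N"
    then obtain u where u: "u \<in> carrier M" "x = j u" by auto
    let ?P = "\<lambda>c. c \<in> (\<Pi>\<^sub>E g\<in>carrier G. mgrade M g) \<and> finite {g \<in> carrier G. c g \<noteq> \<zero>\<^bsub>M\<^esub>} \<and>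
        u = finsum M c {g \<in> carrier G. c g \<noteq> \<zero>\<^bsub>M\<^esub>}"
    let ?Q = "\<lambda>d. d \<in> (\<Pi>\<^sub>E g\<in>carrier G. mgrade N g) \<and> finite {g \<in> carrier G. d g \<noteq> \<zero>\<^bsub>N\<^esub>} \<and>
        x = finsum N d {g \<in> carrier G. d g \<noteq> \<zero>\<^bsub>N\<^esub>}"
    have ex1: "\<exists>!c. ?P c" using module_grading u(1) unfolding is_grading_def by blast
    then obtain c where c: "?P c" by blast
    have c1: "c g \<in> carrier M" if "g \<in> carrier G" for g using c Dc that by blast
    have z: "j (c g) = j \<zero>\<^bsub>M\<^esub> \<longleftrightarrow> c g = \<zero>\<^bsub>M\<^esub>" if "g \<in> carrier G" for g
      using c1[OF that] inj_on_eq_iff[OF j] by simp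
    define d where "d = restrict (\<lambda>g. j (c g)) (carrier G)"
    have supp: "{g \<in> carrier G. d g \<noteq> \<zero>\<^bsub>N\<^esub>} = {g \<in> carrier G. c g \<noteq> \<zero>\<^bsub>M\<^esub>}"
      using z by (auto simp: d_def)
    have "?Q d"
    proof (intro conjI)
      show "d \<in> (\<Pi>\<^sub>E g\<in>carrier G. mgrade N g)" using c by (auto simp: d_def)
      show "finite {g \<in> carrier G. d g \<noteq> \<zero>\<^bsub>N\<^esub>}" using c supp by simp
      have "finsum N d {g \<in> carrier G. c g \<noteq> \<zero>\<^bsub>M\<^esub>} = finsum N (\<lambda>g. j (c g)) {g \<in> carrier G. c g \<noteq> \<zero>\<^bsub>M\<^esub>}"
        using c1 by (intro N.finsum_cong') (auto simp: d_def)
      also have "\<dots> = x" using c c1 u by (subst fin) auto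
      finally show "x = finsum N d {g \<in> carrier G. d g \<noteq> \<zero>\<^bsub>N\<^esub>}" using supp by simp
    qed
    moreover have "e = d" if e: "?Q e" for e
    proof -
      have e1: "e g \<in> j ` mgrade M g" if "g \<in> carrier G" for g using e that by auto
      have e2: "k (e g) \<in> mgrade M g \<and> j (k (e g)) = e g" if g: "g \<in> carrier G" for g
      proof -
        obtain y where "y \<in> mgrade M g" "e g = j y" using e1[OF g] by blast
        moreover from this have "y \<in> carrier M" using Dc[OF g] by blast
        ultimately show ?thesis by simp
      qed
      define b where "b = restrict (\<lambda>g. k (e g)) (carrier G)"
      have b1: "b g \<in> carrier M \<and> j (b g) = e g" if "g \<in> carrier G" for g
        using e2[OF that] Dc[OF that] that by (auto simp: b_def)
      have zb: "e g = j \<zero>\<^bsub>M\<^esub> \<longleftrightarrow> b g = \<zero>\<^bsub>M\<^esub>" if "g \<in> carrier G" for g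
        using b1[OF that] inj_on_eq_iff[OF j, of "b g" "\<zero>\<^bsub>M\<^esub>"] by auto
      have suppb: "{g \<in> carrier G. e g \<noteq> \<zero>\<^bsub>N\<^esub>} = {g \<in> carrier G. b g \<noteq> \<zero>\<^bsub>M\<^esub>}"
        using zb by auto
      have fb: "finite {g \<in> carrier G. b g \<noteq> \<zero>\<^bsub>M\<^esub>}" using e suppb by simp
      have "x = finsum N e {g \<in> carrier G. b g \<noteq> \<zero>\<^bsub>M\<^esub>}" using e suppb by simp
      also have "\<dots> = finsum N (\<lambda>g. j (b g)) {g \<in> carrier G. b g \<noteq> \<zero>\<^bsub>M\<^esub>}"
        using b1 by (intro N.finsum_cong') auto
      also have "\<dots> = j (finsum M b {g \<in> carrier G. b g \<noteq> \<zero>\<^bsub>M\<^esub>})"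
        using fb b1 by (intro fin) auto
      finally have "u = finsum M b {g \<in> carrier G. b g \<noteq> \<zero>\<^bsub>M\<^esub>}"
        using u b1 inj_onD[OF j] by (metis (no_types, lifting) M.M.finsum_closed Pi_I mem_Collect_eq)
      moreover have "b \<in> (\<Pi>\<^sub>E g\<in>carrier G. mgrade M g)" using e2 by (auto simp: b_def)
      ultimately have "?P b" using fb by blast
      then have "b = c" using ex1 c by blast
      then show "e = d"
        using e b1 by (intro ext) (auto simp: d_def restrict_def PiE_def extensional_def)
    qed
    ultimately show "\<exists>!d. ?Q d" by blast
  qed
  have gm: "graded_module G R N"
  proof (intro graded_module.intro graded_module_axioms.intro)
    show "graded_cring G R" by (rule graded_cring_axioms)
    show "module R N" by (rule md)
    show "is_grading G N (mgrade N)" by (rule gr)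
    fix g h a x assume "g \<in> carrier G" "h \<in> carrier G" "a \<in> rgrade R g" "x \<in> mgrade N h"
    then show "a \<odot>\<^bsub>N\<^esub> x \<in> mgrade N (g \<otimes>\<^bsub>G\<^esub> h)"
      using mgrade_smult Dc by fastforce
  qed
  have fg: "finitely_generated R N"
    unfolding finitely_generated_def
  proof (intro exI[of _ "j ` S"] conjI allI impI)
    show "finite (j ` S)" "j ` S \<subseteq> carrier N" using S by auto
    fix T assume T: "submodule T R N \<and> j ` S \<subseteq> T"
    note E = N.submoduleE[OF conjunct1[OF T]]
    define U where "U = {x \<in> carrier M. j x \<in> T}"
    have z: "\<zero>\<^bsub>N\<^esub> \<in> T" using T by (metis submodule.axioms(1) subgroup.one_closed monoid.simps(2))
    have "submodule U R M"
    proof (rule M.submoduleI)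
      fix x assume x: "x \<in> U"
      have "j (\<ominus>\<^bsub>M\<^esub> x) = \<ominus>\<^bsub>N\<^esub> (j x)"
        using x by (intro N.minus_equality[symmetric]) (auto simp: U_def M.M.l_neg)
      then show "\<ominus>\<^bsub>M\<^esub> x \<in> U" using x E(3) by (auto simp: U_def)
    next
      fix x y assume x: "x \<in> U" "y \<in> U"
      then show "x \<oplus>\<^bsub>M\<^esub> y \<in> U" using E(5)[of "j x" "j y"] by (auto simp: U_def)
    next
      fix a x assume x: "a \<in> carrier R" "x \<in> U"
      then show "a \<odot>\<^bsub>M\<^esub> x \<in> U" using E(4)[of a "j x"] by (auto simp: U_def)
    qed (use z in \<open>auto simp: U_def\<close>)
    moreover have "S \<subseteq> U" using T S by (auto simp: U_def)
    ultimately have "U = carrier M" using S(3) by blast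
    then show "T = carrier N" using E(1) by (auto simp: U_def)
  qed
  have "j \<in> ghom G R M N"
    using homj Dc by (auto simp: ghom_def)
  then have "giso G R M N" using j by (auto simp: giso_def bij_betw_def)
  then show ?thesis using gm fg by (auto simp: gmod_def)
qed


subsection \<open>Subcategories\<close>

text \<open>
  A full subcategory closed under isomorphisms is a set of objects. The carriers of the
  objects are subsets of a type \<open>'m\<close>, which plays the role of a universe: if \<open>'m\<close> is
  infinite and the carrier of R embeds into it, then every finitely generated graded R-module,
  whatever its carrier type, is isomorphic to one with carrier in \<open>'m\<close>
  (lemma \<open>giso_copy_in_universe\<close> above). Cokernels and direct sums, whose
  canonical constructions live on other types, are therefore compared with the subcategory
  up to isomorphism.
\<close>

definition subcategory ::
    "'g monoid \<Rightarrow> ('g, 'r) graded_ring \<Rightarrow> ('g, 'r, 'm) graded_module set \<Rightarrow> bool" where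
  "subcategory G R \<C> \<longleftrightarrow>
     \<C> \<subseteq> gmod G R \<and> (\<forall>M\<in>\<C>. \<forall>N\<in>gmod G R. giso G R M N \<longrightarrow> N \<in> \<C>)"

definition shift_closed ::
    "'g monoid \<Rightarrow> ('g, 'r, 'm) graded_module set \<Rightarrow> bool" where
  "shift_closed G \<C> \<longleftrightarrow> (\<forall>M\<in>\<C>. \<forall>g\<in>carrier G. gshift G M g \<in> \<C>)"

definition has_copy ::
    "'g monoid \<Rightarrow> ('g, 'r) graded_ring \<Rightarrow> ('g, 'r, 'm) graded_module set \<Rightarrow>
     ('g, 'r, 'n) graded_module \<Rightarrow> bool" where
  "has_copy G R \<C> M \<longleftrightarrow> (\<exists>N\<in>\<C>. giso G R M N)"

definition additive_subcategory ::
    "'g monoid \<Rightarrow> ('g, 'r) graded_ring \<Rightarrow> ('g, 'r, 'm) graded_module set \<Rightarrow> bool" where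
  "additive_subcategory G R \<C> \<longleftrightarrow> subcategory G R \<C> \<and>
     (\<exists>Z\<in>\<C>. carrier Z = {\<zero>\<^bsub>Z\<^esub>}) \<and> (\<forall>M\<in>\<C>. \<forall>N\<in>\<C>. has_copy G R \<C> (gsum M N))"

definition closed_subobjects ::
    "'g monoid \<Rightarrow> ('g, 'r) graded_ring \<Rightarrow> ('g, 'r, 'm) graded_module set \<Rightarrow> bool" where
  "closed_subobjects G R \<C> \<longleftrightarrow>
     (\<forall>M\<in>\<C>. \<forall>L\<in>gmod G R. \<forall>i\<in>ghom G R L M. inj_on i (carrier L) \<longrightarrow> L \<in> \<C>)"

definition closed_quotients ::
    "'g monoid \<Rightarrow> ('g, 'r) graded_ring \<Rightarrow> ('g, 'r, 'm) graded_module set \<Rightarrow> bool" where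
  "closed_quotients G R \<C> \<longleftrightarrow>
     (\<forall>M\<in>\<C>. \<forall>N\<in>gmod G R. \<forall>p\<in>ghom G R M N. p ` carrier M = carrier N \<longrightarrow> N \<in> \<C>)"

definition closed_extensions ::
    "'g monoid \<Rightarrow> ('g, 'r) graded_ring \<Rightarrow> ('g, 'r, 'm) graded_module set \<Rightarrow> bool" where
  "closed_extensions G R \<C> \<longleftrightarrow>
     (\<forall>L\<in>\<C>. \<forall>N\<in>\<C>. \<forall>M\<in>gmod G R. \<forall>i p. short_exact G R L i M p N \<longrightarrow> M \<in> \<C>)"

definition closed_images ::
    "'g monoid \<Rightarrow> ('g, 'r) graded_ring \<Rightarrow> ('g, 'r, 'm) graded_module set \<Rightarrow> bool" where
  "closed_images G R \<C> \<longleftrightarrow> (\<forall>M\<in>\<C>. \<forall>N\<in>\<C>. \<forall>f\<in>ghom G R M N. gIm M N f \<in> \<C>)"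

definition closed_kernels ::
    "'g monoid \<Rightarrow> ('g, 'r) graded_ring \<Rightarrow> ('g, 'r, 'm) graded_module set \<Rightarrow> bool" where
  "closed_kernels G R \<C> \<longleftrightarrow> (\<forall>M\<in>\<C>. \<forall>N\<in>\<C>. \<forall>f\<in>ghom G R M N. gKer M N f \<in> \<C>)"

definition closed_cokernels ::
    "'g monoid \<Rightarrow> ('g, 'r) graded_ring \<Rightarrow> ('g, 'r, 'm) graded_module set \<Rightarrow> bool" where
  "closed_cokernels G R \<C> \<longleftrightarrow>
     (\<forall>M\<in>\<C>. \<forall>N\<in>\<C>. \<forall>f\<in>ghom G R M N. has_copy G R \<C> (gCok M N f))"

definition serre_subcategory ::
    "'g monoid \<Rightarrow> ('g, 'r) graded_ring \<Rightarrow> ('g, 'r, 'm) graded_module set \<Rightarrow> bool" where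
  "serre_subcategory G R \<C> \<longleftrightarrow> additive_subcategory G R \<C> \<and>
     closed_subobjects G R \<C> \<and> closed_quotients G R \<C> \<and> closed_extensions G R \<C>"

definition torsion_class ::
    "'g monoid \<Rightarrow> ('g, 'r) graded_ring \<Rightarrow> ('g, 'r, 'm) graded_module set \<Rightarrow> bool" where
  "torsion_class G R \<C> \<longleftrightarrow> additive_subcategory G R \<C> \<and>
     closed_quotients G R \<C> \<and> closed_extensions G R \<C>"

definition torsion_free_class ::
    "'g monoid \<Rightarrow> ('g, 'r) graded_ring \<Rightarrow> ('g, 'r, 'm) graded_module set \<Rightarrow> bool" where
  "torsion_free_class G R \<C> \<longleftrightarrow> additive_subcategory G R \<C> \<and>
     closed_subobjects G R \<C> \<and> closed_extensions G R \<C>"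

definition wide_subcategory ::
    "'g monoid \<Rightarrow> ('g, 'r) graded_ring \<Rightarrow> ('g, 'r, 'm) graded_module set \<Rightarrow> bool" where
  "wide_subcategory G R \<C> \<longleftrightarrow> additive_subcategory G R \<C> \<and>
     closed_kernels G R \<C> \<and> closed_cokernels G R \<C> \<and> closed_extensions G R \<C>"

definition IE_closed ::
    "'g monoid \<Rightarrow> ('g, 'r) graded_ring \<Rightarrow> ('g, 'r, 'm) graded_module set \<Rightarrow> bool" where
  "IE_closed G R \<C> \<longleftrightarrow> additive_subcategory G R \<C> \<and>
     closed_images G R \<C> \<and> closed_extensions G R \<C>"

definition IKE_closed ::
    "'g monoid \<Rightarrow> ('g, 'r) graded_ring \<Rightarrow> ('g, 'r, 'm) graded_module set \<Rightarrow> bool" where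
  "IKE_closed G R \<C> \<longleftrightarrow> additive_subcategory G R \<C> \<and>
     closed_images G R \<C> \<and> closed_kernels G R \<C> \<and> closed_extensions G R \<C>"

definition ICE_closed ::
    "'g monoid \<Rightarrow> ('g, 'r) graded_ring \<Rightarrow> ('g, 'r, 'm) graded_module set \<Rightarrow> bool" where
  "ICE_closed G R \<C> \<longleftrightarrow> additive_subcategory G R \<C> \<and>
     closed_images G R \<C> \<and> closed_cokernels G R \<C> \<and> closed_extensions G R \<C>"

definition CE_closed ::
    "'g monoid \<Rightarrow> ('g, 'r) graded_ring \<Rightarrow> ('g, 'r, 'm) graded_module set \<Rightarrow> bool" where
  "CE_closed G R \<C> \<longleftrightarrow> additive_subcategory G R \<C> \<and>
     closed_cokernels G R \<C> \<and> closed_extensions G R \<C>"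

end

(*
  Everything rests on one construction: if M is finitely generated and y is a homogeneous
  element of a graded module Y whose annihilator I is prime (for homogeneous elements) and
  contains the annihilator of M, then some shift M(g) has a nonzero homomorphism into Ry.

  IE-closed subcategories: let N be a submodule of M in C and let L be maximal among the
  submodules of N lying in C. If L < N, choose y in N/L with prime annihilator, f : M(g) -> Ry
  nonzero, and form the pullback E of M -> M/L <- M(g). It is an extension of M(g) by L, so it
  is in C, and its image in M is a submodule of N in C that is strictly larger than L.

  CE-closed subcategories: C contains every N with Ann M <= Ann N for some M in C. In a
  counterexample with Ann N maximal, one may reduce to N = Ry with Ann y = I prime, and to
  f : M -> N nonzero with IM = 0. If f x = a y, then a - s f, where s y = x, is an endomorphism
  of M (up to shift) whose image lies in the kernel of f, so f factors through its cokernel Q.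
  The kernel of Q -> N and the cokernel of f are killed by I and by a, which is not in I, so
  they are in C by maximality. Hence so are the image of f and N.
*)
theory Submission
  imports Defs
begin

subsection \<open>Gradings and homogeneous components\<close>

text \<open>Commutativity enters by making multiplication by a homogeneous element of degree d a
  morphism M(d^-1) -> M; closure under shifts keeps its source in C, so ring elements yield
  morphisms between objects of C. The nonzero map into Ry exists because M has a quotient M/F that
  is torsion free of rank one over R/I: a suitable homogeneous s outside I carries M/F into a cyclic
  module isomorphic to Ry up to shift. The obstacle for IE-closed C is that neither M/L nor Ry need
  lie in C. The pullback avoids this: it is seen to be in C as an extension, and only its image in M
  is used. The obstacle for CE-closed C is the lack of kernels. Dividing M by the image of a - s f
  replaces f by a map with a kernel killed by a, so that maximality of Ann N does the work of
  closure under kernels. The condition IM = 0 is what makes s well defined; it is reached by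
  dividing out bM for homogeneous b in I, which never kills a nonzero map into a module annihilated
  by I.\<close>

locale graded_group = M: abelian_group M
  for G :: "'g monoid" and M :: "('b, 'd) ring_scheme" (structure) and D :: "'g \<Rightarrow> 'b set" +
  assumes grading: "is_grading G M D"
begin

lemma subgroup_D: "g \<in> carrier G \<Longrightarrow> subgroup (D g) (add_monoid M)"
  using grading unfolding is_grading_def by blast

lemma D_closed: "g \<in> carrier G \<Longrightarrow> x \<in> D g \<Longrightarrow> x \<in> carrier M"
  using subgroup.mem_carrier[OF subgroup_D] by fastforce

lemma D_zero: "g \<in> carrier G \<Longrightarrow> \<zero> \<in> D g"
  using subgroup.one_closed[OF subgroup_D] by fastforce

lemma D_add: "g \<in> carrier G \<Longrightarrow> x \<in> D g \<Longrightarrow> y \<in> D g \<Longrightarrow> x \<oplus> y \<in> D g"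
  using subgroup.m_closed[OF subgroup_D] by fastforce

lemma D_minus: "g \<in> carrier G \<Longrightarrow> x \<in> D g \<Longrightarrow> \<ominus> x \<in> D g"
  using subgroup.m_inv_closed[OF subgroup_D] by (fastforce simp: a_inv_def)

text \<open>The description is legitimate by the unique existence in \<open>is_grading\<close>. The
  family is extensional, so only its values on \<open>carrier G\<close> are meaningful and the facts
  below restrict the degree accordingly.\<close>

definition component :: "'b \<Rightarrow> 'g \<Rightarrow> 'b" where
  "component x = (THE c. c \<in> (\<Pi>\<^sub>E g\<in>carrier G. D g) \<and>
        finite {g \<in> carrier G. c g \<noteq> \<zero>} \<and> x = finsum M c {g \<in> carrier G. c g \<noteq> \<zero>})"

lemma comp_props:
  assumes "x \<in> carrier M"
  shows "component x \<in> (\<Pi>\<^sub>E g\<in>carrier G. D g)" "finite {g \<in> carrier G. component x g \<noteq> \<zero>}"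
    "x = finsum M (component x) {g \<in> carrier G. component x g \<noteq> \<zero>}"
proof -
  have "\<exists>!c. c \<in> (\<Pi>\<^sub>E g\<in>carrier G. D g) \<and>
        finite {g \<in> carrier G. c g \<noteq> \<zero>} \<and> x = finsum M c {g \<in> carrier G. c g \<noteq> \<zero>}"
    using grading assms unfolding is_grading_def by blast
  from theI'[OF this] show "component x \<in> (\<Pi>\<^sub>E g\<in>carrier G. D g)" "finite {g \<in> carrier G. component x g \<noteq> \<zero>}"
    "x = finsum M (component x) {g \<in> carrier G. component x g \<noteq> \<zero>}"
    unfolding component_def by blast+
qed

lemma comp_mem: "x \<in> carrier M \<Longrightarrow> g \<in> carrier G \<Longrightarrow> component x g \<in> D g"
  using comp_props(1) by blast

lemma comp_closed: "x \<in> carrier M \<Longrightarrow> g \<in> carrier G \<Longrightarrow> component x g \<in> carrier M"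
  using comp_mem D_closed by blast

text \<open>Padding the support with degrees whose component is zero allows two elements to be
  expanded over one common finite set.\<close>

lemma comp_finsum:
  assumes "x \<in> carrier M" "finite A" "A \<subseteq> carrier G" "{g \<in> carrier G. component x g \<noteq> \<zero>} \<subseteq> A"
  shows "x = finsum M (component x) A"
proof -
  have "finsum M (component x) {g \<in> carrier G. component x g \<noteq> \<zero>} = finsum M (component x) A"
    using assms comp_closed by (intro M.add.finprod_mono_neutral_cong_left) auto
  then show ?thesis using comp_props(3)[OF assms(1)] by simp
qed

text \<open>Extending the family by zero turns any finite sum of homogeneous terms of distinct
  degrees into the decomposition of \<open>is_grading\<close>. Zero terms are allowed, so
  \<open>A\<close> may exceed the support.\<close>

lemma comp_unique:
  assumes "finite A" "A \<subseteq> carrier G" "\<And>g. g \<in> A \<Longrightarrow> c g \<in> D g" "x = finsum M c A" "h \<in> carrier G"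
  shows "component x h = (if h \<in> A then c h else \<zero>)"
proof -
  have cM: "c \<in> A \<rightarrow> carrier M" using assms(2,3) D_closed by blast
  then have x: "x \<in> carrier M" using assms by auto
  define c' where "c' = restrict (\<lambda>g. if g \<in> A then c g else \<zero>) (carrier G)"
  have "c' \<in> (\<Pi>\<^sub>E g\<in>carrier G. D g)" using assms(3) D_zero by (auto simp: c'_def)
  moreover have "finite {g \<in> carrier G. c' g \<noteq> \<zero>}"
    using assms(1) by (rule finite_subset[rotated]) (auto simp: c'_def split: if_splits)
  moreover have "finsum M c' {g \<in> carrier G. c' g \<noteq> \<zero>} = finsum M c A"
    using assms(1,2) cM by (intro M.add.finprod_mono_neutral_cong_left) (auto simp: c'_def split: if_splits)
  moreover have "\<exists>!c. c \<in> (\<Pi>\<^sub>E g\<in>carrier G. D g) \<and>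
        finite {g \<in> carrier G. c g \<noteq> \<zero>} \<and> x = finsum M c {g \<in> carrier G. c g \<noteq> \<zero>}"
    using grading x unfolding is_grading_def by blast
  ultimately have "component x = c'"
    unfolding component_def using assms(4) by (intro the1_equality conjI) auto
  then show ?thesis using assms(5) by (simp add: c'_def)
qed

lemma comp_homogeneous:
  "h \<in> carrier G \<Longrightarrow> x \<in> D h \<Longrightarrow> g \<in> carrier G \<Longrightarrow> component x g = (if g = h then x else \<zero>)"
  using comp_unique[of "{h}" "\<lambda>_. x" x g] D_closed[of h x] by auto

lemma comp_zero: "g \<in> carrier G \<Longrightarrow> component \<zero> g = \<zero>"
  using comp_unique[of "{}" "\<lambda>_. \<zero>" \<zero> g] by auto

lemma comp_add:
  assumes x: "x \<in> carrier M" and y: "y \<in> carrier M" and g: "g \<in> carrier G"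
  shows "component (x \<oplus> y) g = component x g \<oplus> component y g"
proof -
  let ?A = "{g \<in> carrier G. component x g \<noteq> \<zero>} \<union> {g \<in> carrier G. component y g \<noteq> \<zero>}"
  have A: "finite ?A" "?A \<subseteq> carrier G" using comp_props(2) x y by auto
  have "x \<oplus> y = finsum M (component x) ?A \<oplus> finsum M (component y) ?A"
    using comp_finsum[OF x A] comp_finsum[OF y A] by auto
  also have "\<dots> = finsum M (\<lambda>g. component x g \<oplus> component y g) ?A"
    using A comp_closed x y by (intro M.finsum_addf[symmetric]) auto
  finally have "component (x \<oplus> y) g = (if g \<in> ?A then component x g \<oplus> component y g else \<zero>)"
    using A comp_mem x y D_add g by (intro comp_unique) auto
  then show ?thesis using g by (auto split: if_splits)
qed

lemma comp_minus:
  assumes x: "x \<in> carrier M" and g: "g \<in> carrier G"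
  shows "component (\<ominus> x) g = \<ominus> component x g"
proof -
  have "component (\<ominus> x) g \<oplus> component x g = \<zero>"
    using comp_add[OF M.a_inv_closed[OF x] x g] comp_zero[OF g] x by (simp add: M.l_neg)
  then show ?thesis using x g comp_closed M.minus_equality by simp
qed

text \<open>Here the property is tested only on the components of the given x, which suits
  membership in a homogeneous submodule; \<open>homogeneous_induct\<close> is the coarser form that
  tests all homogeneous elements.\<close>

lemma sum_of_comps:
  assumes x: "x \<in> carrier M" and "P \<zero>"
    and "\<And>g. g \<in> carrier G \<Longrightarrow> P (component x g)"
    and add: "\<And>u v. u \<in> carrier M \<Longrightarrow> v \<in> carrier M \<Longrightarrow> P u \<Longrightarrow> P v \<Longrightarrow> P (u \<oplus> v)"
  shows "P x"
proof -
  have "P (finsum M (component x) A)" if "finite A" "A \<subseteq> carrier G" for A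
    using that
  proof (induction A)
    case (insert a A)
    then have "finsum M (component x) (insert a A) = component x a \<oplus> finsum M (component x) A"
      using comp_closed[OF x] by (intro M.finsum_insert) auto
    moreover have "finsum M (component x) A \<in> carrier M"
      using insert comp_closed[OF x] by (intro M.finsum_closed) auto
    ultimately show ?case using insert assms comp_closed[OF x] by simp
  qed (use assms in simp)
  then show ?thesis using comp_props(2,3)[OF x] by (metis (no_types, lifting) mem_Collect_eq subsetI)
qed

lemma homogeneous_induct [consumes 1, case_names zero homogeneous add]:
  assumes "x \<in> carrier M" and "P \<zero>"
    and "\<And>g u. g \<in> carrier G \<Longrightarrow> u \<in> D g \<Longrightarrow> P u"
    and "\<And>u v. u \<in> carrier M \<Longrightarrow> v \<in> carrier M \<Longrightarrow> P u \<Longrightarrow> P v \<Longrightarrow> P (u \<oplus> v)"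
  shows "P x"
  using assms sum_of_comps[of x P] comp_mem by blast

end

section \<open>Additive maps and gradings: transport of components, criteria for a grading\<close>

lemma hom_finsum:
  assumes "abelian_group M" "abelian_group N" "f \<in> hom (add_monoid M) (add_monoid N)"
    and "finite A" "c \<in> A \<rightarrow> carrier M"
  shows "f (finsum M c A) = finsum N (\<lambda>a. f (c a)) A"
proof -
  interpret M: abelian_group M by fact
  interpret N: abelian_group N by fact
  have add: "f (x \<oplus>\<^bsub>M\<^esub> y) = f x \<oplus>\<^bsub>N\<^esub> f y" and cl: "f x \<in> carrier N"
    if "x \<in> carrier M" "y \<in> carrier M" for x y using assms(3) that by (auto simp: hom_def)
  have "f \<zero>\<^bsub>M\<^esub> \<oplus>\<^bsub>N\<^esub> f \<zero>\<^bsub>M\<^esub> = f \<zero>\<^bsub>M\<^esub>" using add[of "\<zero>\<^bsub>M\<^esub>" "\<zero>\<^bsub>M\<^esub>"] by simp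
  then have z: "f \<zero>\<^bsub>M\<^esub> = \<zero>\<^bsub>N\<^esub>" using cl[OF M.zero_closed M.zero_closed] by (simp add: N.add.l_cancel_one)
  from assms(4,5) show ?thesis
  proof (induction A)
    case (insert a A)
    have "f (finsum M c (insert a A)) = f (c a \<oplus>\<^bsub>M\<^esub> finsum M c A)"
      using insert by (subst M.finsum_insert) auto
    also have "\<dots> = f (c a) \<oplus>\<^bsub>N\<^esub> finsum N (\<lambda>a. f (c a)) A" using insert by (simp add: add Pi_def)
    also have "\<dots> = finsum N (\<lambda>a. f (c a)) (insert a A)"
      using insert cl by (intro N.finsum_insert[symmetric]) (auto simp: Pi_def)
    finally show ?case .
  qed (simp add: z)
qed

text \<open>Uniqueness reduces to independence: two families with the same sum differ, over the
  union of their supports, by a homogeneous family with sum zero.\<close>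

lemma is_gradingI:
  assumes "abelian_group M"
    and sub: "\<And>g. g \<in> carrier G \<Longrightarrow> subgroup (D g) (add_monoid M)"
    and gen: "\<And>x. x \<in> carrier M \<Longrightarrow>
      \<exists>A c. finite A \<and> A \<subseteq> carrier G \<and> (\<forall>g\<in>A. c g \<in> D g) \<and> x = finsum M c A"
    and ind: "\<And>A c g. finite A \<Longrightarrow> A \<subseteq> carrier G \<Longrightarrow> (\<forall>g\<in>A. c g \<in> D g) \<Longrightarrow>
      finsum M c A = \<zero>\<^bsub>M\<^esub> \<Longrightarrow> g \<in> A \<Longrightarrow> c g = \<zero>\<^bsub>M\<^esub>"
  shows "is_grading G M D"
  unfolding is_grading_def
proof (intro conjI ballI ex_ex1I)
  interpret M: abelian_group M by fact
  have Dc: "x \<in> carrier M" if "g \<in> carrier G" "x \<in> D g" for g x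
    using subgroup.mem_carrier[OF sub[OF that(1)] that(2)] by simp
  have D0: "\<zero>\<^bsub>M\<^esub> \<in> D g" if "g \<in> carrier G" for g
    using subgroup.one_closed[OF sub[OF that]] by simp
  have Dm: "x \<oplus>\<^bsub>M\<^esub> \<ominus>\<^bsub>M\<^esub> y \<in> D g" if "g \<in> carrier G" "x \<in> D g" "y \<in> D g" for g x y
    using subgroup.m_closed[OF sub[OF that(1)] that(2) subgroup.m_inv_closed[OF sub[OF that(1)] that(3)]]
    by (simp add: a_inv_def)
  fix x assume x: "x \<in> carrier M"
  let ?P = "\<lambda>c. c \<in> (\<Pi>\<^sub>E g\<in>carrier G. D g) \<and> finite {g \<in> carrier G. c g \<noteq> \<zero>\<^bsub>M\<^esub>} \<and>
        x = finsum M c {g \<in> carrier G. c g \<noteq> \<zero>\<^bsub>M\<^esub>}"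
  show "\<exists>c. ?P c"
  proof -
    obtain A c where A: "finite A" "A \<subseteq> carrier G" "\<forall>g\<in>A. c g \<in> D g" "x = finsum M c A"
      using gen[OF x] by blast
    define c' where "c' = restrict (\<lambda>g. if g \<in> A then c g else \<zero>\<^bsub>M\<^esub>) (carrier G)"
    have "c' \<in> (\<Pi>\<^sub>E g\<in>carrier G. D g)" using A(3) D0 by (auto simp: c'_def)
    moreover have "finite {g \<in> carrier G. c' g \<noteq> \<zero>\<^bsub>M\<^esub>}"
      using A(1) by (rule finite_subset[rotated]) (auto simp: c'_def split: if_splits)
    moreover have "finsum M c' {g \<in> carrier G. c' g \<noteq> \<zero>\<^bsub>M\<^esub>} = finsum M c A"
      using A Dc by (intro M.add.finprod_mono_neutral_cong_left) (auto simp: c'_def split: if_splits)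
    ultimately show ?thesis using A by auto
  qed
  fix c d assume c: "?P c" and d: "?P d"
  let ?A = "{g \<in> carrier G. c g \<noteq> \<zero>\<^bsub>M\<^esub>} \<union> {g \<in> carrier G. d g \<noteq> \<zero>\<^bsub>M\<^esub>}"
  have cc: "c g \<in> D g" "d g \<in> D g" if "g \<in> carrier G" for g using c d that by blast+
  have ccl: "c g \<in> carrier M" "d g \<in> carrier M" if "g \<in> carrier G" for g using cc[OF that] Dc[OF that] by blast+
  have fin: "finite ?A" using c d by simp
  have xc: "x = finsum M c ?A"
  proof -
    have "x = finsum M c {g \<in> carrier G. c g \<noteq> \<zero>\<^bsub>M\<^esub>}" using c by blast
    also have "\<dots> = finsum M c ?A"
      using fin ccl by (intro M.add.finprod_mono_neutral_cong_left) auto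
    finally show ?thesis .
  qed
  have xd: "x = finsum M d ?A"
  proof -
    have "x = finsum M d {g \<in> carrier G. d g \<noteq> \<zero>\<^bsub>M\<^esub>}" using d by blast
    also have "\<dots> = finsum M d ?A"
      using fin ccl by (intro M.add.finprod_mono_neutral_cong_left) auto
    finally show ?thesis .
  qed
  have "finsum M (\<lambda>g. c g \<oplus>\<^bsub>M\<^esub> \<ominus>\<^bsub>M\<^esub> d g) ?A = finsum M c ?A \<oplus>\<^bsub>M\<^esub> finsum M (\<lambda>g. \<ominus>\<^bsub>M\<^esub> d g) ?A"
    using ccl by (intro M.finsum_addf) auto
  also have "finsum M (\<lambda>g. \<ominus>\<^bsub>M\<^esub> d g) ?A = \<ominus>\<^bsub>M\<^esub> finsum M d ?A"
    using fin ccl hom_finsum[OF assms(1) assms(1), of "\<lambda>x. \<ominus>\<^bsub>M\<^esub> x" ?A d]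
    by (auto simp: hom_def M.minus_add)
  finally have sum0: "finsum M (\<lambda>g. c g \<oplus>\<^bsub>M\<^esub> \<ominus>\<^bsub>M\<^esub> d g) ?A = \<zero>\<^bsub>M\<^esub>"
    using xc xd x by (simp add: M.r_neg)
  have *: "c g \<oplus>\<^bsub>M\<^esub> \<ominus>\<^bsub>M\<^esub> d g = \<zero>\<^bsub>M\<^esub>" if "g \<in> ?A" for g
  proof (rule ind[OF fin _ _ _ that])
    show "\<forall>g\<in>?A. c g \<oplus>\<^bsub>M\<^esub> \<ominus>\<^bsub>M\<^esub> d g \<in> D g" using cc Dm by blast
  qed (use sum0 in auto)
  have eq: "c g = d g" if g: "g \<in> carrier G" for g
  proof (cases "g \<in> ?A")
    case True
    show ?thesis using *[OF True] ccl[OF g] M.minus_equality[of "c g" "\<ominus>\<^bsub>M\<^esub> d g"] M.minus_minus by simp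
  qed (use g in auto)
  show "c = d"
    using c d eq by (intro extensionalityI[of c "carrier G" d]) (auto simp: PiE_def)
qed (use sub in blast)

text \<open>The reindexing \<tau> admits maps that move degrees, such as multiplication by a
  homogeneous element. Injectivity of \<tau> keeps different components from landing in the same
  degree.\<close>

lemma comp_hom:
  assumes "graded_group G M D" "graded_group G N E" "f \<in> hom (add_monoid M) (add_monoid N)"
    and \<tau>: "\<And>g. g \<in> carrier G \<Longrightarrow> \<tau> g \<in> carrier G" "inj_on \<tau> (carrier G)"
    and f: "\<And>g x. g \<in> carrier G \<Longrightarrow> x \<in> D g \<Longrightarrow> f x \<in> E (\<tau> g)"
    and x: "x \<in> carrier M" and g: "g \<in> carrier G"
  shows "graded_group.component G N E (f x) (\<tau> g) = f (graded_group.component G M D x g)"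
proof -
  interpret M: graded_group G M D by fact
  interpret N: graded_group G N E by fact
  have add_f: "f (x \<oplus>\<^bsub>M\<^esub> y) = f x \<oplus>\<^bsub>N\<^esub> f y" and cl: "f x \<in> carrier N"
    if "x \<in> carrier M" "y \<in> carrier M" for x y using assms(3) that by (auto simp: hom_def)
  have "f \<zero>\<^bsub>M\<^esub> \<oplus>\<^bsub>N\<^esub> f \<zero>\<^bsub>M\<^esub> = f \<zero>\<^bsub>M\<^esub>" using add_f[of "\<zero>\<^bsub>M\<^esub>" "\<zero>\<^bsub>M\<^esub>"] by simp
  then have z: "f \<zero>\<^bsub>M\<^esub> = \<zero>\<^bsub>N\<^esub>"
    using cl[OF M.M.zero_closed M.M.zero_closed] by (simp add: N.M.add.l_cancel_one)
  show ?thesis using x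
  proof (induction x rule: M.homogeneous_induct)
    case (homogeneous h u)
    then show ?case
      using N.comp_homogeneous[OF \<tau>(1)[OF homogeneous(1)] f[OF homogeneous] \<tau>(1)[OF g]] M.comp_homogeneous[OF homogeneous g]
        inj_on_eq_iff[OF \<tau>(2) g homogeneous(1)] z by simp
  next
    case (add u v)
    then show ?case using g \<tau>(1)[OF g] by (simp add: add_f cl M.comp_add N.comp_add M.comp_closed)
  qed (use g \<tau>(1)[OF g] z M.comp_zero N.comp_zero in simp)
qed

text \<open>Applying the candidate projection \<pi> g to a vanishing sum isolates its term of degree
  g, which gives independence. Submodules, shifts and quotients have obvious projections, so this is
  how their gradings are obtained. The existence of decompositions enters as an induction
  principle.\<close>

lemma is_gradingI_projections:
  assumes "abelian_group M"
    and D: "\<And>g. g \<in> carrier G \<Longrightarrow> D g \<subseteq> carrier M" "\<And>g. g \<in> carrier G \<Longrightarrow> \<zero>\<^bsub>M\<^esub> \<in> D g"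
      "\<And>g x y. g \<in> carrier G \<Longrightarrow> x \<in> D g \<Longrightarrow> y \<in> D g \<Longrightarrow> x \<oplus>\<^bsub>M\<^esub> y \<in> D g"
    and gen: "\<And>x P. x \<in> carrier M \<Longrightarrow> P \<zero>\<^bsub>M\<^esub> \<Longrightarrow> (\<And>g u. g \<in> carrier G \<Longrightarrow> u \<in> D g \<Longrightarrow> P u) \<Longrightarrow>
      (\<And>u v. u \<in> carrier M \<Longrightarrow> v \<in> carrier M \<Longrightarrow> P u \<Longrightarrow> P v \<Longrightarrow> P (u \<oplus>\<^bsub>M\<^esub> v)) \<Longrightarrow> P x"
    and hom: "\<And>g. g \<in> carrier G \<Longrightarrow> \<pi> g \<in> hom (add_monoid M) (add_monoid M)"
    and \<pi>: "\<And>g h u. g \<in> carrier G \<Longrightarrow> h \<in> carrier G \<Longrightarrow> u \<in> D h \<Longrightarrow> \<pi> g u = (if g = h then u else \<zero>\<^bsub>M\<^esub>)"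
  shows "is_grading G M D"
proof (rule is_gradingI[OF assms(1)])
  interpret M: abelian_group M by fact
  have \<pi>add: "\<pi> g (x \<oplus>\<^bsub>M\<^esub> y) = \<pi> g x \<oplus>\<^bsub>M\<^esub> \<pi> g y"
    if "g \<in> carrier G" "x \<in> carrier M" "y \<in> carrier M" for g x y
    using hom[OF that(1)] that by (auto simp: hom_def)
  have \<pi>cl: "\<pi> g x \<in> carrier M" if "g \<in> carrier G" "x \<in> carrier M" for g x
    using hom[OF that(1)] that by (auto simp: hom_def)
  have \<pi>0: "\<pi> g \<zero>\<^bsub>M\<^esub> = \<zero>\<^bsub>M\<^esub>" if "g \<in> carrier G" for g using \<pi>[OF that that D(2)[OF that]] by simp
  have \<pi>D: "\<pi> g z \<in> D g" if g: "g \<in> carrier G" and z: "z \<in> carrier M" for g z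
  proof (rule gen[OF z, of "\<lambda>z. \<pi> g z \<in> D g"])
    show "\<pi> g \<zero>\<^bsub>M\<^esub> \<in> D g" using \<pi>0[OF g] D(2)[OF g] by simp
    show "\<pi> g u \<in> D g" if "h \<in> carrier G" "u \<in> D h" for h u
      using \<pi>[OF g that] D(2)[OF g] that by (cases "g = h") simp_all
    show "\<pi> g (u \<oplus>\<^bsub>M\<^esub> v) \<in> D g"
      if "u \<in> carrier M" "v \<in> carrier M" "\<pi> g u \<in> D g" "\<pi> g v \<in> D g" for u v
      using \<pi>add[OF g that(1,2)] D(3)[OF g that(3,4)] by simp
  qed
  {
    \<comment> \<open>Closure under negatives is not assumed: \<pi> g fixes x, hence also its
      negative, and all values of \<pi> g lie in \<open>D g\<close>.\<close>
    fix g assume g: "g \<in> carrier G"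
    have "\<ominus>\<^bsub>M\<^esub> x \<in> D g" if x: "x \<in> D g" for x
    proof -
      have xM: "x \<in> carrier M" using D(1)[OF g] x by blast
      have "\<pi> g (\<ominus>\<^bsub>M\<^esub> x) \<oplus>\<^bsub>M\<^esub> x = \<zero>\<^bsub>M\<^esub>"
        using \<pi>add[OF g, of "\<ominus>\<^bsub>M\<^esub> x" x] \<pi>[OF g g x] xM \<pi>0[OF g] by (simp add: M.l_neg)
      then have "\<pi> g (\<ominus>\<^bsub>M\<^esub> x) = \<ominus>\<^bsub>M\<^esub> x" using xM \<pi>cl[OF g] by (intro M.minus_equality[symmetric]) auto
      then show ?thesis using \<pi>D[OF g, of "\<ominus>\<^bsub>M\<^esub> x"] xM by simp
    qed
    then show "subgroup (D g) (add_monoid M)"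
      using D[OF g] by (intro M.add.subgroupI) (auto simp: a_inv_def)
  next
    fix x assume x: "x \<in> carrier M"
    show "\<exists>A c. finite A \<and> A \<subseteq> carrier G \<and> (\<forall>g\<in>A. c g \<in> D g) \<and> x = finsum M c A"
    proof (rule gen[OF x, of "\<lambda>x. \<exists>A c. finite A \<and> A \<subseteq> carrier G \<and> (\<forall>g\<in>A. c g \<in> D g) \<and> x = finsum M c A"])
      show "\<exists>A c. finite A \<and> A \<subseteq> carrier G \<and> (\<forall>g\<in>A. c g \<in> D g) \<and> \<zero>\<^bsub>M\<^esub> = finsum M c A"
        by (rule exI[of _ "{}"]) simp
    next
      fix g u assume "g \<in> carrier G" "u \<in> D g"
      then show "\<exists>A c. finite A \<and> A \<subseteq> carrier G \<and> (\<forall>g\<in>A. c g \<in> D g) \<and> u = finsum M c A"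
        using subsetD[OF D(1)] by (intro exI[of _ "{g}"] exI[of _ "\<lambda>_. u"]) simp
    next
      fix u v
      assume "\<exists>A c. finite A \<and> A \<subseteq> carrier G \<and> (\<forall>g\<in>A. c g \<in> D g) \<and> u = finsum M c A"
        and "\<exists>A c. finite A \<and> A \<subseteq> carrier G \<and> (\<forall>g\<in>A. c g \<in> D g) \<and> v = finsum M c A"
      then obtain A B c d where A: "finite A" "A \<subseteq> carrier G" "\<forall>g\<in>A. c g \<in> D g" "u = finsum M c A"
        and B: "finite B" "B \<subseteq> carrier G" "\<forall>g\<in>B. d g \<in> D g" "v = finsum M d B" by blast
      let ?c = "\<lambda>g. if g \<in> A then c g else \<zero>\<^bsub>M\<^esub>" and ?d = "\<lambda>g. if g \<in> B then d g else \<zero>\<^bsub>M\<^esub>"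
      have cl: "?c g \<in> D g" "?d g \<in> D g" if "g \<in> carrier G" for g using A(3) B(3) D(2)[OF that] by auto
      have cl': "?c g \<in> carrier M" "?d g \<in> carrier M" if "g \<in> carrier G" for g
        using cl[OF that] D(1)[OF that] by blast+
      have "finsum M c A = finsum M ?c (A \<union> B)" "finsum M d B = finsum M ?d (A \<union> B)"
        using A B cl' by (intro M.add.finprod_mono_neutral_cong_left; force)+
      moreover have "finsum M (\<lambda>g. ?c g \<oplus>\<^bsub>M\<^esub> ?d g) (A \<union> B) = finsum M ?c (A \<union> B) \<oplus>\<^bsub>M\<^esub> finsum M ?d (A \<union> B)"
        using A B cl' by (intro M.finsum_addf) blast+
      moreover have "\<forall>g\<in>A \<union> B. ?c g \<oplus>\<^bsub>M\<^esub> ?d g \<in> D g" using A(2) B(2) cl D(3) by blast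
      ultimately show "\<exists>A c. finite A \<and> A \<subseteq> carrier G \<and> (\<forall>g\<in>A. c g \<in> D g) \<and> u \<oplus>\<^bsub>M\<^esub> v = finsum M c A"
        using A B by (intro exI[of _ "A \<union> B"] exI[of _ "\<lambda>g. ?c g \<oplus>\<^bsub>M\<^esub> ?d g"]) simp
    qed
  next
    fix A c g
    assume A: "finite A" "A \<subseteq> carrier G" "\<forall>g\<in>A. c g \<in> D g" "finsum M c A = \<zero>\<^bsub>M\<^esub>" "g \<in> A"
    have cM: "c \<in> A \<rightarrow> carrier M" using A(2,3) D(1) by blast
    have g: "g \<in> carrier G" using A by blast
    have "\<zero>\<^bsub>M\<^esub> = \<pi> g (finsum M c A)" using A(4) \<pi>0[OF g] by simp
    also have "\<dots> = finsum M (\<lambda>h. \<pi> g (c h)) A"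
      by (rule hom_finsum[OF assms(1) assms(1) hom[OF g] A(1) cM])
    also have "\<dots> = finsum M (\<lambda>h. if g = h then c h else \<zero>\<^bsub>M\<^esub>) A"
      using A(2,3) \<pi>[OF g] cM by (intro M.finsum_cong') auto
    also have "\<dots> = c g" by (rule M.add.finprod_singleton[OF A(5,1)]) (use cM in simp)
    finally show "c g = \<zero>\<^bsub>M\<^esub>" by simp
  }
qed

subsection \<open>Homogeneous submodules and ideals\<close>

sublocale graded_cring \<subseteq> RG: graded_group G R "rgrade R"
  by (intro graded_group.intro graded_group_axioms.intro ring_grading R.abelian_group_axioms)

sublocale graded_module \<subseteq> H: graded_group G M "mgrade M"
  by (intro graded_group.intro graded_group_axioms.intro module_grading M.abelian_group_axioms)

text \<open>Homogeneity is expressed through components, which is easy to verify for annihilators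
  and colon ideals; \<open>homogeneous_ideal\<close> speaks of homogeneous generators
  instead.\<close>

definition hideal :: "'g monoid \<Rightarrow> ('g, 'r) graded_ring \<Rightarrow> 'r set \<Rightarrow> bool" where
  "hideal G R I \<longleftrightarrow> ideal I R \<and>
     (\<forall>a\<in>I. \<forall>g\<in>carrier G. graded_group.component G R (rgrade R) a g \<in> I)"

definition hsub ::
    "'g monoid \<Rightarrow> ('g, 'r) graded_ring \<Rightarrow> ('g, 'r, 'm) graded_module \<Rightarrow> 'm set \<Rightarrow> bool" where
  "hsub G R M S \<longleftrightarrow> submodule S R M \<and>
     (\<forall>x\<in>S. \<forall>g\<in>carrier G. graded_group.component G M (mgrade M) x g \<in> S)"

definition ann :: "('g, 'r) graded_ring \<Rightarrow> ('g, 'r, 'm) graded_module \<Rightarrow> 'm set \<Rightarrow> 'r set" where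
  "ann R M A = {r \<in> carrier R. \<forall>x\<in>A. r \<odot>\<^bsub>M\<^esub> x = \<zero>\<^bsub>M\<^esub>}"

definition cyclic :: "('g, 'r) graded_ring \<Rightarrow> ('g, 'r, 'm) graded_module \<Rightarrow> 'm \<Rightarrow> 'm set" where
  "cyclic R M y = {r \<odot>\<^bsub>M\<^esub> y | r. r \<in> carrier R}"

lemma cyclicI: "r \<in> carrier R \<Longrightarrow> r \<odot>\<^bsub>M\<^esub> y \<in> cyclic R M y"
  unfolding cyclic_def by blast

lemma cyclicE:
  assumes "x \<in> cyclic R M y" obtains r where "r \<in> carrier R" "x = r \<odot>\<^bsub>M\<^esub> y"
  using assms unfolding cyclic_def by blast

lemma set_add_iff: "x \<in> S <+>\<^bsub>M\<^esub> T \<longleftrightarrow> (\<exists>s\<in>S. \<exists>t\<in>T. x = s \<oplus>\<^bsub>M\<^esub> t)"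
  unfolding set_add_defs by auto

context graded_cring begin

text \<open>The bridge to the form in which the noetherian hypothesis is stated: the components of
  an element of I are homogeneous elements of I, and the element is their sum.\<close>

lemma hideal_homogeneous_ideal:
  assumes "hideal G R I" shows "homogeneous_ideal G R I"
proof -
  interpret I: ideal I R using assms by (simp add: hideal_def)
  let ?H = "I \<inter> (\<Union>g\<in>carrier G. rgrade R g)"
  have HI: "?H \<subseteq> I" "?H \<subseteq> carrier R" using I.Icarr by auto
  interpret J: ideal "Idl\<^bsub>R\<^esub> ?H" R by (rule R.genideal_ideal[OF HI(2)])
  have "a \<in> Idl\<^bsub>R\<^esub> ?H" if "a \<in> I" for a
    using I.Icarr[OF that]
  proof (rule RG.sum_of_comps)
    fix g assume "g \<in> carrier G"
    then have "RG.component a g \<in> ?H" using assms that RG.comp_mem[OF I.Icarr[OF that]] unfolding hideal_def by blast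
    then show "RG.component a g \<in> Idl\<^bsub>R\<^esub> ?H" using R.genideal_self[OF HI(2)] by blast
  qed (auto intro: J.a_closed)
  then show ?thesis
    unfolding homogeneous_ideal_def using I.ideal_axioms R.genideal_minimal[OF _ HI(1)] by blast
qed

end

context graded_module begin

lemma hsubI:
  assumes "S \<subseteq> carrier M" "\<zero>\<^bsub>M\<^esub> \<in> S" "\<And>x y. x \<in> S \<Longrightarrow> y \<in> S \<Longrightarrow> x \<oplus>\<^bsub>M\<^esub> y \<in> S"
    and sm: "\<And>a x. a \<in> carrier R \<Longrightarrow> x \<in> S \<Longrightarrow> a \<odot>\<^bsub>M\<^esub> x \<in> S"
    and "\<And>x g. x \<in> S \<Longrightarrow> g \<in> carrier G \<Longrightarrow> H.component x g \<in> S"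
  shows "hsub G R M S"
proof -
  have "\<ominus>\<^bsub>M\<^esub> x \<in> S" if "x \<in> S" for x
    using sm[of "\<ominus>\<^bsub>R\<^esub> \<one>\<^bsub>R\<^esub>" x] that assms(1) M.smult_l_minus[of "\<one>\<^bsub>R\<^esub>" x] by auto
  then show ?thesis unfolding hsub_def using assms by (auto intro: M.submoduleI)
qed

lemma hsubD:
  assumes "hsub G R M S"
  shows "S \<subseteq> carrier M" "\<zero>\<^bsub>M\<^esub> \<in> S" "x \<in> S \<Longrightarrow> x \<in> carrier M" "x \<in> S \<Longrightarrow> y \<in> S \<Longrightarrow> x \<oplus>\<^bsub>M\<^esub> y \<in> S"
    "a \<in> carrier R \<Longrightarrow> x \<in> S \<Longrightarrow> a \<odot>\<^bsub>M\<^esub> x \<in> S" "x \<in> S \<Longrightarrow> \<ominus>\<^bsub>M\<^esub> x \<in> S"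
    "x \<in> S \<Longrightarrow> g \<in> carrier G \<Longrightarrow> H.component x g \<in> S"
proof -
  have s: "submodule S R M" using assms by (simp add: hsub_def)
  note E = M.submoduleE[OF s]
  show "S \<subseteq> carrier M" "x \<in> S \<Longrightarrow> x \<in> carrier M" "x \<in> S \<Longrightarrow> y \<in> S \<Longrightarrow> x \<oplus>\<^bsub>M\<^esub> y \<in> S"
    "a \<in> carrier R \<Longrightarrow> x \<in> S \<Longrightarrow> a \<odot>\<^bsub>M\<^esub> x \<in> S" "x \<in> S \<Longrightarrow> \<ominus>\<^bsub>M\<^esub> x \<in> S" using E by auto
  show "\<zero>\<^bsub>M\<^esub> \<in> S" using submodule.axioms(1)[OF s] subgroup.one_closed by fastforce
  show "x \<in> S \<Longrightarrow> g \<in> carrier G \<Longrightarrow> H.component x g \<in> S" using assms by (simp add: hsub_def)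
qed

lemma hsub_diff:
  assumes "hsub G R M S" "x \<in> carrier M" "y \<in> S" "x \<oplus>\<^bsub>M\<^esub> y \<in> S" shows "x \<in> S"
proof -
  have "x = (x \<oplus>\<^bsub>M\<^esub> y) \<oplus>\<^bsub>M\<^esub> \<ominus>\<^bsub>M\<^esub> y"
    using assms hsubD(3)[OF assms(1)] by (simp add: M.a_assoc M.r_neg)
  then show ?thesis using hsubD(4)[OF assms(1,4) hsubD(6)[OF assms(1,3)]] by simp
qed

lemma comp_smult_homogeneous:
  assumes "d \<in> carrier G" "a \<in> rgrade R d" "x \<in> carrier M" "g \<in> carrier G"
  shows "H.component (a \<odot>\<^bsub>M\<^esub> x) (d \<otimes>\<^bsub>G\<^esub> g) = a \<odot>\<^bsub>M\<^esub> H.component x g"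
  using assms RG.D_closed[OF assms(1,2)] mgrade_smult
  by (intro comp_hom[OF H.graded_group_axioms H.graded_group_axioms])
     (auto simp: hom_def M.smult_r_distr inj_on_def)

text \<open>An instance of \<open>comp_hom\<close> for the additive map r -> r y from R to M, whose
  effect on degrees is right translation by the degree of y.\<close>

lemma comp_smult_right:
  assumes "e \<in> carrier G" "y \<in> mgrade M e" "r \<in> carrier R" "g \<in> carrier G"
  shows "H.component (r \<odot>\<^bsub>M\<^esub> y) (g \<otimes>\<^bsub>G\<^esub> e) = RG.component r g \<odot>\<^bsub>M\<^esub> y"
  using assms H.D_closed[OF assms(1,2)] mgrade_smult
  by (intro comp_hom[OF RG.graded_group_axioms H.graded_group_axioms, where f = "\<lambda>r. r \<odot>\<^bsub>M\<^esub> y"])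
     (auto simp: hom_def M.smult_l_distr inj_on_def)

text \<open>The same rule solved for the factor, for use when the degree of the product is
  prescribed.\<close>

lemma comp_smult_homogeneous':
  assumes "d \<in> carrier G" "a \<in> rgrade R d" "x \<in> carrier M" "k \<in> carrier G"
  shows "H.component (a \<odot>\<^bsub>M\<^esub> x) k = a \<odot>\<^bsub>M\<^esub> H.component x (inv\<^bsub>G\<^esub> d \<otimes>\<^bsub>G\<^esub> k)"
  using comp_smult_homogeneous[OF assms(1-3), of "inv\<^bsub>G\<^esub> d \<otimes>\<^bsub>G\<^esub> k"] assms
  by (simp add: G.m_assoc[symmetric])

lemma comp_smult_right':
  assumes "e \<in> carrier G" "y \<in> mgrade M e" "r \<in> carrier R" "k \<in> carrier G"
  shows "H.component (r \<odot>\<^bsub>M\<^esub> y) k = RG.component r (k \<otimes>\<^bsub>G\<^esub> inv\<^bsub>G\<^esub> e) \<odot>\<^bsub>M\<^esub> y"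
  using comp_smult_right[OF assms(1-3), of "k \<otimes>\<^bsub>G\<^esub> inv\<^bsub>G\<^esub> e"] assms by (simp add: G.m_assoc)

lemma hsub_carrier: "hsub G R M (carrier M)"
  by (rule hsubI) (auto simp: H.comp_closed)

lemma hsub_zero: "hsub G R M {\<zero>\<^bsub>M\<^esub>}"
  by (rule hsubI) (auto simp: H.comp_zero)

lemma hsub_cyclic:
  assumes "e \<in> carrier G" "y \<in> mgrade M e" shows "hsub G R M (cyclic R M y)"
proof (rule hsubI)
  have y: "y \<in> carrier M" using H.D_closed assms by blast
  show "cyclic R M y \<subseteq> carrier M" using y by (auto simp: cyclic_def)
  show "\<zero>\<^bsub>M\<^esub> \<in> cyclic R M y" using cyclicI[OF R.zero_closed, of M y] y by simp
next
  fix u v assume "u \<in> cyclic R M y" "v \<in> cyclic R M y"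
  then obtain a b where "a \<in> carrier R" "b \<in> carrier R" "u = a \<odot>\<^bsub>M\<^esub> y" "v = b \<odot>\<^bsub>M\<^esub> y" by (metis cyclicE)
  then show "u \<oplus>\<^bsub>M\<^esub> v \<in> cyclic R M y"
    using cyclicI[OF R.a_closed, of a b M y] H.D_closed[OF assms] by (simp add: M.smult_l_distr)
next
  fix a u assume "a \<in> carrier R" "u \<in> cyclic R M y"
  then show "a \<odot>\<^bsub>M\<^esub> u \<in> cyclic R M y"
    using H.D_closed[OF assms] by (metis M.smult_assoc1 R.m_closed cyclicE cyclicI)
next
  fix u g assume "u \<in> cyclic R M y" "g \<in> carrier G"
  then show "H.component u g \<in> cyclic R M y"
    using comp_smult_right'[OF assms] assms(1)
    by (metis G.inv_closed G.m_closed RG.comp_closed cyclicE cyclicI)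
qed

lemma self_in_cyclic: "y \<in> carrier M \<Longrightarrow> y \<in> cyclic R M y"
  using cyclicI[OF R.one_closed, of M y] by simp

lemma cyclic_subset: "hsub G R M S \<Longrightarrow> y \<in> S \<Longrightarrow> cyclic R M y \<subseteq> S"
  using hsubD(5) by (auto simp: cyclic_def)

lemma hsub_add:
  assumes S: "hsub G R M S" and T: "hsub G R M T" shows "hsub G R M (S <+>\<^bsub>M\<^esub> T)"
proof (rule hsubI)
  note s = hsubD[OF S] and t = hsubD[OF T]
  show "S <+>\<^bsub>M\<^esub> T \<subseteq> carrier M" using s(3) t(3) by (auto simp: set_add_iff)
  have "\<zero>\<^bsub>M\<^esub> = \<zero>\<^bsub>M\<^esub> \<oplus>\<^bsub>M\<^esub> \<zero>\<^bsub>M\<^esub>" by simp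
  then show "\<zero>\<^bsub>M\<^esub> \<in> S <+>\<^bsub>M\<^esub> T" using s(2) t(2) unfolding set_add_iff by blast
next
  note s = hsubD[OF S] and t = hsubD[OF T]
  fix x y assume "x \<in> S <+>\<^bsub>M\<^esub> T" "y \<in> S <+>\<^bsub>M\<^esub> T"
  then obtain a b c d where *: "a \<in> S" "b \<in> T" "c \<in> S" "d \<in> T" "x = a \<oplus>\<^bsub>M\<^esub> b" "y = c \<oplus>\<^bsub>M\<^esub> d"
    unfolding set_add_iff by blast
  then have "x \<oplus>\<^bsub>M\<^esub> y = (a \<oplus>\<^bsub>M\<^esub> c) \<oplus>\<^bsub>M\<^esub> (b \<oplus>\<^bsub>M\<^esub> d)" using s(3) t(3) by (simp add: M.a_ac)
  then show "x \<oplus>\<^bsub>M\<^esub> y \<in> S <+>\<^bsub>M\<^esub> T" using * s(4) t(4) unfolding set_add_iff by blast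
next
  note s = hsubD[OF S] and t = hsubD[OF T]
  fix a x assume a: "a \<in> carrier R" and "x \<in> S <+>\<^bsub>M\<^esub> T"
  then obtain u v where *: "u \<in> S" "v \<in> T" "x = u \<oplus>\<^bsub>M\<^esub> v" unfolding set_add_iff by blast
  then have "a \<odot>\<^bsub>M\<^esub> x = a \<odot>\<^bsub>M\<^esub> u \<oplus>\<^bsub>M\<^esub> a \<odot>\<^bsub>M\<^esub> v" using a s(3) t(3) by (simp add: M.smult_r_distr)
  then show "a \<odot>\<^bsub>M\<^esub> x \<in> S <+>\<^bsub>M\<^esub> T" using * a s(5) t(5) unfolding set_add_iff by blast
next
  note s = hsubD[OF S] and t = hsubD[OF T]
  fix x g assume g: "g \<in> carrier G" and "x \<in> S <+>\<^bsub>M\<^esub> T"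
  then obtain u v where *: "u \<in> S" "v \<in> T" "x = u \<oplus>\<^bsub>M\<^esub> v" unfolding set_add_iff by blast
  then have "H.component x g = H.component u g \<oplus>\<^bsub>M\<^esub> H.component v g" using g s(3) t(3) by (simp add: H.comp_add)
  then show "H.component x g \<in> S <+>\<^bsub>M\<^esub> T" using * g s(7) t(7) unfolding set_add_iff by blast
qed

lemma add_left_subset: "hsub G R M S \<Longrightarrow> hsub G R M T \<Longrightarrow> S \<subseteq> S <+>\<^bsub>M\<^esub> T"
proof
  fix x assume *: "hsub G R M S" "hsub G R M T" "x \<in> S"
  then have "x = x \<oplus>\<^bsub>M\<^esub> \<zero>\<^bsub>M\<^esub>" using hsubD(3)[OF *(1,3)] by simp
  then show "x \<in> S <+>\<^bsub>M\<^esub> T" using * hsubD(2)[OF *(2)] unfolding set_add_iff by blast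
qed

lemma add_right_subset: "hsub G R M S \<Longrightarrow> hsub G R M T \<Longrightarrow> T \<subseteq> S <+>\<^bsub>M\<^esub> T"
proof
  fix x assume *: "hsub G R M S" "hsub G R M T" "x \<in> T"
  then have "x = \<zero>\<^bsub>M\<^esub> \<oplus>\<^bsub>M\<^esub> x" using hsubD(3)[OF *(2,3)] by simp
  then show "x \<in> S <+>\<^bsub>M\<^esub> T" using * hsubD(2)[OF *(1)] unfolding set_add_iff by blast
qed

lemma add_least: "hsub G R M U \<Longrightarrow> S \<subseteq> U \<Longrightarrow> T \<subseteq> U \<Longrightarrow> S <+>\<^bsub>M\<^esub> T \<subseteq> U"
  unfolding set_add_iff[abs_def] subset_eq using hsubD(4) by (metis set_add_iff)

text \<open>If all components of x were in S, their sum x would be. The witness is returned as a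
  component of x so that it stays in every homogeneous submodule that contains x.\<close>

lemma hsub_homogeneous_notin:
  assumes S: "hsub G R M S" and x: "x \<in> carrier M" "x \<notin> S"
  obtains g y where "g \<in> carrier G" "y \<in> mgrade M g" "y \<notin> S" "y = H.component x g"
proof -
  have "\<exists>g\<in>carrier G. H.component x g \<notin> S"
  proof (rule ccontr)
    assume "\<not> ?thesis"
    then have "x \<in> S" using x(1) hsubD(2,4)[OF S] by (intro H.sum_of_comps[of x "\<lambda>x. x \<in> S"]) auto
    with x show False by blast
  qed
  then show ?thesis using that H.comp_mem[OF x(1)] by blast
qed

text \<open>The condition on components is loose enough to cover both the whole module and a single
  homogeneous element, the two cases used later.\<close>

lemma hideal_ann:
  assumes A: "A \<subseteq> carrier M" and c: "\<And>x g. x \<in> A \<Longrightarrow> g \<in> carrier G \<Longrightarrow> H.component x g \<in> insert \<zero>\<^bsub>M\<^esub> A"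
  shows "hideal G R (ann R M A)"
  unfolding hideal_def
proof (intro conjI ballI)
  show "ideal (ann R M A) R"
  proof (rule idealI)
    show "subgroup (ann R M A) (add_monoid R)"
      using A by (intro R.add.subgroupI)
        (auto simp: ann_def M.smult_l_distr M.smult_l_minus subset_eq a_inv_def[symmetric] intro: exI[of _ "\<zero>\<^bsub>R\<^esub>"])
    fix a r assume *: "a \<in> ann R M A" "r \<in> carrier R"
    then have "(r \<otimes>\<^bsub>R\<^esub> a) \<odot>\<^bsub>M\<^esub> x = \<zero>\<^bsub>M\<^esub>" if "x \<in> A" for x
      using A that by (auto simp: ann_def M.smult_assoc1 subset_eq)
    then show "r \<otimes>\<^bsub>R\<^esub> a \<in> ann R M A" "a \<otimes>\<^bsub>R\<^esub> r \<in> ann R M A"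
      using * R.m_comm[of a r] by (simp_all add: ann_def)
  qed (rule R.ring_axioms)
next
  fix r h assume r: "r \<in> ann R M A" and h: "h \<in> carrier G"
  have rR: "r \<in> carrier R" using r by (simp add: ann_def)
  have "RG.component r h \<odot>\<^bsub>M\<^esub> x = \<zero>\<^bsub>M\<^esub>" if x: "x \<in> A" for x
  proof -
    have xM: "x \<in> carrier M" using x A by blast
    \<comment> \<open>For homogeneous \<open>H.component x g\<close>, this product is one component
      of r times that element, which is zero.\<close>
    have *: "RG.component r h \<odot>\<^bsub>M\<^esub> H.component x g = \<zero>\<^bsub>M\<^esub>" if g: "g \<in> carrier G" for g
    proof -
      have "r \<odot>\<^bsub>M\<^esub> H.component x g = \<zero>\<^bsub>M\<^esub>" using c[OF x g] r by (auto simp: ann_def)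
      then show ?thesis
        using comp_smult_right[OF g H.comp_mem[OF xM g] rR h] H.comp_zero h g by simp
    qed
    from xM show ?thesis
      by (rule H.sum_of_comps) (use * RG.comp_closed[OF rR h] in \<open>auto simp: M.smult_r_distr\<close>)
  qed
  then show "RG.component r h \<in> ann R M A" using RG.comp_closed[OF rR h] by (simp add: ann_def)
qed

lemma hideal_ann_carrier: "hideal G R (ann R M (carrier M))"
  by (rule hideal_ann) (auto simp: H.comp_closed)

lemma hideal_ann_homogeneous:
  "g \<in> carrier G \<Longrightarrow> y \<in> mgrade M g \<Longrightarrow> hideal G R (ann R M {y})"
  by (rule hideal_ann) (auto simp: H.comp_homogeneous H.D_closed)

end

subsection \<open>Homomorphisms of graded modules\<close>

locale graded_hom = M: graded_module G R M + N: graded_module G R N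
  for G :: "'g monoid" and R :: "('g, 'r) graded_ring"
    and M :: "('g, 'r, 'm) graded_module" and N :: "('g, 'r, 'n) graded_module" +
  fixes f :: "'m \<Rightarrow> 'n"
  assumes f_ghom: "f \<in> ghom G R M N"
begin

lemma f_hom: "f \<in> hom (add_monoid M) (add_monoid N)" using f_ghom by (simp add: ghom_def)

lemma f_closed [simp]: "x \<in> carrier M \<Longrightarrow> f x \<in> carrier N" using f_hom by (auto simp: hom_def)

lemma f_add: "x \<in> carrier M \<Longrightarrow> y \<in> carrier M \<Longrightarrow> f (x \<oplus>\<^bsub>M\<^esub> y) = f x \<oplus>\<^bsub>N\<^esub> f y"
  using f_hom by (auto simp: hom_def)

lemma f_smult: "a \<in> carrier R \<Longrightarrow> x \<in> carrier M \<Longrightarrow> f (a \<odot>\<^bsub>M\<^esub> x) = a \<odot>\<^bsub>N\<^esub> f x"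
  using f_ghom by (simp add: ghom_def)

lemma f_degree: "g \<in> carrier G \<Longrightarrow> x \<in> mgrade M g \<Longrightarrow> f x \<in> mgrade N g"
  using f_ghom by (simp add: ghom_def image_subset_iff)

lemma f_zero [simp]: "f \<zero>\<^bsub>M\<^esub> = \<zero>\<^bsub>N\<^esub>"
  using f_smult[of "\<zero>\<^bsub>R\<^esub>" "\<zero>\<^bsub>M\<^esub>"] by simp

lemma f_minus: "x \<in> carrier M \<Longrightarrow> f (\<ominus>\<^bsub>M\<^esub> x) = \<ominus>\<^bsub>N\<^esub> f x"
  using f_add[of "\<ominus>\<^bsub>M\<^esub> x" x] N.M.minus_equality[of "f (\<ominus>\<^bsub>M\<^esub> x)" "f x"] by (simp add: M.M.l_neg)

lemma f_comp: "x \<in> carrier M \<Longrightarrow> g \<in> carrier G \<Longrightarrow> N.H.component (f x) g = f (M.H.component x g)"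
  using comp_hom[OF M.H.graded_group_axioms N.H.graded_group_axioms f_hom, of "\<lambda>g. g" x g] f_degree
  by simp

lemma mem_kernel: "x \<in> a_kernel M N f \<longleftrightarrow> x \<in> carrier M \<and> f x = \<zero>\<^bsub>N\<^esub>"
  by (simp add: a_kernel_def')

lemma hsub_vimage:
  assumes "hsub G R N T" shows "hsub G R M {x \<in> carrier M. f x \<in> T}"
  using N.hsubD[OF assms] M.H.comp_closed
  by (intro M.hsubI) (auto simp: f_add f_smult f_comp[symmetric])

lemma hsub_kernel: "hsub G R M (a_kernel M N f)"
  using hsub_vimage[OF N.hsub_zero] by (simp add: a_kernel_def')

lemma hsub_image:
  assumes "hsub G R M S" shows "hsub G R N (f ` S)"
proof (rule N.hsubI)
  note S = M.hsubD[OF assms]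
  show "f ` S \<subseteq> carrier N" using S(3) by auto
  show "\<zero>\<^bsub>N\<^esub> \<in> f ` S" using S(2) f_zero by (metis imageI)
  show "u \<oplus>\<^bsub>N\<^esub> v \<in> f ` S" if "u \<in> f ` S" "v \<in> f ` S" for u v
    using that f_add S(3,4) by (smt (verit) image_iff)
  show "a \<odot>\<^bsub>N\<^esub> u \<in> f ` S" if "a \<in> carrier R" "u \<in> f ` S" for u a
    using that f_smult S(3,5) by (smt (verit) image_iff)
  show "N.H.component u g \<in> f ` S" if "u \<in> f ` S" "g \<in> carrier G" for u g
    using that f_comp S(3,7) by (smt (verit) image_iff)
qed

lemma inj_on_iff_kernel: "inj_on f (carrier M) \<longleftrightarrow> a_kernel M N f = {\<zero>\<^bsub>M\<^esub>}"
proof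
  assume "inj_on f (carrier M)"
  then show "a_kernel M N f = {\<zero>\<^bsub>M\<^esub>}"
    unfolding a_kernel_def' using inj_on_eq_iff[of f "carrier M" _ "\<zero>\<^bsub>M\<^esub>"] by auto
next
  assume k: "a_kernel M N f = {\<zero>\<^bsub>M\<^esub>}"
  show "inj_on f (carrier M)"
  proof (rule inj_onI)
    fix x y assume x: "x \<in> carrier M" and y: "y \<in> carrier M" and "f x = f y"
    then have "f (x \<oplus>\<^bsub>M\<^esub> \<ominus>\<^bsub>M\<^esub> y) = \<zero>\<^bsub>N\<^esub>" by (simp add: f_add f_minus N.M.r_neg)
    then have "x \<oplus>\<^bsub>M\<^esub> \<ominus>\<^bsub>M\<^esub> y = \<zero>\<^bsub>M\<^esub>" using k x y mem_kernel by blast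
    then show "x = y" using M.M.minus_equality[of x "\<ominus>\<^bsub>M\<^esub> y"] x y by simp
  qed
qed

lemma f_eq_iff:
  assumes "x \<in> carrier M" "y \<in> carrier M"
  shows "f x = f y \<longleftrightarrow> x \<oplus>\<^bsub>M\<^esub> \<ominus>\<^bsub>M\<^esub> y \<in> a_kernel M N f"
proof -
  have "f (x \<oplus>\<^bsub>M\<^esub> \<ominus>\<^bsub>M\<^esub> y) = f x \<oplus>\<^bsub>N\<^esub> \<ominus>\<^bsub>N\<^esub> f y" using assms by (simp add: f_add f_minus)
  moreover have "f x \<oplus>\<^bsub>N\<^esub> \<ominus>\<^bsub>N\<^esub> f y = \<zero>\<^bsub>N\<^esub> \<longleftrightarrow> f x = f y"
    using assms N.M.minus_equality[of "f x" "\<ominus>\<^bsub>N\<^esub> f y"] by (auto simp: N.M.r_neg)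
  ultimately show ?thesis using assms mem_kernel by auto
qed

end

lemma ghomI:
  assumes "\<And>x. x \<in> carrier M \<Longrightarrow> f x \<in> carrier N"
    and "\<And>x y. x \<in> carrier M \<Longrightarrow> y \<in> carrier M \<Longrightarrow> f (x \<oplus>\<^bsub>M\<^esub> y) = f x \<oplus>\<^bsub>N\<^esub> f y"
    and "\<And>a x. a \<in> carrier R \<Longrightarrow> x \<in> carrier M \<Longrightarrow> f (a \<odot>\<^bsub>M\<^esub> x) = a \<odot>\<^bsub>N\<^esub> f x"
    and "\<And>g x. g \<in> carrier G \<Longrightarrow> x \<in> mgrade M g \<Longrightarrow> f x \<in> mgrade N g"
  shows "f \<in> ghom G R M N"
  using assms by (auto simp: ghom_def hom_def)

lemma graded_homI:
  "graded_module G R M \<Longrightarrow> graded_module G R N \<Longrightarrow> f \<in> ghom G R M N \<Longrightarrow> graded_hom G R M N f"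
  by (intro graded_hom.intro graded_hom_axioms.intro)

text \<open>The universal property of a quotient, stated for an arbitrary surjection so that it
  applies to cokernels known only up to isomorphism. The value of \<open>f'\<close> at u is that of
  f at any preimage, by the inclusion of kernels.\<close>

lemma factor_through_surjection:
  assumes "graded_module G R M" "graded_module G R N" "graded_module G R Q"
    and p: "p \<in> ghom G R M Q" "p ` carrier M = carrier Q"
    and f: "f \<in> ghom G R M N" "a_kernel M Q p \<subseteq> a_kernel M N f"
  obtains f' where "f' \<in> ghom G R Q N" "\<And>x. x \<in> carrier M \<Longrightarrow> f' (p x) = f x"
proof
  interpret p: graded_hom G R M Q p using assms by (intro graded_homI)
  interpret f: graded_hom G R M N f using assms by (intro graded_homI)
  define f' where "f' u = f (SOME x. x \<in> carrier M \<and> p x = u)" for u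
  show f': "f' (p x) = f x" if x: "x \<in> carrier M" for x
  proof -
    let ?y = "SOME y. y \<in> carrier M \<and> p y = p x"
    have "?y \<in> carrier M \<and> p ?y = p x" by (rule someI[of _ x]) (use x in simp)
    then show ?thesis unfolding f'_def using p.f_eq_iff[of ?y x] f.f_eq_iff[of ?y x] f(2) x by blast
  qed
  show "f' \<in> ghom G R Q N"
  proof (rule ghomI)
    show "f' u \<in> carrier N" if "u \<in> carrier Q" for u using that f' p(2) by (metis f.f_closed imageE)
    show "f' (u \<oplus>\<^bsub>Q\<^esub> v) = f' u \<oplus>\<^bsub>N\<^esub> f' v" if uv: "u \<in> carrier Q" "v \<in> carrier Q" for u v
    proof -
      obtain x y where "x \<in> carrier M" "u = p x" "y \<in> carrier M" "v = p y" using uv p(2) by blast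
      then show ?thesis using f'[of "x \<oplus>\<^bsub>M\<^esub> y"] f' by (simp add: p.f_add f.f_add)
    qed
    show "f' (a \<odot>\<^bsub>Q\<^esub> u) = a \<odot>\<^bsub>N\<^esub> f' u" if a: "a \<in> carrier R" "u \<in> carrier Q" for a u
    proof -
      obtain x where "x \<in> carrier M" "u = p x" using a p(2) by blast
      then show ?thesis using f'[of "a \<odot>\<^bsub>M\<^esub> x"] f' a(1) by (simp add: p.f_smult f.f_smult)
    qed
    show "f' u \<in> mgrade N g" if g: "g \<in> carrier G" and u: "u \<in> mgrade Q g" for g u
    proof -
      have uQ: "u \<in> carrier Q" using p.N.H.D_closed g u by blast
      then obtain x where x: "x \<in> carrier M" "u = p x" using p(2) by blast
      \<comment> \<open>Since p commutes with components, a preimage of a homogeneous element can be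
        replaced by its component of the same degree.\<close>
      have "u = p (p.M.H.component x g)" using p.f_comp[OF x(1) g] p.N.H.comp_homogeneous[OF g u g] x by simp
      then show ?thesis using f' f.f_degree[OF g] p.M.H.comp_mem[OF x(1) g] p.M.H.comp_closed[OF x(1) g] by simp
    qed
  qed
qed

subsection \<open>Submodules, shifts and quotients as graded modules\<close>

lemma gsub_simps [simp]:
  "carrier (gsub M S) = S" "\<zero>\<^bsub>gsub M S\<^esub> = \<zero>\<^bsub>M\<^esub>" "x \<oplus>\<^bsub>gsub M S\<^esub> y = x \<oplus>\<^bsub>M\<^esub> y"
  "a \<odot>\<^bsub>gsub M S\<^esub> x = a \<odot>\<^bsub>M\<^esub> x" "mgrade (gsub M S) g = mgrade M g \<inter> S"
  by (simp_all add: gsub_def)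

lemma gsub_gsub: "T \<subseteq> S \<Longrightarrow> gsub (gsub M S) T = gsub M T"
  by (auto simp: gsub_def Int_absorb1 Int_assoc)

lemma gshift_simps [simp]:
  "carrier (gshift G M g) = carrier M" "\<zero>\<^bsub>gshift G M g\<^esub> = \<zero>\<^bsub>M\<^esub>" "x \<oplus>\<^bsub>gshift G M g\<^esub> y = x \<oplus>\<^bsub>M\<^esub> y"
  "a \<odot>\<^bsub>gshift G M g\<^esub> x = a \<odot>\<^bsub>M\<^esub> x" "mgrade (gshift G M g) h = mgrade M (h \<otimes>\<^bsub>G\<^esub> g)"
  by (simp_all add: gshift_def)

text \<open>The common pattern for submodules, shifts and quotients: exhibiting the projections
  \<pi> settles the grading.\<close>

lemma (in graded_cring) graded_moduleI:
  assumes "module R M"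
    and "\<And>g. g \<in> carrier G \<Longrightarrow> mgrade M g \<subseteq> carrier M" "\<And>g. g \<in> carrier G \<Longrightarrow> \<zero>\<^bsub>M\<^esub> \<in> mgrade M g"
      "\<And>g x y. g \<in> carrier G \<Longrightarrow> x \<in> mgrade M g \<Longrightarrow> y \<in> mgrade M g \<Longrightarrow> x \<oplus>\<^bsub>M\<^esub> y \<in> mgrade M g"
    and "\<And>x P. x \<in> carrier M \<Longrightarrow> P \<zero>\<^bsub>M\<^esub> \<Longrightarrow> (\<And>g u. g \<in> carrier G \<Longrightarrow> u \<in> mgrade M g \<Longrightarrow> P u) \<Longrightarrow>
      (\<And>u v. u \<in> carrier M \<Longrightarrow> v \<in> carrier M \<Longrightarrow> P u \<Longrightarrow> P v \<Longrightarrow> P (u \<oplus>\<^bsub>M\<^esub> v)) \<Longrightarrow> P x"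
    and "\<And>g. g \<in> carrier G \<Longrightarrow> \<pi> g \<in> hom (add_monoid M) (add_monoid M)"
    and "\<And>g h u. g \<in> carrier G \<Longrightarrow> h \<in> carrier G \<Longrightarrow> u \<in> mgrade M h \<Longrightarrow> \<pi> g u = (if g = h then u else \<zero>\<^bsub>M\<^esub>)"
    and "\<And>g h a x. g \<in> carrier G \<Longrightarrow> h \<in> carrier G \<Longrightarrow> a \<in> rgrade R g \<Longrightarrow> x \<in> mgrade M h
        \<Longrightarrow> a \<odot>\<^bsub>M\<^esub> x \<in> mgrade M (g \<otimes>\<^bsub>G\<^esub> h)"
  shows "graded_module G R M"
proof (intro graded_module.intro graded_module_axioms.intro)
  show "graded_cring G R" by (rule graded_cring_axioms)
  interpret M: module R M by fact
  have ab: "abelian_group M" by (rule M.M.abelian_group_axioms)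
  show "is_grading G M (mgrade M)"
    by (rule is_gradingI_projections[where \<pi> = \<pi>, OF ab]) (fact assms)+
qed (fact assms)+

context graded_module begin

lemma graded_module_gsub:
  assumes "hsub G R M S" shows "graded_module G R (gsub M S)"
proof (rule graded_moduleI[where \<pi> = "\<lambda>g x. H.component x g"])
  note S = hsubD[OF assms]
  have "abelian_group (gsub M S)"
  proof (rule abelian_groupI)
    fix x assume "x \<in> carrier (gsub M S)"
    then show "\<exists>y\<in>carrier (gsub M S). y \<oplus>\<^bsub>gsub M S\<^esub> x = \<zero>\<^bsub>gsub M S\<^esub>"
      using S by (intro bexI[of _ "\<ominus>\<^bsub>M\<^esub> x"]) (auto simp: M.l_neg)
  qed (use S in \<open>auto simp: M.a_ac\<close>)
  then show "module R (gsub M S)"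
    by (rule moduleI[OF R.is_cring])
      (use S in \<open>auto simp: M.smult_l_distr M.smult_r_distr M.smult_assoc1\<close>)
  show "P x" if x: "x \<in> carrier (gsub M S)" and P: "P \<zero>\<^bsub>gsub M S\<^esub>"
    "\<And>g u. g \<in> carrier G \<Longrightarrow> u \<in> mgrade (gsub M S) g \<Longrightarrow> P u"
    "\<And>u v. u \<in> carrier (gsub M S) \<Longrightarrow> v \<in> carrier (gsub M S) \<Longrightarrow> P u \<Longrightarrow> P v \<Longrightarrow> P (u \<oplus>\<^bsub>gsub M S\<^esub> v)" for x P
  proof -
    \<comment> \<open>The induction runs in M, while P is known to be additive only on S; membership
      in S is therefore carried along.\<close>
    have "x \<in> S \<and> P x"
    proof (rule H.sum_of_comps[of x "\<lambda>x. x \<in> S \<and> P x"])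
      show "x \<in> carrier M" using x S(3) by simp
      show "H.component x g \<in> S \<and> P (H.component x g)" if "g \<in> carrier G" for g
        using x S(3,7) that P(2)[of g] H.comp_mem by simp
    qed (use S P in auto)
    then show ?thesis by simp
  qed
  show "H.component u g = (if g = h then u else \<zero>\<^bsub>gsub M S\<^esub>)"
    if "g \<in> carrier G" "h \<in> carrier G" "u \<in> mgrade (gsub M S) h" for g h u
    using that H.comp_homogeneous[of h u g] by simp
  show "(\<lambda>x. H.component x g) \<in> hom (add_monoid (gsub M S)) (add_monoid (gsub M S))"
    if "g \<in> carrier G" for g
    using that S H.comp_add by (auto simp: hom_def)
qed (use hsubD[OF assms] H.D_zero H.D_add RG.D_closed mgrade_smult in auto)

lemma inclusion_gsub: "S \<subseteq> carrier M \<Longrightarrow> (\<lambda>x. x) \<in> ghom G R (gsub M S) M"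
  by (rule ghomI) auto

lemma graded_module_gshift:
  assumes g: "g \<in> carrier G" shows "graded_module G R (gshift G M g)"
proof (rule graded_moduleI[where \<pi> = "\<lambda>k x. H.component x (k \<otimes>\<^bsub>G\<^esub> g)"])
  have "abelian_group (gshift G M g)"
  proof (rule abelian_groupI)
    fix x assume "x \<in> carrier (gshift G M g)"
    then show "\<exists>y\<in>carrier (gshift G M g). y \<oplus>\<^bsub>gshift G M g\<^esub> x = \<zero>\<^bsub>gshift G M g\<^esub>"
      by (intro bexI[of _ "\<ominus>\<^bsub>M\<^esub> x"]) (auto simp: M.l_neg)
  qed (auto simp: M.a_ac)
  then show "module R (gshift G M g)"
    by (rule moduleI[OF R.is_cring]) (auto simp: M.smult_l_distr M.smult_r_distr M.smult_assoc1)
  show "P x" if x: "x \<in> carrier (gshift G M g)" and P: "P \<zero>\<^bsub>gshift G M g\<^esub>"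
    "\<And>h u. h \<in> carrier G \<Longrightarrow> u \<in> mgrade (gshift G M g) h \<Longrightarrow> P u"
    "\<And>u v. u \<in> carrier (gshift G M g) \<Longrightarrow> v \<in> carrier (gshift G M g) \<Longrightarrow> P u \<Longrightarrow> P v \<Longrightarrow> P (u \<oplus>\<^bsub>gshift G M g\<^esub> v)" for x P
  proof (rule H.homogeneous_induct[of x P])
    fix h u assume "h \<in> carrier G" "u \<in> mgrade M h"
    then show "P u" using P(2)[of "h \<otimes>\<^bsub>G\<^esub> inv\<^bsub>G\<^esub> g" u] g by (simp add: G.m_assoc)
  qed (use x P in auto)
  show "H.component u (k \<otimes>\<^bsub>G\<^esub> g) = (if k = h then u else \<zero>\<^bsub>gshift G M g\<^esub>)"
    if "k \<in> carrier G" "h \<in> carrier G" "u \<in> mgrade (gshift G M g) h" for k h u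
    using that g H.comp_homogeneous[of "h \<otimes>\<^bsub>G\<^esub> g" u "k \<otimes>\<^bsub>G\<^esub> g"] by simp
  show "(\<lambda>x. H.component x (k \<otimes>\<^bsub>G\<^esub> g)) \<in> hom (add_monoid (gshift G M g)) (add_monoid (gshift G M g))"
    if "k \<in> carrier G" for k
    using that g H.comp_add H.comp_closed by (auto simp: hom_def)
  show "a \<odot>\<^bsub>gshift G M g\<^esub> x \<in> mgrade (gshift G M g) (k \<otimes>\<^bsub>G\<^esub> h)"
    if "k \<in> carrier G" "h \<in> carrier G" "a \<in> rgrade R k" "x \<in> mgrade (gshift G M g) h" for k h a x
    using that g mgrade_smult[of k "h \<otimes>\<^bsub>G\<^esub> g" a x] by (simp add: G.m_assoc)
qed (use g H.D_closed[OF G.m_closed] H.D_zero H.D_add in auto)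

text \<open>
  The quotient is realised on a set of coset representatives, so that it has the same carrier
  type as the module itself.
\<close>

lemma quotient_exists:
  assumes S: "hsub G R M S"
  obtains Q :: "('g, 'r, 'm) graded_module" and p where "graded_module G R Q" "p \<in> ghom G R M Q"
    "p ` carrier M = carrier Q" "a_kernel M Q p = S"
proof -
  note s = hsubD[OF S]
  have m0: "\<ominus>\<^bsub>M\<^esub> \<zero>\<^bsub>M\<^esub> = \<zero>\<^bsub>M\<^esub>" by (rule M.minus_equality) auto
  define rel where "rel x y \<longleftrightarrow> x \<oplus>\<^bsub>M\<^esub> \<ominus>\<^bsub>M\<^esub> y \<in> S" for x y
  have refl: "rel x x" if "x \<in> carrier M" for x using that s(2) by (simp add: rel_def M.r_neg)
  have sym: "rel y x" if "rel x y" "x \<in> carrier M" "y \<in> carrier M" for x y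
    using s(6)[of "x \<oplus>\<^bsub>M\<^esub> \<ominus>\<^bsub>M\<^esub> y"] that by (simp add: rel_def M.minus_add M.a_comm)
  have trans: "rel x z" if "rel x y" "rel y z" "x \<in> carrier M" "y \<in> carrier M" "z \<in> carrier M" for x y z
  proof -
    have "(x \<oplus>\<^bsub>M\<^esub> \<ominus>\<^bsub>M\<^esub> y) \<oplus>\<^bsub>M\<^esub> (y \<oplus>\<^bsub>M\<^esub> \<ominus>\<^bsub>M\<^esub> z) = x \<oplus>\<^bsub>M\<^esub> \<ominus>\<^bsub>M\<^esub> z"
      using that by (simp add: M.a_assoc M.r_neg1)
    then show ?thesis using that s(4)[of "x \<oplus>\<^bsub>M\<^esub> \<ominus>\<^bsub>M\<^esub> y" "y \<oplus>\<^bsub>M\<^esub> \<ominus>\<^bsub>M\<^esub> z"] by (simp add: rel_def m0)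
  qed
  have radd: "rel (x \<oplus>\<^bsub>M\<^esub> z) (y \<oplus>\<^bsub>M\<^esub> w)" if "rel x y" "rel z w"
    "x \<in> carrier M" "y \<in> carrier M" "z \<in> carrier M" "w \<in> carrier M" for x y z w
  proof -
    have "(x \<oplus>\<^bsub>M\<^esub> z) \<oplus>\<^bsub>M\<^esub> \<ominus>\<^bsub>M\<^esub> (y \<oplus>\<^bsub>M\<^esub> w) = (x \<oplus>\<^bsub>M\<^esub> \<ominus>\<^bsub>M\<^esub> y) \<oplus>\<^bsub>M\<^esub> (z \<oplus>\<^bsub>M\<^esub> \<ominus>\<^bsub>M\<^esub> w)"
      using that by (simp add: M.minus_add M.a_ac)
    then show ?thesis using that s(4) by (simp add: rel_def m0)
  qed
  have rsm: "rel (a \<odot>\<^bsub>M\<^esub> x) (a \<odot>\<^bsub>M\<^esub> y)" if "rel x y" "a \<in> carrier R" "x \<in> carrier M" "y \<in> carrier M" for a x y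
    using s(5)[OF that(2), of "x \<oplus>\<^bsub>M\<^esub> \<ominus>\<^bsub>M\<^esub> y"] that by (simp add: rel_def M.smult_r_distr M.smult_r_minus)
  have rcomp: "rel (H.component x g) (H.component y g)" if "rel x y" "g \<in> carrier G" "x \<in> carrier M" "y \<in> carrier M" for g x y
    using s(7)[of "x \<oplus>\<^bsub>M\<^esub> \<ominus>\<^bsub>M\<^esub> y" g] that by (simp add: rel_def H.comp_add H.comp_minus)
  define r where "r x = (SOME y. y \<in> carrier M \<and> rel x y)" for x
  have r: "r x \<in> carrier M" "rel x (r x)" if "x \<in> carrier M" for x
    unfolding r_def using someI[of "\<lambda>y. y \<in> carrier M \<and> rel x y" x] that refl by auto
  have r_eq: "r x = r y" if "rel x y" "x \<in> carrier M" "y \<in> carrier M" for x y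
  proof -
    \<comment> \<open>Congruent elements have the same candidates for a representative, so the
      choice operator selects the same one.\<close>
    have "(\<lambda>z. z \<in> carrier M \<and> rel x z) = (\<lambda>z. z \<in> carrier M \<and> rel y z)"
      using that sym trans by blast
    then show ?thesis unfolding r_def by simp
  qed
  have rr [simp]: "r (r x) = r x" if "x \<in> carrier M" for x
    by (rule r_eq[symmetric]) (use r that in auto)
  \<comment> \<open>These rules remove every inner r, so that the module laws of Q become the image
    under r of the laws of M.\<close>
  have r1 [simp]: "r (r x \<oplus>\<^bsub>M\<^esub> y) = r (x \<oplus>\<^bsub>M\<^esub> y)" "r (y \<oplus>\<^bsub>M\<^esub> r x) = r (y \<oplus>\<^bsub>M\<^esub> x)"
    if "x \<in> carrier M" "y \<in> carrier M" for x y
    by (rule r_eq[symmetric]; use r that refl radd in auto)+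
  have r2 [simp]: "r (a \<odot>\<^bsub>M\<^esub> r x) = r (a \<odot>\<^bsub>M\<^esub> x)" if "a \<in> carrier R" "x \<in> carrier M" for a x
    by (rule r_eq[symmetric]) (use r that rsm in auto)
  have r3 [simp]: "r (H.component (r x) g) = r (H.component x g)" if "g \<in> carrier G" "x \<in> carrier M" for g x
    by (rule r_eq[symmetric]) (use r that rcomp H.comp_closed in auto)
  have r_iff: "r x = r \<zero>\<^bsub>M\<^esub> \<longleftrightarrow> x \<in> S" if "x \<in> carrier M" for x
  proof
    assume "r x = r \<zero>\<^bsub>M\<^esub>"
    then have "rel x \<zero>\<^bsub>M\<^esub>"
      using trans[of x "r x" "\<zero>\<^bsub>M\<^esub>"] sym[of "\<zero>\<^bsub>M\<^esub>" "r \<zero>\<^bsub>M\<^esub>"] r that M.zero_closed by metis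
    then show "x \<in> S" using that by (simp add: rel_def m0)
  qed (use that r_eq[of x "\<zero>\<^bsub>M\<^esub>"] in \<open>simp add: rel_def m0\<close>)
  define Q :: "('g, 'r, 'm) graded_module" where
    "Q = \<lparr>carrier = r ` carrier M, monoid.mult = undefined, monoid.one = undefined,
      ring.zero = r \<zero>\<^bsub>M\<^esub>, ring.add = (\<lambda>u v. r (u \<oplus>\<^bsub>M\<^esub> v)),
      smult = (\<lambda>a u. r (a \<odot>\<^bsub>M\<^esub> u)), mgrade = (\<lambda>g. r ` mgrade M g)\<rparr>"
  have sel [simp]: "carrier Q = r ` carrier M" "\<zero>\<^bsub>Q\<^esub> = r \<zero>\<^bsub>M\<^esub>" "u \<oplus>\<^bsub>Q\<^esub> v = r (u \<oplus>\<^bsub>M\<^esub> v)"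
    "a \<odot>\<^bsub>Q\<^esub> u = r (a \<odot>\<^bsub>M\<^esub> u)" "mgrade Q g = r ` mgrade M g" for u v a g
    by (simp_all add: Q_def)
  have gm: "graded_module G R Q"
  proof (rule graded_moduleI[where \<pi> = "\<lambda>g u. r (H.component u g)"])
    have "abelian_group Q"
    proof (rule abelian_groupI)
      fix u assume "u \<in> carrier Q"
      then obtain x where "x \<in> carrier M" "u = r x" by auto
      then show "\<exists>v\<in>carrier Q. v \<oplus>\<^bsub>Q\<^esub> u = \<zero>\<^bsub>Q\<^esub>"
        using r by (intro bexI[of _ "r (\<ominus>\<^bsub>M\<^esub> x)"]) (auto simp: M.l_neg)
    next
      fix u v w assume "u \<in> carrier Q" "v \<in> carrier Q" "w \<in> carrier Q"
      then obtain x y z where xyz: "x \<in> carrier M" "y \<in> carrier M" "z \<in> carrier M"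
        "u = r x" "v = r y" "w = r z" by auto
      have "u \<oplus>\<^bsub>Q\<^esub> v \<oplus>\<^bsub>Q\<^esub> w = r (x \<oplus>\<^bsub>M\<^esub> y \<oplus>\<^bsub>M\<^esub> z)"
        "u \<oplus>\<^bsub>Q\<^esub> (v \<oplus>\<^bsub>Q\<^esub> w) = r (x \<oplus>\<^bsub>M\<^esub> (y \<oplus>\<^bsub>M\<^esub> z))" using xyz r by simp_all
      then show "u \<oplus>\<^bsub>Q\<^esub> v \<oplus>\<^bsub>Q\<^esub> w = u \<oplus>\<^bsub>Q\<^esub> (v \<oplus>\<^bsub>Q\<^esub> w)" using xyz by (simp add: M.a_assoc)
    next
      fix u v assume "u \<in> carrier Q" "v \<in> carrier Q"
      then obtain x y where xy: "x \<in> carrier M" "y \<in> carrier M" "u = r x" "v = r y" by auto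
      then show "u \<oplus>\<^bsub>Q\<^esub> v = v \<oplus>\<^bsub>Q\<^esub> u" using r by (simp add: M.a_comm)
    qed (use r in auto)
    moreover have "r ((a \<oplus>\<^bsub>R\<^esub> b) \<odot>\<^bsub>M\<^esub> r x) = r (a \<odot>\<^bsub>M\<^esub> x \<oplus>\<^bsub>M\<^esub> b \<odot>\<^bsub>M\<^esub> x)"
      "r ((a \<otimes>\<^bsub>R\<^esub> b) \<odot>\<^bsub>M\<^esub> r x) = r (a \<odot>\<^bsub>M\<^esub> (b \<odot>\<^bsub>M\<^esub> x))"
      if "a \<in> carrier R" "b \<in> carrier R" "x \<in> carrier M" for a b x
      using that r2[of "a \<oplus>\<^bsub>R\<^esub> b" x] r2[of "a \<otimes>\<^bsub>R\<^esub> b" x]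
      by (simp_all add: M.smult_l_distr M.smult_assoc1)
    ultimately show "module R Q"
      by (intro moduleI[OF R.is_cring]) (use r in \<open>auto simp: M.smult_r_distr\<close>)
    show "P u" if u: "u \<in> carrier Q" and P: "P \<zero>\<^bsub>Q\<^esub>"
      "\<And>g u. g \<in> carrier G \<Longrightarrow> u \<in> mgrade Q g \<Longrightarrow> P u"
      "\<And>u v. u \<in> carrier Q \<Longrightarrow> v \<in> carrier Q \<Longrightarrow> P u \<Longrightarrow> P v \<Longrightarrow> P (u \<oplus>\<^bsub>Q\<^esub> v)" for u P
    proof -
      obtain x where x: "x \<in> carrier M" "u = r x" using u by auto
      from x(1) have "P (r x)"
      proof (rule H.homogeneous_induct[of x "\<lambda>x. P (r x)"])
        fix v w assume "v \<in> carrier M" "w \<in> carrier M" "P (r v)" "P (r w)"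
        then show "P (r (v \<oplus>\<^bsub>M\<^esub> w))" using P(3)[of "r v" "r w"] r by simp
      qed (use P in auto)
      then show ?thesis using x by simp
    qed
    show "r (H.component u g) = (if g = h then u else \<zero>\<^bsub>Q\<^esub>)"
      if "g \<in> carrier G" "h \<in> carrier G" "u \<in> mgrade Q h" for g h u
      using that H.D_closed[OF that(2)] H.comp_homogeneous[OF that(2) _ that(1)] by auto
    show "(\<lambda>u. r (H.component u g)) \<in> hom (add_monoid Q) (add_monoid Q)"
      if g: "g \<in> carrier G" for g
      using g r H.comp_closed by (auto simp: hom_def H.comp_add)
    show "x \<oplus>\<^bsub>Q\<^esub> y \<in> mgrade Q g" if "g \<in> carrier G" "x \<in> mgrade Q g" "y \<in> mgrade Q g" for g x y
      using that H.D_closed[OF that(1)] H.D_add[OF that(1)] r by auto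
    show "a \<odot>\<^bsub>Q\<^esub> x \<in> mgrade Q (g \<otimes>\<^bsub>G\<^esub> h)"
      if "g \<in> carrier G" "h \<in> carrier G" "a \<in> rgrade R g" "x \<in> mgrade Q h" for g h a x
      using that H.D_closed[OF that(2)] RG.D_closed[OF that(1,3)] mgrade_smult[OF that(1-3)] by auto
  qed (use H.D_closed H.D_zero in auto)
  moreover have "r \<in> ghom G R M Q" using r by (intro ghomI) auto
  moreover have "a_kernel M Q r = S" using r_iff s(3) by (auto simp: a_kernel_def')
  ultimately show ?thesis using that[of Q r] by simp
qed

end

subsection \<open>Chain conditions\<close>

text \<open>Stated for an arbitrary family of sets, because it is needed for homogeneous ideals as
  well as for homogeneous submodules.\<close>

definition acc :: "'a set set \<Rightarrow> bool" where
  "acc \<A> \<longleftrightarrow> (\<forall>U :: nat \<Rightarrow> 'a set. (\<forall>n. U n \<in> \<A>) \<and> (\<forall>n. U n \<subseteq> U (Suc n)) \<longrightarrow>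
     (\<exists>N. \<forall>n\<ge>N. U n = U N))"

lemma accD:
  "acc \<A> \<Longrightarrow> (\<And>n. U n \<in> \<A>) \<Longrightarrow> (\<And>n :: nat. U n \<subseteq> U (Suc n)) \<Longrightarrow> \<exists>N. \<forall>n\<ge>N. U n = U N"
  by (simp add: acc_def)

lemma acc_singleton:
  assumes "\<A> \<subseteq> {S}" shows "acc \<A>"
  unfolding acc_def
proof (intro allI impI)
  fix U :: "nat \<Rightarrow> _" assume "(\<forall>n. U n \<in> \<A>) \<and> (\<forall>n. U n \<subseteq> U (Suc n))"
  then have "U n = S" for n using assms by blast
  then show "\<exists>N. \<forall>n\<ge>N. U n = U N" by simp
qed

lemma set_add_mono: "S \<subseteq> S' \<Longrightarrow> S <+>\<^bsub>M\<^esub> T \<subseteq> S' <+>\<^bsub>M\<^esub> T"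
  unfolding set_add_defs by (rule UN_mono) simp_all

lemma acc_maximal:
  assumes "acc \<A>" "\<F> \<subseteq> \<A>" "\<F> \<noteq> {}"
  shows "\<exists>S\<in>\<F>. \<forall>T\<in>\<F>. S \<subseteq> T \<longrightarrow> T = S"
proof (rule ccontr)
  assume "\<not> ?thesis"
  then have *: "\<exists>T. T \<in> \<F> \<and> S \<subset> T" if "S \<in> \<F>" for S using that by (metis psubsetI)
  have "\<exists>U. \<forall>n :: nat. U n \<in> \<F> \<and> U n \<subset> U (Suc n)"
    by (rule dependent_nat_choice) (use assms(3) * in blast)+
  then obtain U where U: "\<And>n :: nat. U n \<in> \<F>" "\<And>n. U n \<subset> U (Suc n)" by blast
  have "\<exists>N. \<forall>n\<ge>N. U n = U N"
  proof (rule accD[OF assms(1)])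
    show "U n \<in> \<A>" for n using U(1) assms(2) by blast
    show "U n \<subseteq> U (Suc n)" for n using U(2)[of n] by simp
  qed
  then obtain N where N: "\<forall>n\<ge>N. U n = U N" by (rule exE)
  have "U (Suc N) = U N" by (rule N[rule_format]) simp
  with U(2)[of N] show False by simp
qed

lemma (in graded_cring) acc_hideals:
  "graded_noetherian G R \<Longrightarrow> acc {I. hideal G R I}"
  unfolding acc_def graded_noetherian_def mem_Collect_eq
  by (intro allI impI, elim allE, erule impE) (simp_all add: hideal_homogeneous_ideal)

context graded_module begin

lemma hsub_Int: "hsub G R M S \<Longrightarrow> hsub G R M T \<Longrightarrow> hsub G R M (S \<inter> T)"
  by (rule hsubI) (use hsubD[of S] hsubD[of T] in auto)

text \<open>This is the colon ideal (T : y). Homogeneity of y matters: the component of r in degree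
  g times y is the component of r y in degree g e.\<close>

lemma hideal_colon:
  assumes T: "hsub G R M T" and e: "e \<in> carrier G" and y: "y \<in> mgrade M e"
  shows "hideal G R {r \<in> carrier R. r \<odot>\<^bsub>M\<^esub> y \<in> T}"
  unfolding hideal_def
proof (intro conjI ballI)
  note t = hsubD[OF T]
  have yM: "y \<in> carrier M" by (rule H.D_closed[OF e y])
  let ?J = "{r \<in> carrier R. r \<odot>\<^bsub>M\<^esub> y \<in> T}"
  show "ideal ?J R"
  proof (rule idealI)
    show "subgroup ?J (add_monoid R)"
      using yM t(2,4,6) by (intro R.add.subgroupI)
        (auto simp: M.smult_l_distr M.smult_l_minus a_inv_def[symmetric] intro: exI[of _ "\<zero>\<^bsub>R\<^esub>"])
    fix a r assume *: "a \<in> ?J" "r \<in> carrier R"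
    then have "(r \<otimes>\<^bsub>R\<^esub> a) \<odot>\<^bsub>M\<^esub> y \<in> T" using yM t(5) by (simp add: M.smult_assoc1)
    then show "r \<otimes>\<^bsub>R\<^esub> a \<in> ?J" "a \<otimes>\<^bsub>R\<^esub> r \<in> ?J" using * R.m_comm[of a r] by simp_all
  qed (rule R.ring_axioms)
  show "RG.component r g \<in> ?J" if "r \<in> ?J" "g \<in> carrier G" for r g
    using that e RG.comp_closed comp_smult_right[OF e y, of r g] t(7)[of "r \<odot>\<^bsub>M\<^esub> y" "g \<otimes>\<^bsub>G\<^esub> e"] by simp
qed

text \<open>
  A chain \<open>U\<close> of submodules of \<open>T + Ry\<close> is controlled by the chains \<open>U \<inter> T\<close> and
  \<open>{r. r y \<in> U + T}\<close>.
\<close>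

lemma acc_add_cyclic:
  assumes noeth: "graded_noetherian G R" and T: "hsub G R M T" "acc {U. hsub G R M U \<and> U \<subseteq> T}"
    and e: "e \<in> carrier G" and y: "y \<in> mgrade M e"
  shows "acc {U. hsub G R M U \<and> U \<subseteq> T <+>\<^bsub>M\<^esub> cyclic R M y}"
  unfolding acc_def
proof (intro allI impI)
  fix U :: "nat \<Rightarrow> _"
  assume "(\<forall>n. U n \<in> {U. hsub G R M U \<and> U \<subseteq> T <+>\<^bsub>M\<^esub> cyclic R M y}) \<and> (\<forall>n. U n \<subseteq> U (Suc n))"
  then have U: "\<And>n. hsub G R M (U n)" "\<And>n. U n \<subseteq> T <+>\<^bsub>M\<^esub> cyclic R M y" "\<And>n. U n \<subseteq> U (Suc n)"
    by auto
  have mono: "U m \<subseteq> U n" if "m \<le> n" for m n by (rule lift_Suc_mono_le[of U, OF U(3) that])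
  have "\<exists>N. \<forall>n\<ge>N. U n \<inter> T = U N \<inter> T"
  proof (rule accD[OF T(2), of "\<lambda>n. U n \<inter> T"])
    show "U n \<inter> T \<in> {U. hsub G R M U \<and> U \<subseteq> T}" for n using hsub_Int[OF U(1) T(1)] by simp
    show "U n \<inter> T \<subseteq> U (Suc n) \<inter> T" for n using U(3)[of n] by blast
  qed
  then obtain N1 where N1: "\<forall>n\<ge>N1. U n \<inter> T = U N1 \<inter> T" by (rule exE)
  \<comment> \<open>These ideals record the chain modulo T, where everything is a multiple of y;
    this is where noetherianity of R enters.\<close>
  let ?J = "\<lambda>n. {r \<in> carrier R. r \<odot>\<^bsub>M\<^esub> y \<in> U n <+>\<^bsub>M\<^esub> T}"
  have "\<exists>N. \<forall>n\<ge>N. ?J n = ?J N"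
  proof (rule accD[OF acc_hideals[OF noeth], of ?J])
    show "?J n \<in> {I. hideal G R I}" for n using hideal_colon[OF hsub_add[OF U(1) T(1)] e y] by simp
    have "U n <+>\<^bsub>M\<^esub> T \<subseteq> U (Suc n) <+>\<^bsub>M\<^esub> T" for n by (rule set_add_mono[OF U(3)])
    then show "?J n \<subseteq> ?J (Suc n)" for n by blast
  qed
  then obtain N2 where N2: "\<forall>n\<ge>N2. ?J n = ?J N2" by (rule exE)
  have "U n \<subseteq> U (max N1 N2)" if n: "n \<ge> max N1 N2" for n
  proof
    let ?N = "max N1 N2"
    fix u assume u: "u \<in> U n"
    then obtain t r where t: "t \<in> T" and r: "r \<in> carrier R" and ut: "u = t \<oplus>\<^bsub>M\<^esub> r \<odot>\<^bsub>M\<^esub> y"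
      using U(2) unfolding set_add_iff subset_eq by (metis cyclicE)
    have uM: "u \<in> carrier M" and tM: "t \<in> carrier M" and yM: "y \<in> carrier M"
      using hsubD(3)[OF U(1) u] hsubD(3)[OF T(1) t] H.D_closed[OF e y] by auto
    have "r \<odot>\<^bsub>M\<^esub> y = u \<oplus>\<^bsub>M\<^esub> \<ominus>\<^bsub>M\<^esub> t" using ut uM tM yM r by (simp add: M.a_ac M.r_neg2)
    then have "r \<odot>\<^bsub>M\<^esub> y \<in> U n <+>\<^bsub>M\<^esub> T"
      using u hsubD(6)[OF T(1) t] by (subst set_add_iff) (rule bexI bexI)+
    then have "r \<in> ?J n" using r by simp
    then have "r \<in> ?J ?N" using N2[rule_format, of n] N2[rule_format, of ?N] n by simp
    then obtain u' t' where u': "u' \<in> U ?N" "t' \<in> T" "r \<odot>\<^bsub>M\<^esub> y = u' \<oplus>\<^bsub>M\<^esub> t'"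
      by (auto simp: set_add_iff)
    have u'M: "u' \<in> carrier M" "t' \<in> carrier M" using hsubD(3)[OF U(1) u'(1)] hsubD(3)[OF T(1) u'(2)] by auto
    have eq: "u = (t \<oplus>\<^bsub>M\<^esub> t') \<oplus>\<^bsub>M\<^esub> u'" using ut u'(3) tM u'M by (simp add: M.a_ac)
    \<comment> \<open>The element t + t' is u - u', hence in \<open>U n\<close>, and it also lies in
      T. Stability of the intersections with T moves it to \<open>U ?N\<close>, and then u
      follows.\<close>
    have tt: "t \<oplus>\<^bsub>M\<^esub> t' \<in> T" using hsubD(4)[OF T(1) t u'(2)] .
    have "t \<oplus>\<^bsub>M\<^esub> t' \<in> U n"
      by (rule hsub_diff[OF U(1), of _ u']) (use u u' mono[OF n] eq tM u'M in auto)
    then have "t \<oplus>\<^bsub>M\<^esub> t' \<in> U ?N" using tt N1[rule_format, of n] N1[rule_format, of ?N] n by (metis IntD1 IntI max.cobounded1 order_trans)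
    then show "u \<in> U ?N" using eq hsubD(4)[OF U(1)] u'(1) by simp
  qed
  then show "\<exists>N. \<forall>n\<ge>N. U n = U N"
    using mono by (intro exI[of _ "max N1 N2"] allI impI subset_antisym)
qed

text \<open>An arbitrary x is absorbed one homogeneous piece at a time. The submodule T is left
  general, because the second summand is added to the submodule already enlarged by the
  first.\<close>

lemma acc_contains:
  assumes noeth: "graded_noetherian G R" and "x \<in> carrier M"
    and "hsub G R M T" "acc {U. hsub G R M U \<and> U \<subseteq> T}"
  shows "\<exists>T'. hsub G R M T' \<and> acc {U. hsub G R M U \<and> U \<subseteq> T'} \<and> T \<subseteq> T' \<and> x \<in> T'"
  using assms(2-4)
proof (induction x arbitrary: T rule: H.homogeneous_induct)
  case zero
  then show ?case using hsubD(2)[OF zero(1)] by blast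
next
  case (homogeneous g u)
  have c: "hsub G R M (cyclic R M u)" by (rule hsub_cyclic[OF homogeneous(1,2)])
  have "u \<in> T <+>\<^bsub>M\<^esub> cyclic R M u"
    using add_right_subset[OF homogeneous(3) c] self_in_cyclic H.D_closed[OF homogeneous(1,2)] by blast
  then show ?case
    using acc_add_cyclic[OF noeth homogeneous(3,4,1,2)] hsub_add[OF homogeneous(3) c]
      add_left_subset[OF homogeneous(3) c] by blast
next
  case (add u v)
  obtain T' where T': "hsub G R M T'" "acc {U. hsub G R M U \<and> U \<subseteq> T'}" "T \<subseteq> T'" "u \<in> T'"
    using add(3)[OF add(5,6)] by blast
  obtain T'' where T'': "hsub G R M T''" "acc {U. hsub G R M U \<and> U \<subseteq> T''}" "T' \<subseteq> T''" "v \<in> T''"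
    using add(4)[OF T'(1,2)] by blast
  then show ?case using T' hsubD(4)[OF T''(1)] by blast
qed

text \<open>Starting from the zero submodule, one generator after another is absorbed. Generators
  may be inhomogeneous, so the submodule reached merely contains them; this already forces it to be
  all of M.\<close>

lemma acc_hsubs:
  assumes noeth: "graded_noetherian G R" and fg: "finitely_generated R M"
  shows "acc {U. hsub G R M U}"
proof -
  obtain S where S: "finite S" "S \<subseteq> carrier M" "\<And>N. submodule N R M \<Longrightarrow> S \<subseteq> N \<Longrightarrow> N = carrier M"
    using fg unfolding finitely_generated_def by blast
  from S(1,2) have "\<exists>T. hsub G R M T \<and> acc {U. hsub G R M U \<and> U \<subseteq> T} \<and> S \<subseteq> T"
  proof (induction S)
    case empty
    have "U = {\<zero>\<^bsub>M\<^esub>}" if "hsub G R M U" "U \<subseteq> {\<zero>\<^bsub>M\<^esub>}" for U using hsubD(2)[OF that(1)] that(2) by auto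
    then have "acc {U. hsub G R M U \<and> U \<subseteq> {\<zero>\<^bsub>M\<^esub>}}" by (intro acc_singleton[of _ "{\<zero>\<^bsub>M\<^esub>}"]) blast
    then show ?case using hsub_zero by blast
  next
    case (insert s S)
    then obtain T where "hsub G R M T" "acc {U. hsub G R M U \<and> U \<subseteq> T}" "S \<subseteq> T" by auto
    then show ?case using acc_contains[OF noeth, of s T] insert by (meson insert_subset order_trans)
  qed
  then obtain T where T: "hsub G R M T" "acc {U. hsub G R M U \<and> U \<subseteq> T}" "S \<subseteq> T" by blast
  have "T = carrier M" using S(3)[OF _ T(3)] T(1) by (simp add: hsub_def)
  moreover have "{U. hsub G R M U \<and> U \<subseteq> carrier M} = {U. hsub G R M U}" using hsubD(1) by blast
  ultimately show ?thesis using T(2) by simp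
qed

text \<open>Among the finitely generated homogeneous submodules inside S there is a maximal one. It
  must be S, since adjoining one homogeneous element of S preserves finite generation.\<close>

lemma finitely_generated_gsub:
  assumes noeth: "graded_noetherian G R" and fg: "finitely_generated R M" and S: "hsub G R M S"
  shows "finitely_generated R (gsub M S)"
proof -
  interpret S: graded_module G R "gsub M S" by (rule graded_module_gsub[OF S])
  define \<F> where "\<F> = {U. hsub G R M U \<and> U \<subseteq> S \<and>
    (\<exists>F. finite F \<and> F \<subseteq> U \<and> (\<forall>N. submodule N R M \<and> F \<subseteq> N \<longrightarrow> U \<subseteq> N))}"
  have "{\<zero>\<^bsub>M\<^esub>} \<in> \<F>"
    using hsub_zero hsubD(2)[OF S] unfolding \<F>_def by (auto intro: exI[of _ "{\<zero>\<^bsub>M\<^esub>}"])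
  moreover have "\<F> \<subseteq> {U. hsub G R M U}" by (auto simp: \<F>_def)
  ultimately obtain U where U: "U \<in> \<F>" "\<forall>T\<in>\<F>. U \<subseteq> T \<longrightarrow> T = U"
    using acc_maximal[OF acc_hsubs[OF noeth fg], of \<F>] by blast
  have U': "hsub G R M U" "U \<subseteq> S"
    "\<exists>F. finite F \<and> F \<subseteq> U \<and> (\<forall>N. submodule N R M \<and> F \<subseteq> N \<longrightarrow> U \<subseteq> N)"
    using U(1) by (simp_all add: \<F>_def)
  then obtain F where F: "hsub G R M U" "U \<subseteq> S" "finite F" "F \<subseteq> U"
    "\<And>N. submodule N R M \<Longrightarrow> F \<subseteq> N \<Longrightarrow> U \<subseteq> N" by auto
  have "S \<subseteq> U"
  proof (rule ccontr)
    assume "\<not> S \<subseteq> U"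
    then obtain x where x: "x \<in> S" "x \<notin> U" by blast
    obtain g y where y: "g \<in> carrier G" "y \<in> mgrade M g" "y \<notin> U" "y = H.component x g"
      using hsub_homogeneous_notin[OF F(1) hsubD(3)[OF S x(1)] x(2)] .
    have yS: "y \<in> S" using y hsubD(7)[OF S x(1)] by simp
    have yM: "y \<in> carrier M" using H.D_closed y by blast
    have c: "hsub G R M (cyclic R M y)" by (rule hsub_cyclic[OF y(1,2)])
    let ?V = "U <+>\<^bsub>M\<^esub> cyclic R M y"
    have yV: "y \<in> ?V" using add_right_subset[OF F(1) c] self_in_cyclic[OF yM] by blast
    have "?V \<subseteq> N" if N: "submodule N R M" "insert y F \<subseteq> N" for N
    proof -
      have "U \<subseteq> N" using F(5) N by simp
      then show ?thesis
      proof (intro subsetI)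
        fix z assume "z \<in> ?V"
        then obtain s r where z: "s \<in> U" "r \<in> carrier R" "z = s \<oplus>\<^bsub>M\<^esub> r \<odot>\<^bsub>M\<^esub> y"
          unfolding set_add_iff by (metis cyclicE)
        then have "s \<in> N" "r \<odot>\<^bsub>M\<^esub> y \<in> N" using \<open>U \<subseteq> N\<close> N(2) M.submoduleE(4)[OF N(1)] by auto
        then show "z \<in> N" using M.submoduleE(5)[OF N(1)] z(3) by simp
      qed
    qed
    moreover have "insert y F \<subseteq> ?V" using F(4) add_left_subset[OF F(1) c] yV by (simp add: subset_trans)
    ultimately have "\<exists>F. finite F \<and> F \<subseteq> ?V \<and> (\<forall>N. submodule N R M \<and> F \<subseteq> N \<longrightarrow> ?V \<subseteq> N)"
      using F(3) by (intro exI[of _ "insert y F"]) simp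
    then have "?V \<in> \<F>"
      using hsub_add[OF F(1) c] add_least[OF S F(2) cyclic_subset[OF S yS]] by (simp add: \<F>_def)
    then have "?V = U" using U(2) add_left_subset[OF F(1) c] by simp
    then show False using yV y(3) by simp
  qed
  \<comment> \<open>The finite set F was chosen with respect to submodules of M, whereas the goal
    speaks of submodules of \<open>gsub M S\<close>. Negatives are recovered as multiples by
    -1.\<close>
  have "submodule N R M" if N: "submodule N R (gsub M S)" for N
  proof -
    note E = S.M.submoduleE[OF N]
    have NM: "N \<subseteq> carrier M" using E(1) hsubD(1)[OF S] by auto
    have "\<ominus>\<^bsub>M\<^esub> x \<in> N" if "x \<in> N" for x
      using E(4)[of "\<ominus>\<^bsub>R\<^esub> \<one>\<^bsub>R\<^esub>" x] that NM M.smult_l_minus[of "\<one>\<^bsub>R\<^esub>" x] by auto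
    moreover have "\<zero>\<^bsub>M\<^esub> \<in> N" using submodule.axioms(1)[OF N] subgroup.one_closed by fastforce
    ultimately show ?thesis using E(4,5) NM by (intro M.submoduleI) auto
  qed
  note sub = this
  have "N = S" if N: "submodule N R (gsub M S)" "F \<subseteq> N" for N
    using F(5)[OF sub[OF N(1)] N(2)] \<open>S \<subseteq> U\<close> S.M.submoduleE(1)[OF N(1)] by auto
  then show ?thesis
    unfolding finitely_generated_def using F(2,3,4) by (intro exI[of _ F]) auto
qed

end

text \<open>Multiplication by a ring element is R-linear. In this form commutativity of R enters the
  constructions of homomorphisms below.\<close>

lemma (in module) smult_swap:
  "a \<in> carrier R \<Longrightarrow> b \<in> carrier R \<Longrightarrow> x \<in> carrier M \<Longrightarrow> a \<odot>\<^bsub>M\<^esub> (b \<odot>\<^bsub>M\<^esub> x) = b \<odot>\<^bsub>M\<^esub> (a \<odot>\<^bsub>M\<^esub> x)"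
  using smult_assoc1[of a b x] smult_assoc1[of b a x] m_comm[of a b] by simp

section \<open>Finite generation of submodules and quotients over a noetherian graded ring\<close>

locale noetherian_graded_cring = graded_cring +
  assumes noeth: "graded_noetherian G R"
begin

lemma gmodD: "M \<in> gmod G R \<Longrightarrow> graded_module G R M" "M \<in> gmod G R \<Longrightarrow> finitely_generated R M"
  by (simp_all add: gmod_def)

lemma gsub_gmod: "M \<in> gmod G R \<Longrightarrow> hsub G R M S \<Longrightarrow> gsub M S \<in> gmod G R"
  using graded_module.graded_module_gsub graded_module.finitely_generated_gsub noeth
  by (fastforce simp: gmod_def)

lemma quotient_gmod:
  assumes M: "M \<in> gmod G R" and Q: "graded_module G R Q"
    and p: "p \<in> ghom G R M Q" "p ` carrier M = carrier Q"
  shows "Q \<in> gmod G R"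
proof -
  interpret p: graded_hom G R M Q p using gmodD[OF M] Q p by (intro graded_homI)
  obtain S where S: "finite S" "S \<subseteq> carrier M" "\<And>N. submodule N R M \<Longrightarrow> S \<subseteq> N \<Longrightarrow> N = carrier M"
    using gmodD(2)[OF M] unfolding finitely_generated_def by blast
  have "N = carrier Q" if N: "submodule N R Q" "p ` S \<subseteq> N" for N
  proof -
    note E = p.N.M.submoduleE[OF N(1)]
    have "\<zero>\<^bsub>Q\<^esub> \<in> N" using submodule.axioms(1)[OF N(1)] subgroup.one_closed by fastforce
    then have "submodule {x \<in> carrier M. p x \<in> N} R M"
      using E(3-5) by (intro p.M.M.submoduleI) (auto simp: p.f_add p.f_smult p.f_minus)
    then have "{x \<in> carrier M. p x \<in> N} = carrier M" by (rule S(3)) (use S(2) N(2) in auto)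
    then have "p ` carrier M \<subseteq> N" by blast
    then show ?thesis using E(1) p(2) by simp
  qed
  moreover have "p ` S \<subseteq> carrier Q" using S(2) p(2) by blast
  ultimately have "finitely_generated R Q"
    unfolding finitely_generated_def using S(1) by (intro exI[of _ "p ` S"]) simp
  then show ?thesis using Q by (simp add: gmod_def)
qed

lemma quotient_gmod_exists:
  fixes M :: "('a, 'b, 'm) graded_module"
  assumes M: "M \<in> gmod G R" and S: "hsub G R M S"
  shows "\<exists>(Q :: ('a, 'b, 'm) graded_module) p. Q \<in> gmod G R \<and> p \<in> ghom G R M Q \<and> p ` carrier M = carrier Q \<and> a_kernel M Q p = S"
proof -
  obtain Q :: "('a, 'b, 'm) graded_module" and p where Q: "graded_module G R Q" "p \<in> ghom G R M Q"
    "p ` carrier M = carrier Q" "a_kernel M Q p = S"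
    using graded_module.quotient_exists[OF gmodD(1)[OF M] S] .
  then show ?thesis using quotient_gmod[OF M Q(1-3)] by (intro exI[of _ Q] exI[of _ p]) simp
qed

subsection \<open>Homogeneous primes\<close>

text \<open>Primality is tested on homogeneous elements only. For groups with torsion such an ideal
  need not be prime: take the zero ideal of k[x]/(x^2 - 1), k a field, with x in the nontrivial
  degree of Z/2.\<close>

definition hprime where
  "hprime I \<longleftrightarrow> hideal G R I \<and> \<one>\<^bsub>R\<^esub> \<notin> I \<and>
     (\<forall>g\<in>carrier G. \<forall>h\<in>carrier G. \<forall>a\<in>rgrade R g. \<forall>b\<in>rgrade R h. a \<otimes>\<^bsub>R\<^esub> b \<in> I \<longrightarrow> a \<in> I \<or> b \<in> I)"

text \<open>An annihilator that is maximal among those of nonzero homogeneous elements of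
  \<open>W\<close> is prime: if b does not kill y, then b y is another candidate, and its
  annihilator contains that of y. The set \<open>W\<close> serves to confine y to the image of a
  submodule.\<close>

lemma exists_prime_annihilator:
  assumes Q: "graded_module G R Q"
    and W: "\<And>a w. a \<in> carrier R \<Longrightarrow> w \<in> W \<Longrightarrow> a \<odot>\<^bsub>Q\<^esub> w \<in> W"
    and z: "g \<in> carrier G" "z \<in> mgrade Q g" "z \<in> W" "z \<noteq> \<zero>\<^bsub>Q\<^esub>"
  shows "\<exists>e\<in>carrier G. \<exists>y\<in>mgrade Q e. y \<in> W \<and> y \<noteq> \<zero>\<^bsub>Q\<^esub> \<and> hprime (ann R Q {y})"
proof -
  interpret Q: graded_module G R Q by fact
  define \<F> where "\<F> = {ann R Q {y} | e y. e \<in> carrier G \<and> y \<in> mgrade Q e \<and> y \<in> W \<and> y \<noteq> \<zero>\<^bsub>Q\<^esub>}"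
  have "ann R Q {z} \<in> \<F>" unfolding \<F>_def using z by blast
  moreover have "\<F> \<subseteq> {I. hideal G R I}" using Q.hideal_ann_homogeneous by (auto simp: \<F>_def)
  ultimately have "\<exists>S\<in>\<F>. \<forall>T\<in>\<F>. S \<subseteq> T \<longrightarrow> T = S" by (intro acc_maximal[OF acc_hideals[OF noeth]]) auto
  then obtain I where I: "I \<in> \<F>" "\<And>T. T \<in> \<F> \<Longrightarrow> I \<subseteq> T \<Longrightarrow> T = I" by auto
  then obtain e y where y: "I = ann R Q {y}" "e \<in> carrier G" "y \<in> mgrade Q e" "y \<in> W" "y \<noteq> \<zero>\<^bsub>Q\<^esub>"
    unfolding \<F>_def by blast
  have yQ: "y \<in> carrier Q" using Q.H.D_closed y by blast
  have "a \<in> I" if g: "g \<in> carrier G" "h \<in> carrier G" and ab: "a \<in> rgrade R g" "b \<in> rgrade R h"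
    and abI: "a \<otimes>\<^bsub>R\<^esub> b \<in> I" and bI: "b \<notin> I" for g h a b
  proof -
    have aR: "a \<in> carrier R" "b \<in> carrier R" using RG.D_closed g ab by auto
    have bnz: "b \<odot>\<^bsub>Q\<^esub> y \<noteq> \<zero>\<^bsub>Q\<^esub>" using bI aR y(1) by (simp add: ann_def)
    have "ann R Q {b \<odot>\<^bsub>Q\<^esub> y} \<in> \<F>"
      unfolding \<F>_def using bnz W[OF aR(2) y(4)] Q.mgrade_smult[OF g(2) y(2) ab(2) y(3)] g y(2) by blast
    moreover have "I \<subseteq> ann R Q {b \<odot>\<^bsub>Q\<^esub> y}"
    proof
      fix r assume r: "r \<in> I"
      then have rR: "r \<in> carrier R" "r \<odot>\<^bsub>Q\<^esub> y = \<zero>\<^bsub>Q\<^esub>" using y(1) by (auto simp: ann_def)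
      have "r \<odot>\<^bsub>Q\<^esub> (b \<odot>\<^bsub>Q\<^esub> y) = b \<odot>\<^bsub>Q\<^esub> (r \<odot>\<^bsub>Q\<^esub> y)"
        by (rule Q.M.smult_swap[OF rR(1) aR(2) yQ])
      then show "r \<in> ann R Q {b \<odot>\<^bsub>Q\<^esub> y}" using rR aR by (simp add: ann_def)
    qed
    ultimately have "ann R Q {b \<odot>\<^bsub>Q\<^esub> y} = I" by (rule I(2))
    moreover have "a \<odot>\<^bsub>Q\<^esub> (b \<odot>\<^bsub>Q\<^esub> y) = \<zero>\<^bsub>Q\<^esub>"
      using abI y(1) aR yQ by (simp add: ann_def Q.M.smult_assoc1)
    ultimately show ?thesis using aR by (auto simp: ann_def)
  qed
  moreover have "\<one>\<^bsub>R\<^esub> \<notin> I" using y(1,5) yQ by (simp add: ann_def)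
  ultimately have "hprime I" unfolding hprime_def y(1) using Q.hideal_ann_homogeneous[OF y(2,3)] by blast
  then show ?thesis using y by blast
qed

text \<open>
  Take \<open>F\<close> maximal among the homogeneous submodules that contain \<open>s M\<close> for no homogeneous
  \<open>s \<notin> I\<close>. Then \<open>M/F\<close> is torsion free of rank one over \<open>R/I\<close>.
\<close>

lemma prime_quotient:
  assumes M: "M \<in> gmod G R" and I: "hprime I" and annM: "ann R M (carrier M) \<subseteq> I"
  shows "\<exists>F d x e s. hsub G R M F \<and> d \<in> carrier G \<and> x \<in> mgrade M d \<and>
    e \<in> carrier G \<and> s \<in> rgrade R e \<and> s \<notin> I \<and>
    (\<forall>m\<in>carrier M. \<exists>c\<in>carrier R. \<exists>u\<in>F. s \<odot>\<^bsub>M\<^esub> m = u \<oplus>\<^bsub>M\<^esub> c \<odot>\<^bsub>M\<^esub> x) \<and>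
    (\<forall>c\<in>carrier R. c \<odot>\<^bsub>M\<^esub> x \<in> F \<longleftrightarrow> c \<in> I)"
proof -
  interpret M: graded_module G R M by (rule gmodD(1)[OF M])
  have hI: "hideal G R I" and one: "\<one>\<^bsub>R\<^esub> \<notin> I"
    and prime: "\<And>g h a b. g \<in> carrier G \<Longrightarrow> h \<in> carrier G \<Longrightarrow> a \<in> rgrade R g \<Longrightarrow> b \<in> rgrade R h \<Longrightarrow>
      a \<otimes>\<^bsub>R\<^esub> b \<in> I \<Longrightarrow> a \<in> I \<or> b \<in> I"
    using I by (auto simp: hprime_def)
  interpret I: ideal I R using hI by (simp add: hideal_def)
  \<comment> \<open>The zero submodule belongs to this family because, by \<open>annM\<close>, no
    homogeneous element outside I annihilates M.\<close>
  define \<F> where "\<F> = {F. hsub G R M F \<and>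
    (\<forall>e\<in>carrier G. \<forall>s\<in>rgrade R e. s \<notin> I \<longrightarrow> \<not> (\<forall>m\<in>carrier M. s \<odot>\<^bsub>M\<^esub> m \<in> F))}"
  have "{\<zero>\<^bsub>M\<^esub>} \<in> \<F>"
    unfolding \<F>_def mem_Collect_eq
  proof (intro conjI ballI impI notI M.hsub_zero)
    fix e s assume "e \<in> carrier G" "s \<in> rgrade R e" "s \<notin> I" "\<forall>m\<in>carrier M. s \<odot>\<^bsub>M\<^esub> m \<in> {\<zero>\<^bsub>M\<^esub>}"
    then show False using annM RG.D_closed[of e s] by (auto simp: ann_def)
  qed
  moreover have "\<F> \<subseteq> {U. hsub G R M U}" by (auto simp: \<F>_def)
  ultimately have "\<exists>F\<in>\<F>. \<forall>T\<in>\<F>. F \<subseteq> T \<longrightarrow> T = F"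
    by (intro acc_maximal[OF M.acc_hsubs[OF noeth gmodD(2)[OF M]]]) auto
  then obtain F where F\<F>: "F \<in> \<F>" and Fmax: "\<And>T. T \<in> \<F> \<Longrightarrow> F \<subseteq> T \<Longrightarrow> T = F" by auto
  have F: "hsub G R M F" using F\<F> by (simp add: \<F>_def)
  note f = M.hsubD[OF F]
  have small: False if "e \<in> carrier G" "s \<in> rgrade R e" "s \<notin> I" "\<And>m. m \<in> carrier M \<Longrightarrow> s \<odot>\<^bsub>M\<^esub> m \<in> F" for e s
    using F\<F> that unfolding \<F>_def by blast
  \<comment> \<open>Rank one: by maximality of F, adjoining x makes the submodule so large that it
    contains some s M with s outside I.\<close>
  have big: "\<exists>e\<in>carrier G. \<exists>s\<in>rgrade R e. s \<notin> I \<and>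
      (\<forall>m\<in>carrier M. \<exists>r\<in>carrier R. \<exists>u\<in>F. s \<odot>\<^bsub>M\<^esub> m = u \<oplus>\<^bsub>M\<^esub> r \<odot>\<^bsub>M\<^esub> x)"
    if d: "d \<in> carrier G" and x: "x \<in> mgrade M d" and xF: "x \<notin> F" for d x
  proof -
    have c: "hsub G R M (cyclic R M x)" by (rule M.hsub_cyclic[OF d x])
    let ?V = "F <+>\<^bsub>M\<^esub> cyclic R M x"
    have "x \<in> ?V" using M.add_right_subset[OF F c] M.self_in_cyclic M.H.D_closed[OF d x] by blast
    then have "?V \<noteq> F" using xF by blast
    then have "?V \<notin> \<F>" using Fmax M.add_left_subset[OF F c] by blast
    then obtain e s where s: "e \<in> carrier G" "s \<in> rgrade R e" "s \<notin> I" "\<forall>m\<in>carrier M. s \<odot>\<^bsub>M\<^esub> m \<in> ?V"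
      using M.hsub_add[OF F c] unfolding \<F>_def by blast
    have "\<exists>r\<in>carrier R. \<exists>u\<in>F. s \<odot>\<^bsub>M\<^esub> m = u \<oplus>\<^bsub>M\<^esub> r \<odot>\<^bsub>M\<^esub> x" if "m \<in> carrier M" for m
    proof -
      have "s \<odot>\<^bsub>M\<^esub> m \<in> ?V" using s(4) that by simp
      then obtain u v where u: "u \<in> F" and v: "v \<in> cyclic R M x" and eq: "s \<odot>\<^bsub>M\<^esub> m = u \<oplus>\<^bsub>M\<^esub> v"
        by (auto simp: set_add_iff)
      from v obtain r where "r \<in> carrier R" "v = r \<odot>\<^bsub>M\<^esub> x" by (rule cyclicE)
      then show ?thesis using u eq by blast
    qed
    then show ?thesis using s by blast
  qed
  \<comment> \<open>Otherwise some s' M lies in F + Rx. Multiplying by s pushes it into F, and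
    primality keeps s s' outside I, against the choice of F.\<close>
  have torsion_free: "x \<in> F" if e: "e \<in> carrier G" "s \<in> rgrade R e" "s \<notin> I"
    and d: "d \<in> carrier G" "x \<in> mgrade M d" and sx: "s \<odot>\<^bsub>M\<^esub> x \<in> F" for e s d x
  proof (rule ccontr)
    assume "x \<notin> F"
    then obtain e' s' where s': "e' \<in> carrier G" "s' \<in> rgrade R e'" "s' \<notin> I"
      "\<forall>m\<in>carrier M. \<exists>r\<in>carrier R. \<exists>u\<in>F. s' \<odot>\<^bsub>M\<^esub> m = u \<oplus>\<^bsub>M\<^esub> r \<odot>\<^bsub>M\<^esub> x" using big[OF d] by blast
    have sR: "s \<in> carrier R" "s' \<in> carrier R" using RG.D_closed e s' by auto
    have xM: "x \<in> carrier M" using M.H.D_closed d by blast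
    show False
    proof (rule small)
      show "e \<otimes>\<^bsub>G\<^esub> e' \<in> carrier G" "s \<otimes>\<^bsub>R\<^esub> s' \<in> rgrade R (e \<otimes>\<^bsub>G\<^esub> e')" "s \<otimes>\<^bsub>R\<^esub> s' \<notin> I"
        using e s' rgrade_mult prime[OF e(1) s'(1) e(2) s'(2)] by auto
      fix m assume m: "m \<in> carrier M"
      then obtain r u where ru: "r \<in> carrier R" "u \<in> F" "s' \<odot>\<^bsub>M\<^esub> m = u \<oplus>\<^bsub>M\<^esub> r \<odot>\<^bsub>M\<^esub> x" using s'(4) by blast
      have "(s \<otimes>\<^bsub>R\<^esub> s') \<odot>\<^bsub>M\<^esub> m = s \<odot>\<^bsub>M\<^esub> u \<oplus>\<^bsub>M\<^esub> s \<odot>\<^bsub>M\<^esub> (r \<odot>\<^bsub>M\<^esub> x)"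
        using ru sR xM m f(3)[OF ru(2)] by (simp add: M.M.smult_assoc1 M.M.smult_r_distr)
      also have "s \<odot>\<^bsub>M\<^esub> (r \<odot>\<^bsub>M\<^esub> x) = r \<odot>\<^bsub>M\<^esub> (s \<odot>\<^bsub>M\<^esub> x)"
        by (rule M.M.smult_swap[OF sR(1) ru(1) xM])
      finally show "(s \<otimes>\<^bsub>R\<^esub> s') \<odot>\<^bsub>M\<^esub> m \<in> F" using f(4,5) ru sR sx by simp
    qed
  qed
  \<comment> \<open>The claim that I annihilates M/F. If b x were outside F, then \<open>big\<close>
    for b x would express s x as a multiple of b x modulo F, and s could be corrected by an element
    of I so as to kill x modulo F.\<close>
  have killed: "b \<odot>\<^bsub>M\<^esub> x \<in> F" if b: "h \<in> carrier G" "b \<in> rgrade R h" "b \<in> I"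
    and d: "d \<in> carrier G" "x \<in> mgrade M d" for h b d x
  proof (rule ccontr)
    assume bx: "b \<odot>\<^bsub>M\<^esub> x \<notin> F"
    have hd: "h \<otimes>\<^bsub>G\<^esub> d \<in> carrier G" "b \<odot>\<^bsub>M\<^esub> x \<in> mgrade M (h \<otimes>\<^bsub>G\<^esub> d)" using b d M.mgrade_smult by auto
    have xM: "x \<in> carrier M" and bR: "b \<in> carrier R" using M.H.D_closed d RG.D_closed b by blast+
    obtain e s where s: "e \<in> carrier G" "s \<in> rgrade R e" "s \<notin> I"
      "\<forall>m\<in>carrier M. \<exists>r\<in>carrier R. \<exists>u\<in>F. s \<odot>\<^bsub>M\<^esub> m = u \<oplus>\<^bsub>M\<^esub> r \<odot>\<^bsub>M\<^esub> (b \<odot>\<^bsub>M\<^esub> x)" using big[OF hd bx] by blast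
    obtain r u where ru: "r \<in> carrier R" "u \<in> F" "s \<odot>\<^bsub>M\<^esub> x = u \<oplus>\<^bsub>M\<^esub> r \<odot>\<^bsub>M\<^esub> (b \<odot>\<^bsub>M\<^esub> x)" using s(4) xM by blast
    have sR: "s \<in> carrier R" using RG.D_closed s by blast
    \<comment> \<open>The degree for which a coefficient of degree k times b has the degree of
      s.\<close>
    define k where "k = e \<otimes>\<^bsub>G\<^esub> inv\<^bsub>G\<^esub> h"
    have k: "k \<in> carrier G" "k \<otimes>\<^bsub>G\<^esub> h = e" using s b by (simp_all add: k_def G.m_assoc)
    then have k3: "k \<otimes>\<^bsub>G\<^esub> (h \<otimes>\<^bsub>G\<^esub> d) = e \<otimes>\<^bsub>G\<^esub> d"
      using b d G.m_assoc[of k h d] by simp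
    define r0 where "r0 = RG.component r k"
    have r0: "r0 \<in> rgrade R k" "r0 \<in> carrier R" using RG.comp_mem RG.comp_closed ru k by (auto simp: r0_def)
    have uM: "u \<in> carrier M" using f(3) ru by blast
    have ed: "e \<otimes>\<^bsub>G\<^esub> d \<in> carrier G" using s d by simp
    have "s \<odot>\<^bsub>M\<^esub> x = M.H.component (s \<odot>\<^bsub>M\<^esub> x) (e \<otimes>\<^bsub>G\<^esub> d)"
      using M.H.comp_homogeneous[OF ed M.mgrade_smult[OF s(1) d(1) s(2) d(2)] ed] by simp
    also have "\<dots> = M.H.component u (e \<otimes>\<^bsub>G\<^esub> d) \<oplus>\<^bsub>M\<^esub> M.H.component (r \<odot>\<^bsub>M\<^esub> (b \<odot>\<^bsub>M\<^esub> x)) (k \<otimes>\<^bsub>G\<^esub> (h \<otimes>\<^bsub>G\<^esub> d))"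
      unfolding ru(3) k3 using M.H.comp_add[OF uM _ ed] ru bR xM by simp
    also have "\<dots> = M.H.component u (e \<otimes>\<^bsub>G\<^esub> d) \<oplus>\<^bsub>M\<^esub> r0 \<odot>\<^bsub>M\<^esub> (b \<odot>\<^bsub>M\<^esub> x)"
      using M.comp_smult_right[OF hd ru(1) k(1)] by (simp add: r0_def)
    finally have eq: "s \<odot>\<^bsub>M\<^esub> x = M.H.component u (e \<otimes>\<^bsub>G\<^esub> d) \<oplus>\<^bsub>M\<^esub> r0 \<odot>\<^bsub>M\<^esub> (b \<odot>\<^bsub>M\<^esub> x)" .
    \<comment> \<open>Homogeneous of the degree of s and congruent to s modulo I, hence outside I;
      it sends x into F, so \<open>torsion_free\<close> puts x itself into F.\<close>
    let ?t = "s \<oplus>\<^bsub>R\<^esub> \<ominus>\<^bsub>R\<^esub> (r0 \<otimes>\<^bsub>R\<^esub> b)"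
    have rb: "r0 \<otimes>\<^bsub>R\<^esub> b \<in> I" using I.I_l_closed[OF b(3) r0(2)] .
    have "?t \<odot>\<^bsub>M\<^esub> x = s \<odot>\<^bsub>M\<^esub> x \<oplus>\<^bsub>M\<^esub> \<ominus>\<^bsub>M\<^esub> (r0 \<odot>\<^bsub>M\<^esub> (b \<odot>\<^bsub>M\<^esub> x))"
      using sR r0 bR xM by (simp add: M.M.smult_l_distr M.M.smult_l_minus M.M.smult_assoc1)
    also have "\<dots> = M.H.component u (e \<otimes>\<^bsub>G\<^esub> d)"
      unfolding eq using r0 bR xM M.H.comp_closed[OF uM ed] by (simp add: M.M.a_assoc M.M.r_neg)
    finally have "?t \<odot>\<^bsub>M\<^esub> x \<in> F" using f(7)[OF ru(2) ed] by simp
    moreover have "?t \<in> rgrade R e"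
      using s r0 b k rgrade_mult[OF k(1) b(1) r0(1) b(2)] by (intro RG.D_add RG.D_minus) auto
    moreover have "?t \<notin> I"
    proof
      assume "?t \<in> I"
      then have "?t \<oplus>\<^bsub>R\<^esub> r0 \<otimes>\<^bsub>R\<^esub> b \<in> I" using rb by (rule I.a_closed)
      moreover have "?t \<oplus>\<^bsub>R\<^esub> r0 \<otimes>\<^bsub>R\<^esub> b = s" using sR r0 bR by (simp add: R.a_assoc R.l_neg)
      ultimately show False using s(3) by simp
    qed
    ultimately have "x \<in> F" using torsion_free[OF s(1) _ _ d] by blast
    then show False using bx f(5)[OF bR] by blast
  qed
  \<comment> \<open>Since 1 is not in I, some component of 1 is a homogeneous element outside I, and
    F = M would contain its multiples of M.\<close>
  have "carrier M \<noteq> F"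
  proof
    assume eq: "carrier M = F"
    have "\<exists>g\<in>carrier G. RG.component \<one>\<^bsub>R\<^esub> g \<notin> I"
    proof (rule ccontr)
      assume "\<not> ?thesis"
      then have "\<one>\<^bsub>R\<^esub> \<in> I"
        by (intro RG.sum_of_comps[of "\<one>\<^bsub>R\<^esub>" "\<lambda>r. r \<in> I"]) (auto intro: I.a_closed)
      then show False using one by blast
    qed
    then obtain g where g: "g \<in> carrier G" "RG.component \<one>\<^bsub>R\<^esub> g \<notin> I" by blast
    show False
      by (rule small[OF g(1) RG.comp_mem[OF R.one_closed g(1)] g(2)])
        (use eq M.M.smult_closed[OF RG.comp_closed[OF R.one_closed g(1)]] in blast)
  qed
  then obtain x' where "x' \<in> carrier M" "x' \<notin> F" using f(1) by blast
  then obtain d x where x: "d \<in> carrier G" "x \<in> mgrade M d" "x \<notin> F"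
    using M.hsub_homogeneous_notin[OF F] by metis
  have xM: "x \<in> carrier M" using M.H.D_closed x by blast
  obtain e s where s: "e \<in> carrier G" "s \<in> rgrade R e" "s \<notin> I"
    "\<forall>m\<in>carrier M. \<exists>r\<in>carrier R. \<exists>u\<in>F. s \<odot>\<^bsub>M\<^esub> m = u \<oplus>\<^bsub>M\<^esub> r \<odot>\<^bsub>M\<^esub> x" using big[OF x] by blast
  have "c \<odot>\<^bsub>M\<^esub> x \<in> F \<longleftrightarrow> c \<in> I" if c: "c \<in> carrier R" for c
  proof
    assume cx: "c \<odot>\<^bsub>M\<^esub> x \<in> F"
    have cg: "RG.component c g \<in> I" if g: "g \<in> carrier G" for g
    proof (rule ccontr)
      assume "RG.component c g \<notin> I"
      moreover have "RG.component c g \<odot>\<^bsub>M\<^esub> x \<in> F"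
        using M.comp_smult_right[OF x(1,2) c g] f(7)[OF cx, of "g \<otimes>\<^bsub>G\<^esub> d"] g x(1) by simp
      ultimately show False using torsion_free[OF g RG.comp_mem[OF c g] _ x(1,2)] x(3) by blast
    qed
    show "c \<in> I" using c by (rule RG.sum_of_comps) (use cg in \<open>auto intro: I.a_closed\<close>)
  next
    assume "c \<in> I"
    then have cg: "RG.component c g \<odot>\<^bsub>M\<^esub> x \<in> F" if "g \<in> carrier G" for g
      using hI that killed[OF that RG.comp_mem[OF c that] _ x(1,2)] by (simp add: hideal_def)
    show "c \<odot>\<^bsub>M\<^esub> x \<in> F"
      by (rule RG.sum_of_comps[of c "\<lambda>c. c \<odot>\<^bsub>M\<^esub> x \<in> F"])
        (use c xM cg f(2,4) in \<open>auto simp: M.M.smult_l_distr\<close>)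
  qed
  then show ?thesis using F x s by blast
qed

text \<open>With F, x and s from \<open>prime_quotient\<close>, multiplication by s maps M/F into
  the submodule generated by the class of x. That submodule is R/I up to shift, and so is Ry; the
  map sends m to c y whenever s m is congruent to c x modulo F.\<close>

lemma nonzero_hom_from_shift:
  assumes M: "M \<in> gmod G R" and Y: "graded_module G R Y" and e0: "e0 \<in> carrier G" and y: "y \<in> mgrade Y e0"
    and prime: "hprime (ann R Y {y})" and annM: "ann R M (carrier M) \<subseteq> ann R Y {y}"
  shows "\<exists>g\<in>carrier G. \<exists>\<phi>\<in>ghom G R (gshift G M g) Y.
    \<phi> ` carrier M \<subseteq> cyclic R Y y \<and> (\<exists>x\<in>carrier M. \<phi> x \<noteq> \<zero>\<^bsub>Y\<^esub>)"
proof -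
  interpret M: graded_module G R M by (rule gmodD(1)[OF M])
  interpret Y: graded_module G R Y by (rule Y)
  have yY: "y \<in> carrier Y" using Y.H.D_closed[OF e0 y] .
  let ?I = "ann R Y {y}"
  obtain F d x e s where F: "hsub G R M F" and d: "d \<in> carrier G" "x \<in> mgrade M d"
    and s: "e \<in> carrier G" "s \<in> rgrade R e" "s \<notin> ?I"
    and ex: "\<And>m. m \<in> carrier M \<Longrightarrow> \<exists>c\<in>carrier R. \<exists>u\<in>F. s \<odot>\<^bsub>M\<^esub> m = u \<oplus>\<^bsub>M\<^esub> c \<odot>\<^bsub>M\<^esub> x"
    and iff: "\<And>c. c \<in> carrier R \<Longrightarrow> c \<odot>\<^bsub>M\<^esub> x \<in> F \<longleftrightarrow> c \<in> ?I"
    using prime_quotient[OF M prime annM] by auto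
  note f = M.hsubD[OF F]
  have xM: "x \<in> carrier M" and sR: "s \<in> carrier R" using M.H.D_closed[OF d] RG.D_closed[OF s(1,2)] by auto
  \<comment> \<open>The coefficient c is determined only modulo I = Ann y, which is exactly what
    makes c y well defined.\<close>
  define P where "P m c \<longleftrightarrow> c \<in> carrier R \<and> (\<exists>u\<in>F. s \<odot>\<^bsub>M\<^esub> m = u \<oplus>\<^bsub>M\<^esub> c \<odot>\<^bsub>M\<^esub> x)" for m c
  define \<phi> where "\<phi> m = (SOME c. P m c) \<odot>\<^bsub>Y\<^esub> y" for m
  have P: "\<exists>c. P m c" if "m \<in> carrier M" for m using ex[OF that] by (auto simp: P_def)
  have unique: "c \<odot>\<^bsub>Y\<^esub> y = c' \<odot>\<^bsub>Y\<^esub> y" if "P m c" "P m c'" for m c c'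
  proof -
    obtain u where u1: "u \<in> F" "s \<odot>\<^bsub>M\<^esub> m = u \<oplus>\<^bsub>M\<^esub> c \<odot>\<^bsub>M\<^esub> x" using \<open>P m c\<close> unfolding P_def by blast
    obtain u' where u2: "u' \<in> F" "s \<odot>\<^bsub>M\<^esub> m = u' \<oplus>\<^bsub>M\<^esub> c' \<odot>\<^bsub>M\<^esub> x" using \<open>P m c'\<close> unfolding P_def by blast
    note u = u1 u2
    have c: "c \<in> carrier R" "c' \<in> carrier R" using that by (auto simp: P_def)
    have uM: "u \<in> carrier M" "u' \<in> carrier M" using u f(3) by auto
    have "(c \<oplus>\<^bsub>R\<^esub> \<ominus>\<^bsub>R\<^esub> c') \<odot>\<^bsub>M\<^esub> x \<oplus>\<^bsub>M\<^esub> u = (u \<oplus>\<^bsub>M\<^esub> c \<odot>\<^bsub>M\<^esub> x) \<oplus>\<^bsub>M\<^esub> \<ominus>\<^bsub>M\<^esub> (c' \<odot>\<^bsub>M\<^esub> x)"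
      using c uM xM by (simp add: M.M.smult_l_distr M.M.smult_l_minus M.M.a_ac)
    also have "u \<oplus>\<^bsub>M\<^esub> c \<odot>\<^bsub>M\<^esub> x = u' \<oplus>\<^bsub>M\<^esub> c' \<odot>\<^bsub>M\<^esub> x" using u(2,4) by simp
    also have "\<dots> \<oplus>\<^bsub>M\<^esub> \<ominus>\<^bsub>M\<^esub> (c' \<odot>\<^bsub>M\<^esub> x) = u'"
      using c uM xM by (simp add: M.M.a_assoc M.M.r_neg)
    finally have eq: "(c \<oplus>\<^bsub>R\<^esub> \<ominus>\<^bsub>R\<^esub> c') \<odot>\<^bsub>M\<^esub> x \<oplus>\<^bsub>M\<^esub> u = u'" .
    have "(c \<oplus>\<^bsub>R\<^esub> \<ominus>\<^bsub>R\<^esub> c') \<odot>\<^bsub>M\<^esub> x \<in> F"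
    proof (rule M.hsub_diff[OF F _ u(1)])
      show "(c \<oplus>\<^bsub>R\<^esub> \<ominus>\<^bsub>R\<^esub> c') \<odot>\<^bsub>M\<^esub> x \<in> carrier M" using c xM by simp
      show "(c \<oplus>\<^bsub>R\<^esub> \<ominus>\<^bsub>R\<^esub> c') \<odot>\<^bsub>M\<^esub> x \<oplus>\<^bsub>M\<^esub> u \<in> F" unfolding eq by (rule u(3))
    qed
    then have "c \<oplus>\<^bsub>R\<^esub> \<ominus>\<^bsub>R\<^esub> c' \<in> ?I" using iff c by simp
    then have "c \<odot>\<^bsub>Y\<^esub> y \<oplus>\<^bsub>Y\<^esub> \<ominus>\<^bsub>Y\<^esub> (c' \<odot>\<^bsub>Y\<^esub> y) = \<zero>\<^bsub>Y\<^esub>"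
      using c yY by (simp add: ann_def Y.M.smult_l_distr Y.M.smult_l_minus)
    then show ?thesis
      using Y.M.minus_equality[of "c \<odot>\<^bsub>Y\<^esub> y" "\<ominus>\<^bsub>Y\<^esub> (c' \<odot>\<^bsub>Y\<^esub> y)"] c yY by simp
  qed
  have \<phi>: "\<phi> m = c \<odot>\<^bsub>Y\<^esub> y" if "P m c" for m c
    unfolding \<phi>_def using unique[OF someI[of "P m", OF that] that] .
  \<comment> \<open>Multiplication by s changes degrees by e, and replacing x by y turns d into
    \<open>e0\<close>; so \<phi> changes degrees by w, and the shift by its inverse
    compensates.\<close>
  define w where "w = e \<otimes>\<^bsub>G\<^esub> inv\<^bsub>G\<^esub> d \<otimes>\<^bsub>G\<^esub> e0"
  have w: "w \<in> carrier G" using s d e0 by (simp add: w_def)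
  have hom: "\<phi> \<in> ghom G R (gshift G M (inv\<^bsub>G\<^esub> w)) Y"
  proof (rule ghomI)
    show "\<phi> m \<in> carrier Y" if "m \<in> carrier (gshift G M (inv\<^bsub>G\<^esub> w))" for m
    proof -
      obtain c where "P m c" using P \<open>m \<in> _\<close> by auto
      then show ?thesis using \<phi> yY by (auto simp: P_def)
    qed
  next
    fix m n assume "m \<in> carrier (gshift G M (inv\<^bsub>G\<^esub> w))" "n \<in> carrier (gshift G M (inv\<^bsub>G\<^esub> w))"
    then have mn: "m \<in> carrier M" "n \<in> carrier M" by simp_all
    obtain b c where bc: "P m b" "P n c" using P mn by blast
    obtain u v where u: "b \<in> carrier R" "u \<in> F" "s \<odot>\<^bsub>M\<^esub> m = u \<oplus>\<^bsub>M\<^esub> b \<odot>\<^bsub>M\<^esub> x"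
      "c \<in> carrier R" "v \<in> F" "s \<odot>\<^bsub>M\<^esub> n = v \<oplus>\<^bsub>M\<^esub> c \<odot>\<^bsub>M\<^esub> x" using bc unfolding P_def by blast
    have "s \<odot>\<^bsub>M\<^esub> (m \<oplus>\<^bsub>M\<^esub> n) = (u \<oplus>\<^bsub>M\<^esub> v) \<oplus>\<^bsub>M\<^esub> (b \<oplus>\<^bsub>R\<^esub> c) \<odot>\<^bsub>M\<^esub> x"
      using u f(3) mn sR xM by (simp add: M.M.smult_r_distr M.M.smult_l_distr M.M.a_ac)
    then have "P (m \<oplus>\<^bsub>M\<^esub> n) (b \<oplus>\<^bsub>R\<^esub> c)" using u f(4) by (auto simp: P_def)
    then show "\<phi> (m \<oplus>\<^bsub>gshift G M (inv\<^bsub>G\<^esub> w)\<^esub> n) = \<phi> m \<oplus>\<^bsub>Y\<^esub> \<phi> n"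
      using \<phi> bc u yY by (simp add: Y.M.smult_l_distr)
  next
    fix a m assume a: "a \<in> carrier R" and "m \<in> carrier (gshift G M (inv\<^bsub>G\<^esub> w))"
    then have m: "m \<in> carrier M" by simp
    obtain c where c: "P m c" using P m by blast
    then obtain u where u: "c \<in> carrier R" "u \<in> F" "s \<odot>\<^bsub>M\<^esub> m = u \<oplus>\<^bsub>M\<^esub> c \<odot>\<^bsub>M\<^esub> x" unfolding P_def by blast
    have "s \<odot>\<^bsub>M\<^esub> (a \<odot>\<^bsub>M\<^esub> m) = a \<odot>\<^bsub>M\<^esub> (s \<odot>\<^bsub>M\<^esub> m)" by (rule M.M.smult_swap[OF sR a m])
    also have "\<dots> = a \<odot>\<^bsub>M\<^esub> u \<oplus>\<^bsub>M\<^esub> (a \<otimes>\<^bsub>R\<^esub> c) \<odot>\<^bsub>M\<^esub> x"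
      using u f(3) a xM by (simp add: M.M.smult_r_distr M.M.smult_assoc1)
    finally have "P (a \<odot>\<^bsub>M\<^esub> m) (a \<otimes>\<^bsub>R\<^esub> c)" using u a f(5) by (auto simp: P_def)
    then show "\<phi> (a \<odot>\<^bsub>gshift G M (inv\<^bsub>G\<^esub> w)\<^esub> m) = a \<odot>\<^bsub>Y\<^esub> \<phi> m"
      using \<phi> c u a yY by (simp add: Y.M.smult_assoc1)
  next
    fix k m assume k: "k \<in> carrier G" and "m \<in> mgrade (gshift G M (inv\<^bsub>G\<^esub> w)) k"
    then have m: "m \<in> mgrade M (k \<otimes>\<^bsub>G\<^esub> inv\<^bsub>G\<^esub> w)" by simp
    define l where "l = e \<otimes>\<^bsub>G\<^esub> (k \<otimes>\<^bsub>G\<^esub> inv\<^bsub>G\<^esub> w)"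
    \<comment> \<open>For homogeneous m, the coefficient may be replaced by its component in the one
      degree h for which multiplication by x reaches the degree l of s m.\<close>
    define h where "h = l \<otimes>\<^bsub>G\<^esub> inv\<^bsub>G\<^esub> d"
    have l: "l \<in> carrier G" "h \<in> carrier G" using s k w d by (simp_all add: l_def h_def)
    have mM: "m \<in> carrier M" using M.H.D_closed[OF _ m] k w by simp
    obtain c u where cu: "c \<in> carrier R" "u \<in> F" "s \<odot>\<^bsub>M\<^esub> m = u \<oplus>\<^bsub>M\<^esub> c \<odot>\<^bsub>M\<^esub> x" using ex[OF mM] by blast
    have "s \<odot>\<^bsub>M\<^esub> m = M.H.component (s \<odot>\<^bsub>M\<^esub> m) l"
      using M.H.comp_homogeneous[OF l(1) _ l(1)] M.mgrade_smult[OF s(1) _ s(2) m] k w by (simp add: l_def)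
    also have "\<dots> = M.H.component u l \<oplus>\<^bsub>M\<^esub> RG.component c h \<odot>\<^bsub>M\<^esub> x"
      unfolding cu(3) h_def using M.H.comp_add[OF _ _ l(1)] f(3)[OF cu(2)] cu(1) xM
        M.comp_smult_right'[OF d cu(1) l(1)] by simp
    finally have "P m (RG.component c h)"
      using f(7)[OF cu(2) l(1)] RG.comp_closed[OF cu(1) l(2)] by (auto simp: P_def)
    then have "\<phi> m = RG.component c h \<odot>\<^bsub>Y\<^esub> y" by (rule \<phi>)
    moreover have "h \<otimes>\<^bsub>G\<^esub> e0 = k"
    proof -
      have "h \<otimes>\<^bsub>G\<^esub> e0 = k \<otimes>\<^bsub>G\<^esub> (inv\<^bsub>G\<^esub> w \<otimes>\<^bsub>G\<^esub> (e \<otimes>\<^bsub>G\<^esub> inv\<^bsub>G\<^esub> d \<otimes>\<^bsub>G\<^esub> e0))"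
        unfolding h_def l_def using s(1) k w d(1) e0 by (simp add: G.m_ac)
      then have "h \<otimes>\<^bsub>G\<^esub> e0 = k \<otimes>\<^bsub>G\<^esub> (inv\<^bsub>G\<^esub> w \<otimes>\<^bsub>G\<^esub> w)" unfolding w_def[symmetric] .
      then show ?thesis using k w by simp
    qed
    ultimately show "\<phi> m \<in> mgrade Y k"
      using Y.mgrade_smult[OF l(2) e0 RG.comp_mem[OF cu(1) l(2)] y] by simp
  qed
  have "\<phi> m \<in> cyclic R Y y" if "m \<in> carrier M" for m
  proof -
    obtain c where "P m c" using P[OF \<open>m \<in> carrier M\<close>] by (rule exE)
    then show ?thesis using \<phi> cyclicI[of c R Y y] by (auto simp: P_def)
  qed
  \<comment> \<open>Thus \<phi> maps x to s y, which is nonzero because s lies outside Ann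
    y.\<close>
  moreover have "P x s"
    using sR f(2) xM by (auto simp: P_def intro!: bexI[of _ "\<zero>\<^bsub>M\<^esub>"])
  then have "\<phi> x \<noteq> \<zero>\<^bsub>Y\<^esub>" using \<phi> s(3) sR by (simp add: ann_def)
  ultimately show ?thesis using hom w xM by (meson G.inv_closed image_subsetI)
qed

end

section \<open>Coset quotients compared with surjective homomorphisms\<close>

context graded_module begin

lemma abelian_subgroup_hsub: "hsub G R M S \<Longrightarrow> abelian_subgroup S M"
  by (intro abelian_subgroupI3 additive_subgroupI M.abelian_group_axioms)
     (auto simp: hsub_def dest: submodule.axioms(1))

text \<open>Coset arithmetic is reduced once and for all to representatives, so that the coset type
  does not appear in later arguments.\<close>

lemma gquot_ops:
  assumes S: "hsub G R M S"
  shows "carrier (gquot M S) = (\<lambda>x. S +>\<^bsub>M\<^esub> x) ` carrier M"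
    and "x \<in> carrier M \<Longrightarrow> y \<in> carrier M \<Longrightarrow>
      (S +>\<^bsub>M\<^esub> x) \<oplus>\<^bsub>gquot M S\<^esub> (S +>\<^bsub>M\<^esub> y) = S +>\<^bsub>M\<^esub> (x \<oplus>\<^bsub>M\<^esub> y)"
    and "a \<in> carrier R \<Longrightarrow> x \<in> carrier M \<Longrightarrow> a \<odot>\<^bsub>gquot M S\<^esub> (S +>\<^bsub>M\<^esub> x) = S +>\<^bsub>M\<^esub> (a \<odot>\<^bsub>M\<^esub> x)"
    and "mgrade (gquot M S) g = (\<lambda>x. S +>\<^bsub>M\<^esub> x) ` mgrade M g"
    and "x \<in> carrier M \<Longrightarrow> y \<in> carrier M \<Longrightarrow> S +>\<^bsub>M\<^esub> x = S +>\<^bsub>M\<^esub> y \<longleftrightarrow> x \<oplus>\<^bsub>M\<^esub> \<ominus>\<^bsub>M\<^esub> y \<in> S"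
proof -
  interpret S: abelian_subgroup S M by (rule abelian_subgroup_hsub[OF S])
  note s = hsubD[OF S]
  show "carrier (gquot M S) = (\<lambda>x. S +>\<^bsub>M\<^esub> x) ` carrier M"
    by (auto simp: gquot_def A_RCOSETS_def')
  show "(S +>\<^bsub>M\<^esub> x) \<oplus>\<^bsub>gquot M S\<^esub> (S +>\<^bsub>M\<^esub> y) = S +>\<^bsub>M\<^esub> (x \<oplus>\<^bsub>M\<^esub> y)"
    if "x \<in> carrier M" "y \<in> carrier M" using S.a_rcos_sum[OF that] by (simp add: gquot_def)
  have mem: "u \<in> S +>\<^bsub>M\<^esub> x \<longleftrightarrow> u \<oplus>\<^bsub>M\<^esub> \<ominus>\<^bsub>M\<^esub> x \<in> S" if "x \<in> carrier M" "u \<in> carrier M" for x u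
  proof
    assume "u \<in> S +>\<^bsub>M\<^esub> x"
    then obtain h where "h \<in> S" "u = h \<oplus>\<^bsub>M\<^esub> x" by (auto simp: a_r_coset_def')
    then show "u \<oplus>\<^bsub>M\<^esub> \<ominus>\<^bsub>M\<^esub> x \<in> S" using that s(3) by (simp add: M.a_assoc M.r_neg)
  next
    assume "u \<oplus>\<^bsub>M\<^esub> \<ominus>\<^bsub>M\<^esub> x \<in> S"
    moreover have "u = (u \<oplus>\<^bsub>M\<^esub> \<ominus>\<^bsub>M\<^esub> x) \<oplus>\<^bsub>M\<^esub> x" using that by (simp add: M.a_assoc M.l_neg)
    ultimately show "u \<in> S +>\<^bsub>M\<^esub> x" unfolding a_r_coset_def' by blast
  qed
  show eq: "S +>\<^bsub>M\<^esub> x = S +>\<^bsub>M\<^esub> y \<longleftrightarrow> x \<oplus>\<^bsub>M\<^esub> \<ominus>\<^bsub>M\<^esub> y \<in> S" if "x \<in> carrier M" "y \<in> carrier M" for x y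
    using mem[OF that(2,1)] S.a_rcos_self[OF that(1)] M.a_repr_independence[OF _ that(2) S.a_subgroup, of x] by auto
  show "mgrade (gquot M S) g = (\<lambda>x. S +>\<^bsub>M\<^esub> x) ` mgrade M g" by (simp add: gquot_def)
  assume a: "a \<in> carrier R" and x: "x \<in> carrier M"
  \<comment> \<open>Scalar multiplication of cosets is a union over all elements of the coset; each
    of them contributes the same coset, so the union collapses.\<close>
  have *: "S +>\<^bsub>M\<^esub> (a \<odot>\<^bsub>M\<^esub> u) = S +>\<^bsub>M\<^esub> (a \<odot>\<^bsub>M\<^esub> x)" if "u \<in> S +>\<^bsub>M\<^esub> x" for u
  proof -
    have u: "u \<in> carrier M" using that x s(3) by (auto simp: a_r_coset_def')
    have "a \<odot>\<^bsub>M\<^esub> u \<oplus>\<^bsub>M\<^esub> \<ominus>\<^bsub>M\<^esub> (a \<odot>\<^bsub>M\<^esub> x) = a \<odot>\<^bsub>M\<^esub> (u \<oplus>\<^bsub>M\<^esub> \<ominus>\<^bsub>M\<^esub> x)"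
      using a u x by (simp add: M.smult_r_distr M.smult_r_minus)
    also have "\<dots> \<in> S" using s(5)[OF a] mem[OF x u] that by simp
    finally show ?thesis using eq a u x by simp
  qed
  have "a \<odot>\<^bsub>gquot M S\<^esub> (S +>\<^bsub>M\<^esub> x) = (\<Union>u\<in>S +>\<^bsub>M\<^esub> x. S +>\<^bsub>M\<^esub> (a \<odot>\<^bsub>M\<^esub> u))" by (simp add: gquot_def)
  also have "\<dots> = (\<Union>u\<in>S +>\<^bsub>M\<^esub> x. S +>\<^bsub>M\<^esub> (a \<odot>\<^bsub>M\<^esub> x))" using * by simp
  also have "\<dots> = S +>\<^bsub>M\<^esub> (a \<odot>\<^bsub>M\<^esub> x)" using S.a_rcos_self[OF x] by auto
  finally show "a \<odot>\<^bsub>gquot M S\<^esub> (S +>\<^bsub>M\<^esub> x) = S +>\<^bsub>M\<^esub> (a \<odot>\<^bsub>M\<^esub> x)" .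
qed

text \<open>A cokernel meets the subcategory only through an isomorphic copy. Composing with the
  coset map turns the copy into an honest quotient of M.\<close>

lemma quotient_map_of_giso:
  assumes S: "hsub G R M S" and Q: "graded_module G R Q"
    and j: "j \<in> ghom G R (gquot M S) Q" "bij_betw j (carrier (gquot M S)) (carrier Q)"
  shows "(\<lambda>x. j (S +>\<^bsub>M\<^esub> x)) \<in> ghom G R M Q"
    and "(\<lambda>x. j (S +>\<^bsub>M\<^esub> x)) ` carrier M = carrier Q"
    and "a_kernel M Q (\<lambda>x. j (S +>\<^bsub>M\<^esub> x)) = S"
proof -
  interpret Q: graded_module G R Q by fact
  note q = gquot_ops[OF S]
  note s = hsubD[OF S]
  have m: "S +>\<^bsub>M\<^esub> x \<in> carrier (gquot M S)" if "x \<in> carrier M" for x using q(1) that by simp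
  show hom: "(\<lambda>x. j (S +>\<^bsub>M\<^esub> x)) \<in> ghom G R M Q"
  proof (rule ghomI)
    show "j (S +>\<^bsub>M\<^esub> x) \<in> carrier Q" if "x \<in> carrier M" for x
      using m[OF that] j(2) by (auto simp: bij_betw_def)
    show "j (S +>\<^bsub>M\<^esub> (x \<oplus>\<^bsub>M\<^esub> y)) = j (S +>\<^bsub>M\<^esub> x) \<oplus>\<^bsub>Q\<^esub> j (S +>\<^bsub>M\<^esub> y)" if "x \<in> carrier M" "y \<in> carrier M" for x y
      using m[OF that(1)] m[OF that(2)] j(1) q(2)[OF that, symmetric] by (simp add: ghom_def hom_def)
    show "j (S +>\<^bsub>M\<^esub> (a \<odot>\<^bsub>M\<^esub> x)) = a \<odot>\<^bsub>Q\<^esub> j (S +>\<^bsub>M\<^esub> x)" if "a \<in> carrier R" "x \<in> carrier M" for a x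
      using m[OF that(2)] j(1) q(3)[OF that, symmetric] that(1) by (simp add: ghom_def)
    show "j (S +>\<^bsub>M\<^esub> x) \<in> mgrade Q g" if "g \<in> carrier G" "x \<in> mgrade M g" for x g
      using j(1) that unfolding ghom_def by (fastforce simp: q(4))
  qed
  show "(\<lambda>x. j (S +>\<^bsub>M\<^esub> x)) ` carrier M = carrier Q"
    using j(2) q(1) by (auto simp: bij_betw_def)
  interpret p: graded_hom G R M Q "\<lambda>x. j (S +>\<^bsub>M\<^esub> x)"
    by (rule graded_homI[OF graded_module_axioms Q hom])
  have m0: "\<ominus>\<^bsub>M\<^esub> \<zero>\<^bsub>M\<^esub> = \<zero>\<^bsub>M\<^esub>" by (rule M.minus_equality) auto
  have "j (S +>\<^bsub>M\<^esub> x) = \<zero>\<^bsub>Q\<^esub> \<longleftrightarrow> x \<in> S" if x: "x \<in> carrier M" for x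
  proof -
    have "j (S +>\<^bsub>M\<^esub> x) = \<zero>\<^bsub>Q\<^esub> \<longleftrightarrow> j (S +>\<^bsub>M\<^esub> x) = j (S +>\<^bsub>M\<^esub> \<zero>\<^bsub>M\<^esub>)" using p.f_zero by simp
    also have "\<dots> \<longleftrightarrow> S +>\<^bsub>M\<^esub> x = S +>\<^bsub>M\<^esub> \<zero>\<^bsub>M\<^esub>"
      by (rule inj_on_eq_iff[OF bij_betw_imp_inj_on[OF j(2)] m[OF x] m[OF M.zero_closed]])
    also have "\<dots> \<longleftrightarrow> x \<in> S" using q(5)[OF x M.zero_closed] x m0 by simp
    finally show ?thesis .
  qed
  then show "a_kernel M Q (\<lambda>x. j (S +>\<^bsub>M\<^esub> x)) = S" using s(3) by (auto simp: a_kernel_def')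
qed

text \<open>The converse passage: a quotient realised on the element type of M serves as a copy of
  the coset quotient.\<close>

lemma giso_gquot:
  assumes S: "hsub G R M S" and Q: "graded_module G R Q"
    and p: "p \<in> ghom G R M Q" "p ` carrier M = carrier Q" "a_kernel M Q p = S"
  shows "giso G R (gquot M S) Q"
proof -
  interpret p: graded_hom G R M Q p by (rule graded_homI[OF graded_module_axioms Q p(1)])
  note q = gquot_ops[OF S]
  define j where "j c = p (SOME x. x \<in> carrier M \<and> c = S +>\<^bsub>M\<^esub> x)" for c
  have j: "j (S +>\<^bsub>M\<^esub> x) = p x" if x: "x \<in> carrier M" for x
  proof -
    let ?y = "SOME y. y \<in> carrier M \<and> S +>\<^bsub>M\<^esub> x = S +>\<^bsub>M\<^esub> y"
    have "?y \<in> carrier M \<and> S +>\<^bsub>M\<^esub> x = S +>\<^bsub>M\<^esub> ?y" by (rule someI[of _ x]) (use x in simp)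
    then show ?thesis unfolding j_def using q(5)[of x ?y] p.f_eq_iff[of x ?y] p(3) x by simp
  qed
  have "j \<in> ghom G R (gquot M S) Q"
  proof (rule ghomI)
    fix u v assume "u \<in> carrier (gquot M S)" "v \<in> carrier (gquot M S)"
    then obtain x y where "x \<in> carrier M" "u = S +>\<^bsub>M\<^esub> x" "y \<in> carrier M" "v = S +>\<^bsub>M\<^esub> y" unfolding q(1) by blast
    then show "j (u \<oplus>\<^bsub>gquot M S\<^esub> v) = j u \<oplus>\<^bsub>Q\<^esub> j v" by (simp add: q(2) j p.f_add)
  next
    fix a u assume "a \<in> carrier R" "u \<in> carrier (gquot M S)"
    moreover from this obtain x where "x \<in> carrier M" "u = S +>\<^bsub>M\<^esub> x" unfolding q(1) by blast
    ultimately show "j (a \<odot>\<^bsub>gquot M S\<^esub> u) = a \<odot>\<^bsub>Q\<^esub> j u" by (simp add: q(3) j p.f_smult)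
  next
    fix u assume "u \<in> carrier (gquot M S)"
    then show "j u \<in> carrier Q" unfolding q(1) using j by auto
  next
    fix g u assume "g \<in> carrier G" "u \<in> mgrade (gquot M S) g"
    then show "j u \<in> mgrade Q g" unfolding q(4) using j H.D_closed p.f_degree by auto
  qed
  moreover have "inj_on j (carrier (gquot M S))"
    unfolding q(1) using j q(5) p.f_eq_iff p(3) by (auto simp: inj_on_def)
  moreover have "j ` carrier (gquot M S) = carrier Q"
    unfolding q(1) image_image p(2)[symmetric] by (rule image_cong) (auto simp: j)
  ultimately show ?thesis unfolding giso_def bij_betw_def by blast
qed

end

context graded_hom begin

lemma restrict_domain: "S \<subseteq> carrier M \<Longrightarrow> f \<in> ghom G R (gsub M S) N"
  by (rule ghomI) (auto simp: f_add f_smult f_degree subset_iff)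

lemma restrict_both: "S \<subseteq> carrier M \<Longrightarrow> f ` S \<subseteq> T \<Longrightarrow> f \<in> ghom G R (gsub M S) (gsub N T)"
  by (rule ghomI) (auto simp: f_add f_smult f_degree subset_iff)

end

text \<open>The identity of M factors through the surjection f because f has zero kernel; in
  particular the inverse preserves degrees.\<close>

lemma inverse_ghom:
  assumes M: "graded_module G R M" and N: "graded_module G R N"
    and f: "f \<in> ghom G R M N" "bij_betw f (carrier M) (carrier N)"
  shows "\<exists>f'\<in>ghom G R N M. bij_betw f' (carrier N) (carrier M)"
proof -
  interpret f: graded_hom G R M N f by (intro graded_homI M N f)
  have "a_kernel M N f = {\<zero>\<^bsub>M\<^esub>}" using f(2) f.inj_on_iff_kernel by (simp add: bij_betw_def)
  then have k: "a_kernel M N f \<subseteq> a_kernel M M (\<lambda>x. x)" by (simp add: a_kernel_def')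
  have id: "(\<lambda>x. x) \<in> ghom G R M M" by (rule ghomI) auto
  obtain f' where f': "f' \<in> ghom G R N M" "\<And>x. x \<in> carrier M \<Longrightarrow> f' (f x) = x"
    using factor_through_surjection[OF M M N f(1) bij_betw_imp_surj_on[OF f(2)] id k] by blast
  have "inj_on f' (carrier N)"
    unfolding bij_betw_imp_surj_on[OF f(2), symmetric] by (auto simp: inj_on_def f'(2))
  moreover have "f' ` carrier N = carrier M"
    unfolding bij_betw_imp_surj_on[OF f(2), symmetric] by (auto simp: f'(2) image_image)
  ultimately show ?thesis using f'(1) by (auto simp: bij_betw_def)
qed

subsection \<open>Subcategories closed under grading shifts\<close>

locale graded_subcategory = noetherian_graded_cring G R
  for G :: "'g monoid" and R :: "('g, 'r) graded_ring" +
  fixes \<C> :: "('g, 'r, 'm) graded_module set"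
  assumes subcategory: "subcategory G R \<C>" and shift_closed: "shift_closed G \<C>"
begin

lemma in_gmod: "M \<in> \<C> \<Longrightarrow> M \<in> gmod G R"
  using subcategory by (auto simp: subcategory_def)

lemma in_graded_module: "M \<in> \<C> \<Longrightarrow> graded_module G R M"
  using in_gmod gmodD(1) by blast

lemma iso_closed:
  "M \<in> \<C> \<Longrightarrow> N \<in> gmod G R \<Longrightarrow> f \<in> ghom G R M N \<Longrightarrow> bij_betw f (carrier M) (carrier N) \<Longrightarrow> N \<in> \<C>"
  using subcategory unfolding subcategory_def giso_def by blast

lemma shift_mem: "M \<in> \<C> \<Longrightarrow> g \<in> carrier G \<Longrightarrow> gshift G M g \<in> \<C>"
  using shift_closed by (simp add: shift_closed_def)

lemma zero_mem:
  assumes "additive_subcategory G R \<C>" and N: "N \<in> gmod G R" "carrier N = {\<zero>\<^bsub>N\<^esub>}"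
  shows "N \<in> \<C>"
proof -
  interpret N: graded_module G R N by (rule gmodD(1)[OF N(1)])
  obtain Z where Z: "Z \<in> \<C>" "carrier Z = {\<zero>\<^bsub>Z\<^esub>}" using assms(1) by (auto simp: additive_subcategory_def)
  have "(\<lambda>_. \<zero>\<^bsub>N\<^esub>) \<in> ghom G R Z N" by (rule ghomI) (auto simp: N.H.D_zero)
  moreover have "bij_betw (\<lambda>_. \<zero>\<^bsub>N\<^esub>) (carrier Z) (carrier N)" using Z(2) N(2) by (simp add: bij_betw_def)
  ultimately show ?thesis using iso_closed[OF Z(1) N(1)] by blast
qed

lemma extension_mem:
  assumes "closed_extensions G R \<C>" and M: "M \<in> gmod G R" and N: "N \<in> \<C>"
    and p: "p \<in> ghom G R M N" "p ` carrier M = carrier N" and k: "gsub M (a_kernel M N p) \<in> \<C>"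
  shows "M \<in> \<C>"
proof -
  interpret p: graded_hom G R M N p by (intro graded_homI gmodD(1)[OF M] in_graded_module N p)
  have "short_exact G R (gsub M (a_kernel M N p)) (\<lambda>x. x) M p N"
    unfolding short_exact_def using p p.M.inclusion_gsub[OF p.M.hsubD(1)[OF p.hsub_kernel]] by simp
  then show ?thesis using assms(1) M N k unfolding closed_extensions_def by blast
qed

text \<open>The working form of closure under cokernels: a member of the subcategory together with a
  surjection whose kernel is the image of f.\<close>

lemma cokernel_mem:
  assumes "closed_cokernels G R \<C>" and M: "M \<in> \<C>" and N: "N \<in> \<C>" and f: "f \<in> ghom G R M N"
  shows "\<exists>Q\<in>\<C>. \<exists>p\<in>ghom G R N Q. p ` carrier N = carrier Q \<and> a_kernel N Q p = f ` carrier M"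
proof -
  interpret f: graded_hom G R M N f by (intro graded_homI in_graded_module M N f)
  obtain Q j where Q: "Q \<in> \<C>" "j \<in> ghom G R (gquot N (f ` carrier M)) Q"
    "bij_betw j (carrier (gquot N (f ` carrier M))) (carrier Q)"
    using assms unfolding closed_cokernels_def has_copy_def giso_def gCok_def by blast
  show ?thesis
    using f.N.quotient_map_of_giso[OF f.hsub_image[OF f.M.hsub_carrier] in_graded_module[OF Q(1)] Q(2,3)] Q(1)
    by blast
qed

lemma closed_cokernels_if_quotients:
  assumes "closed_quotients G R \<C>" shows "closed_cokernels G R \<C>"
  unfolding closed_cokernels_def
proof (intro ballI)
  fix M N f assume M: "M \<in> \<C>" and N: "N \<in> \<C>" and f: "f \<in> ghom G R M N"
  interpret f: graded_hom G R M N f by (intro graded_homI in_graded_module M N f)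
  have S: "hsub G R N (f ` carrier M)" by (rule f.hsub_image[OF f.M.hsub_carrier])
  obtain Q :: "('g, 'r, 'm) graded_module" and p where Q: "Q \<in> gmod G R" "p \<in> ghom G R N Q"
    "p ` carrier N = carrier Q" "a_kernel N Q p = f ` carrier M"
    using quotient_gmod_exists[OF in_gmod[OF N] S] by blast
  have "Q \<in> \<C>" using assms N Q(1-3) unfolding closed_quotients_def by blast
  then show "has_copy G R \<C> (gCok M N f)"
    unfolding has_copy_def gCok_def using f.N.giso_gquot[OF S gmodD(1)[OF Q(1)] Q(2-4)] by blast
qed

lemma gsub_mem_if_subobjects:
  assumes "closed_subobjects G R \<C>" and M: "M \<in> \<C>" and S: "hsub G R M S"
  shows "gsub M S \<in> \<C>"
proof -
  interpret M: graded_module G R M by (rule in_graded_module[OF M])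
  have "(\<lambda>x. x) \<in> ghom G R (gsub M S) M" by (rule M.inclusion_gsub[OF M.hsubD(1)[OF S]])
  moreover have "inj_on (\<lambda>x. x) (carrier (gsub M S))" by (simp add: inj_on_def)
  ultimately show ?thesis
    using assms(1) M gsub_gmod[OF in_gmod[OF M] S] unfolding closed_subobjects_def by blast
qed

lemma closed_kernels_images_if_subobjects:
  assumes "closed_subobjects G R \<C>"
  shows "closed_kernels G R \<C>" "closed_images G R \<C>"
proof -
  have *: "gKer M N f \<in> \<C> \<and> gIm M N f \<in> \<C>"
    if M: "M \<in> \<C>" and N: "N \<in> \<C>" and f: "f \<in> ghom G R M N" for M N f
  proof -
    interpret f: graded_hom G R M N f by (intro graded_homI in_graded_module M N f)
    show ?thesis
      unfolding gKer_def gIm_def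
      using gsub_mem_if_subobjects[OF assms M f.hsub_kernel]
        gsub_mem_if_subobjects[OF assms N f.hsub_image[OF f.M.hsub_carrier]] by blast
  qed
  show "closed_kernels G R \<C>" "closed_images G R \<C>"
    unfolding closed_kernels_def closed_images_def using * by blast+
qed

lemma closed_subobjects_if_gsub:
  assumes "\<And>M S. M \<in> \<C> \<Longrightarrow> hsub G R M S \<Longrightarrow> gsub M S \<in> \<C>"
  shows "closed_subobjects G R \<C>"
  unfolding closed_subobjects_def
proof (intro ballI impI)
  fix M L :: "('g, 'r, 'm) graded_module" and i assume M: "M \<in> \<C>" and L: "L \<in> gmod G R" and i: "i \<in> ghom G R L M" "inj_on i (carrier L)"
  interpret i: graded_hom G R L M i by (intro graded_homI gmodD(1)[OF L] in_graded_module M i)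
  have S: "hsub G R M (i ` carrier L)" by (rule i.hsub_image[OF i.M.hsub_carrier])
  have mem: "gsub M (i ` carrier L) \<in> \<C>" by (rule assms[OF M S])
  have "i \<in> ghom G R L (gsub M (i ` carrier L))"
    by (rule ghomI) (auto simp: i.f_add i.f_smult i.f_degree i.M.H.D_closed)
  moreover have "bij_betw i (carrier L) (carrier (gsub M (i ` carrier L)))"
    using i(2) by (simp add: bij_betw_def)
  ultimately obtain f where "f \<in> ghom G R (gsub M (i ` carrier L)) L"
    "bij_betw f (carrier (gsub M (i ` carrier L))) (carrier L)"
    using inverse_ghom[OF gmodD(1)[OF L] in_graded_module[OF mem]] by blast
  then show "L \<in> \<C>" by (rule iso_closed[OF mem L])
qed

text \<open>The product lives on another type, so only a copy S of it is available. Recorded are the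
  two projections, the first inclusion and the facts about them that a pullback inside S
  requires.\<close>

lemma direct_sum_mem:
  assumes "additive_subcategory G R \<C>" and M: "M \<in> \<C>" and N: "N \<in> \<C>"
  shows "\<exists>S\<in>\<C>. \<exists>i\<in>ghom G R M S. \<exists>p\<in>ghom G R S M. \<exists>q\<in>ghom G R S N.
    (\<forall>u\<in>carrier M. p (i u) = u \<and> q (i u) = \<zero>\<^bsub>N\<^esub>) \<and>
    (\<forall>s\<in>carrier S. q s = \<zero>\<^bsub>N\<^esub> \<longrightarrow> s = i (p s)) \<and>
    (\<forall>u\<in>carrier M. \<forall>v\<in>carrier N. \<exists>s\<in>carrier S. p s = u \<and> q s = v)"
proof -
  interpret M: graded_module G R M by (rule in_graded_module[OF M])
  interpret N: graded_module G R N by (rule in_graded_module[OF N])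
  obtain S j where S: "S \<in> \<C>" "j \<in> ghom G R (gsum M N) S" "bij_betw j (carrier (gsum M N)) (carrier S)"
    using assms unfolding additive_subcategory_def has_copy_def giso_def by blast
  interpret S: graded_module G R S by (rule in_graded_module[OF S(1)])
  have gs: "carrier (gsum M N) = carrier M \<times> carrier N"
    "(u, v) \<oplus>\<^bsub>gsum M N\<^esub> (u', v') = (u \<oplus>\<^bsub>M\<^esub> u', v \<oplus>\<^bsub>N\<^esub> v')"
    "a \<odot>\<^bsub>gsum M N\<^esub> (u, v) = (a \<odot>\<^bsub>M\<^esub> u, a \<odot>\<^bsub>N\<^esub> v)"
    "mgrade (gsum M N) g = mgrade M g \<times> mgrade N g" for u v u' v' a g
    by (simp_all add: gsum_def)
  have jcl: "j (u, v) \<in> carrier S" if "u \<in> carrier M" "v \<in> carrier N" for u v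
    using S(3) gs(1) that by (auto simp: bij_betw_def)
  have jadd: "j (u \<oplus>\<^bsub>M\<^esub> u', v \<oplus>\<^bsub>N\<^esub> v') = j (u, v) \<oplus>\<^bsub>S\<^esub> j (u', v')"
    if "u \<in> carrier M" "v \<in> carrier N" "u' \<in> carrier M" "v' \<in> carrier N" for u v u' v'
    using S(2) gs(1) that unfolding gs(2)[symmetric] by (simp add: ghom_def hom_def)
  have jsm: "j (a \<odot>\<^bsub>M\<^esub> u, a \<odot>\<^bsub>N\<^esub> v) = a \<odot>\<^bsub>S\<^esub> j (u, v)"
    if "a \<in> carrier R" "u \<in> carrier M" "v \<in> carrier N" for a u v
    using S(2) gs(1) that unfolding gs(3)[symmetric] by (simp add: ghom_def)
  have jdeg: "j (u, v) \<in> mgrade S g" if "g \<in> carrier G" "u \<in> mgrade M g" "v \<in> mgrade N g" for g u v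
    using S(2) that unfolding ghom_def mem_Collect_eq gs(4) by blast
  have jinj: "u = u' \<and> v = v'" if "j (u, v) = j (u', v')"
    "u \<in> carrier M" "v \<in> carrier N" "u' \<in> carrier M" "v' \<in> carrier N" for u v u' v'
    using inj_onD[OF bij_betw_imp_inj_on[OF S(3)] that(1)] that(2-) by (simp add: gs(1))
  have jsurj: "\<exists>u\<in>carrier M. \<exists>v\<in>carrier N. s = j (u, v)" if "s \<in> carrier S" for s
    using that bij_betw_imp_surj_on[OF S(3)] unfolding gs(1) by blast
  define k where "k s = (SOME z. z \<in> carrier M \<times> carrier N \<and> j z = s)" for s
  have k: "k (j (u, v)) = (u, v)" if "u \<in> carrier M" "v \<in> carrier N" for u v
  proof -
    let ?z = "k (j (u, v))"
    have "?z \<in> carrier M \<times> carrier N \<and> j ?z = j (u, v)"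
      unfolding k_def by (rule someI[of _ "(u, v)"]) (use that in simp)
    then show ?thesis using jinj[of "fst ?z" "snd ?z" u v] that by (auto simp: prod_eq_iff)
  qed
  have i1: "(\<lambda>u. j (u, \<zero>\<^bsub>N\<^esub>)) \<in> ghom G R M S"
  proof (rule ghomI)
    show "j (x \<oplus>\<^bsub>M\<^esub> y, \<zero>\<^bsub>N\<^esub>) = j (x, \<zero>\<^bsub>N\<^esub>) \<oplus>\<^bsub>S\<^esub> j (y, \<zero>\<^bsub>N\<^esub>)"
      if "x \<in> carrier M" "y \<in> carrier M" for x y using jadd[of x "\<zero>\<^bsub>N\<^esub>" y "\<zero>\<^bsub>N\<^esub>"] that by simp
    show "j (a \<odot>\<^bsub>M\<^esub> x, \<zero>\<^bsub>N\<^esub>) = a \<odot>\<^bsub>S\<^esub> j (x, \<zero>\<^bsub>N\<^esub>)"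
      if "a \<in> carrier R" "x \<in> carrier M" for a x using jsm[of a x "\<zero>\<^bsub>N\<^esub>"] that by simp
  qed (use jcl jdeg N.H.D_zero in auto)
  have i2: "(\<lambda>v. j (\<zero>\<^bsub>M\<^esub>, v)) \<in> ghom G R N S"
  proof (rule ghomI)
    show "j (\<zero>\<^bsub>M\<^esub>, x \<oplus>\<^bsub>N\<^esub> y) = j (\<zero>\<^bsub>M\<^esub>, x) \<oplus>\<^bsub>S\<^esub> j (\<zero>\<^bsub>M\<^esub>, y)"
      if "x \<in> carrier N" "y \<in> carrier N" for x y using jadd[of "\<zero>\<^bsub>M\<^esub>" x "\<zero>\<^bsub>M\<^esub>" y] that by simp
    show "j (\<zero>\<^bsub>M\<^esub>, a \<odot>\<^bsub>N\<^esub> x) = a \<odot>\<^bsub>S\<^esub> j (\<zero>\<^bsub>M\<^esub>, x)"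
      if "a \<in> carrier R" "x \<in> carrier N" for a x using jsm[of a "\<zero>\<^bsub>M\<^esub>" x] that by simp
  qed (use jcl jdeg M.H.D_zero in auto)
  interpret i1: graded_hom G R M S "\<lambda>u. j (u, \<zero>\<^bsub>N\<^esub>)"
    by (rule graded_homI[OF M.graded_module_axioms S.graded_module_axioms i1])
  interpret i2: graded_hom G R N S "\<lambda>v. j (\<zero>\<^bsub>M\<^esub>, v)"
    by (rule graded_homI[OF N.graded_module_axioms S.graded_module_axioms i2])
  \<comment> \<open>The map j is bijective and preserves degrees; that its inverse k does so too
    follows by comparing s with its own component, since j commutes with taking components in each
    summand.\<close>
  have kdeg: "fst (k s) \<in> mgrade M g \<and> snd (k s) \<in> mgrade N g" if g: "g \<in> carrier G" and s: "s \<in> mgrade S g" for g s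
  proof -
    obtain u v where uv: "u \<in> carrier M" "v \<in> carrier N" "s = j (u, v)"
      using jsurj S.H.D_closed[OF g s] by blast
    have s': "s = j (u, \<zero>\<^bsub>N\<^esub>) \<oplus>\<^bsub>S\<^esub> j (\<zero>\<^bsub>M\<^esub>, v)" using uv jadd[of u "\<zero>\<^bsub>N\<^esub>" "\<zero>\<^bsub>M\<^esub>" v] by simp
    have cc: "M.H.component u g \<in> carrier M" "N.H.component v g \<in> carrier N"
      using M.H.comp_closed N.H.comp_closed uv g by auto
    have "s = S.H.component s g" using S.H.comp_homogeneous[OF g s g] by simp
    also have "\<dots> = j (M.H.component u g, \<zero>\<^bsub>N\<^esub>) \<oplus>\<^bsub>S\<^esub> j (\<zero>\<^bsub>M\<^esub>, N.H.component v g)"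
      unfolding s' using uv g jcl by (simp add: S.H.comp_add i1.f_comp i2.f_comp)
    also have "\<dots> = j (M.H.component u g, N.H.component v g)"
      using cc jadd[of "M.H.component u g" "\<zero>\<^bsub>N\<^esub>" "\<zero>\<^bsub>M\<^esub>" "N.H.component v g"] by simp
    finally have "u = M.H.component u g \<and> v = N.H.component v g" using jinj[of u v] uv cc by simp
    then show ?thesis using k[OF uv(1,2)] uv M.H.comp_mem[OF uv(1) g] N.H.comp_mem[OF uv(2) g] by simp
  qed
  have p: "(\<lambda>s. fst (k s)) \<in> ghom G R S M" "(\<lambda>s. snd (k s)) \<in> ghom G R S N"
  proof -
    have cl: "fst (k s) \<in> carrier M \<and> snd (k s) \<in> carrier N" if s: "s \<in> carrier S" for s
      using jsurj[OF s] k by auto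
    have ad: "k (s \<oplus>\<^bsub>S\<^esub> t) = (fst (k s) \<oplus>\<^bsub>M\<^esub> fst (k t), snd (k s) \<oplus>\<^bsub>N\<^esub> snd (k t))"
      if st: "s \<in> carrier S" "t \<in> carrier S" for s t
    proof -
      obtain u v u' v' where *: "u \<in> carrier M" "v \<in> carrier N" "s = j (u, v)"
        "u' \<in> carrier M" "v' \<in> carrier N" "t = j (u', v')" using jsurj[OF st(1)] jsurj[OF st(2)] by blast
      then show ?thesis using k[of "u \<oplus>\<^bsub>M\<^esub> u'" "v \<oplus>\<^bsub>N\<^esub> v'"] jadd[OF *(1,2,4,5)] by (simp add: k)
    qed
    have sm: "k (a \<odot>\<^bsub>S\<^esub> s) = (a \<odot>\<^bsub>M\<^esub> fst (k s), a \<odot>\<^bsub>N\<^esub> snd (k s))"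
      if as: "a \<in> carrier R" "s \<in> carrier S" for a s
    proof -
      obtain u v where *: "u \<in> carrier M" "v \<in> carrier N" "s = j (u, v)" using jsurj[OF as(2)] by blast
      then show ?thesis using k[of "a \<odot>\<^bsub>M\<^esub> u" "a \<odot>\<^bsub>N\<^esub> v"] jsm[OF as(1) *(1,2)] as(1) by (simp add: k)
    qed
    show "(\<lambda>s. fst (k s)) \<in> ghom G R S M" "(\<lambda>s. snd (k s)) \<in> ghom G R S N"
      by (rule ghomI; use cl ad sm kdeg in simp)+
  qed
  show ?thesis
  proof (intro bexI[OF _ S(1)] bexI[OF _ i1] bexI[OF _ p(1)] bexI[OF _ p(2)] conjI ballI impI)
    show "fst (k (j (u, \<zero>\<^bsub>N\<^esub>))) = u" "snd (k (j (u, \<zero>\<^bsub>N\<^esub>))) = \<zero>\<^bsub>N\<^esub>" if "u \<in> carrier M" for u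
      using k[OF that N.M.zero_closed] by simp_all
    show "s = j (fst (k s), \<zero>\<^bsub>N\<^esub>)" if "s \<in> carrier S" "snd (k s) = \<zero>\<^bsub>N\<^esub>" for s
    proof -
      obtain u v where "u \<in> carrier M" "v \<in> carrier N" "s = j (u, v)" using jsurj[OF \<open>s \<in> carrier S\<close>] by blast
      then show ?thesis using k that(2) by simp
    qed
    show "\<exists>s\<in>carrier S. fst (k s) = u \<and> snd (k s) = v" if "u \<in> carrier M" "v \<in> carrier N" for u v
      using k[OF that] jcl[OF that] by (intro bexI[of _ "j (u, v)"]) simp_all
  qed
qed

section \<open>Maximal submodules in the subcategory, and closure under images and
  extensions\<close>

lemma zero_submodule_mem:
  assumes "additive_subcategory G R \<C>" and M: "M \<in> gmod G R" shows "gsub M {\<zero>\<^bsub>M\<^esub>} \<in> \<C>"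
proof -
  interpret M: graded_module G R M by (rule gmodD(1)[OF M])
  show ?thesis using zero_mem[OF assms(1) gsub_gmod[OF M M.hsub_zero]] by simp
qed

text \<open>The zero submodule makes the family nonempty, and the chain condition on homogeneous
  submodules supplies a maximal member. No uniqueness is claimed.\<close>

lemma maximal_submodule_mem:
  assumes "additive_subcategory G R \<C>" and M: "M \<in> gmod G R" and N: "hsub G R M N"
  shows "\<exists>L. hsub G R M L \<and> L \<subseteq> N \<and> gsub M L \<in> \<C> \<and>
    (\<forall>T. hsub G R M T \<and> T \<subseteq> N \<and> gsub M T \<in> \<C> \<and> L \<subseteq> T \<longrightarrow> T = L)"
proof -
  interpret M: graded_module G R M by (rule gmodD(1)[OF M])
  define \<F> where "\<F> = {L. hsub G R M L \<and> L \<subseteq> N \<and> gsub M L \<in> \<C>}"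
  have "{\<zero>\<^bsub>M\<^esub>} \<in> \<F>"
    using M.hsub_zero M.hsubD(2)[OF N] zero_submodule_mem[OF assms(1,2)] by (simp add: \<F>_def)
  moreover have "\<F> \<subseteq> {U. hsub G R M U}" by (auto simp: \<F>_def)
  ultimately have "\<exists>L\<in>\<F>. \<forall>T\<in>\<F>. L \<subseteq> T \<longrightarrow> T = L"
    by (intro acc_maximal[OF M.acc_hsubs[OF noeth gmodD(2)[OF M]]]) auto
  then show ?thesis by (auto simp: \<F>_def)
qed

text \<open>The pullback is a kernel of a map into Q = M/L, which may lie outside the subcategory.
  Its membership therefore comes from an extension, and closure under images is applied only to its
  projection to M.\<close>

lemma gsub_mem_if_IE_closed:
  assumes add: "additive_subcategory G R \<C>" and im: "closed_images G R \<C>" and ext: "closed_extensions G R \<C>"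
    and M: "M \<in> \<C>" and N: "hsub G R M N"
  shows "gsub M N \<in> \<C>"
proof -
  interpret M: graded_module G R M by (rule in_graded_module[OF M])
  obtain L where L: "hsub G R M L" "L \<subseteq> N" "gsub M L \<in> \<C>"
    and max: "\<And>T. hsub G R M T \<Longrightarrow> T \<subseteq> N \<Longrightarrow> gsub M T \<in> \<C> \<Longrightarrow> L \<subseteq> T \<Longrightarrow> T = L"
    using maximal_submodule_mem[OF add in_gmod[OF M] N] by blast
  have "N \<subseteq> L"
  proof (rule ccontr)
    assume "\<not> N \<subseteq> L"
    then obtain z0 where z0: "z0 \<in> N" "z0 \<notin> L" by blast
    obtain g z where z: "g \<in> carrier G" "z \<in> mgrade M g" "z \<notin> L" "z = M.H.component z0 g"
      using M.hsub_homogeneous_notin[OF L(1) M.hsubD(3)[OF N z0(1)] z0(2)] .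
    have zN: "z \<in> N" using z(4) M.hsubD(7)[OF N z0(1) z(1)] by simp
    obtain Q :: "('g, 'r, 'm) graded_module" and q where Q: "Q \<in> gmod G R" "q \<in> ghom G R M Q"
      "q ` carrier M = carrier Q" "a_kernel M Q q = L"
      using quotient_gmod_exists[OF in_gmod[OF M] L(1)] by blast
    interpret q: graded_hom G R M Q q by (intro graded_homI M.graded_module_axioms gmodD(1)[OF Q(1)] Q(2))
    \<comment> \<open>Choosing y in the image of N is what later confines the image of the pullback
      to N.\<close>
    have W: "hsub G R Q (q ` N)" by (rule q.hsub_image[OF N])
    have qz: "q z \<noteq> \<zero>\<^bsub>Q\<^esub>" using z(3) Q(4) q.mem_kernel M.hsubD(3)[OF N zN] by blast
    obtain e y where y: "e \<in> carrier G" "y \<in> mgrade Q e" "y \<in> q ` N" "hprime (ann R Q {y})"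
      using exists_prime_annihilator[OF gmodD(1)[OF Q(1)] q.N.hsubD(5)[OF W] z(1) q.f_degree[OF z(1,2)] imageI[OF zN] qz]
      by blast
    have "ann R M (carrier M) \<subseteq> ann R Q {y}"
    proof
      fix r assume r: "r \<in> ann R M (carrier M)"
      obtain m where m: "m \<in> N" "y = q m" using y(3) by blast
      have "r \<odot>\<^bsub>Q\<^esub> q m = q (r \<odot>\<^bsub>M\<^esub> m)"
        using q.f_smult[of r m] r M.hsubD(3)[OF N m(1)] by (simp add: ann_def)
      then show "r \<in> ann R Q {y}" using r m M.hsubD(3)[OF N m(1)] by (simp add: ann_def)
    qed
    then obtain h \<phi> x where h: "h \<in> carrier G" and \<phi>: "\<phi> \<in> ghom G R (gshift G M h) Q"
      and im_\<phi>: "\<phi> ` carrier M \<subseteq> cyclic R Q y" and x: "x \<in> carrier M" "\<phi> x \<noteq> \<zero>\<^bsub>Q\<^esub>"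
      using nonzero_hom_from_shift[OF in_gmod[OF M] gmodD(1)[OF Q(1)] y(1,2,4)] by blast
    define M' where "M' = gshift G M h"
    have M': "M' \<in> \<C>" unfolding M'_def by (rule shift_mem[OF M h])
    have cM': "carrier M' = carrier M" by (simp add: M'_def)
    interpret \<phi>: graded_hom G R M' Q \<phi>
      using \<phi> by (intro graded_homI in_graded_module M' gmodD(1)[OF Q(1)]) (simp add: M'_def)
    obtain S i p1 p2 where S: "S \<in> \<C>" and i: "i \<in> ghom G R M S" and p1: "p1 \<in> ghom G R S M" and p2: "p2 \<in> ghom G R S M'"
      and pi: "\<And>u. u \<in> carrier M \<Longrightarrow> p1 (i u) = u" "\<And>u. u \<in> carrier M \<Longrightarrow> p2 (i u) = \<zero>\<^bsub>M'\<^esub>"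
      and ip: "\<And>s. s \<in> carrier S \<Longrightarrow> p2 s = \<zero>\<^bsub>M'\<^esub> \<Longrightarrow> s = i (p1 s)"
      and pair: "\<And>u v. u \<in> carrier M \<Longrightarrow> v \<in> carrier M' \<Longrightarrow> \<exists>s\<in>carrier S. p1 s = u \<and> p2 s = v"
      using direct_sum_mem[OF add M M'] by auto
    interpret i: graded_hom G R M S i by (intro graded_homI in_graded_module M S i)
    interpret p1: graded_hom G R S M p1 by (intro graded_homI in_graded_module M S p1)
    interpret p2: graded_hom G R S M' p2 by (intro graded_homI in_graded_module M' S p2)
    \<comment> \<open>The pullback of q and \<phi> is the kernel of this difference on the direct
      sum.\<close>
    define f where "f s = q (p1 s) \<oplus>\<^bsub>Q\<^esub> \<ominus>\<^bsub>Q\<^esub> \<phi> (p2 s)" for s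
    have f: "f \<in> ghom G R S Q"
    proof (rule ghomI)
      show "f (s \<oplus>\<^bsub>S\<^esub> t) = f s \<oplus>\<^bsub>Q\<^esub> f t" if "s \<in> carrier S" "t \<in> carrier S" for s t
        using that by (simp add: f_def p1.f_add p2.f_add q.f_add \<phi>.f_add q.N.M.minus_add q.N.M.a_ac)
      show "f (a \<odot>\<^bsub>S\<^esub> s) = a \<odot>\<^bsub>Q\<^esub> f s" if "a \<in> carrier R" "s \<in> carrier S" for a s
        using that by (simp add: f_def p1.f_smult p2.f_smult q.f_smult \<phi>.f_smult
          q.N.M.smult_r_distr q.N.M.smult_r_minus)
      show "f s \<in> mgrade Q g" if "g \<in> carrier G" "s \<in> mgrade S g" for g s
        unfolding f_def using that
        by (intro q.N.H.D_add q.N.H.D_minus q.f_degree \<phi>.f_degree p1.f_degree p2.f_degree)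
    qed (simp add: f_def)
    interpret f: graded_hom G R S Q f by (intro graded_homI in_graded_module S gmodD(1)[OF Q(1)] f)
    define E where "E = a_kernel S Q f"
    have E: "hsub G R S E" unfolding E_def by (rule f.hsub_kernel)
    have memE: "s \<in> E \<longleftrightarrow> s \<in> carrier S \<and> q (p1 s) = \<phi> (p2 s)" for s
    proof -
      have "f s = \<zero>\<^bsub>Q\<^esub> \<longleftrightarrow> q (p1 s) = \<phi> (p2 s)" if "s \<in> carrier S"
        using that q.N.M.minus_equality[of "q (p1 s)" "\<ominus>\<^bsub>Q\<^esub> \<phi> (p2 s)"]
        by (auto simp: f_def q.N.M.r_neg)
      then show ?thesis unfolding E_def f.mem_kernel by blast
    qed
    have gE: "gsub S E \<in> gmod G R" by (rule gsub_gmod[OF in_gmod[OF S] E])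
    have ES: "E \<subseteq> carrier S" by (rule i.N.hsubD(1)[OF E])
    have iL: "i l \<in> E" if "l \<in> L" for l
    proof -
      have "l \<in> carrier M" "q l = \<zero>\<^bsub>Q\<^esub>" using that Q(4) q.mem_kernel by auto
      then show ?thesis by (simp add: memE pi)
    qed
    \<comment> \<open>The second projection is onto because q is, and its kernel on E consists of
      the pairs (l, 0) with l in L.\<close>
    have EM: "gsub S E \<in> \<C>"
    proof -
      have "i \<in> ghom G R (gsub M L) (gsub S E)"
        using iL by (intro i.restrict_both M.hsubD(1)[OF L(1)]) auto
      moreover have "inj_on i L" using pi(1) M.hsubD(1)[OF L(1)] by (metis inj_onI subsetD)
      moreover have "i ` L = a_kernel (gsub S E) M' p2"
      proof
        show "i ` L \<subseteq> a_kernel (gsub S E) M' p2"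
          using iL pi(2) M.hsubD(1)[OF L(1)] by (auto simp: a_kernel_def')
        show "a_kernel (gsub S E) M' p2 \<subseteq> i ` L"
        proof
          fix s assume "s \<in> a_kernel (gsub S E) M' p2"
          then have s: "s \<in> E" "p2 s = \<zero>\<^bsub>M'\<^esub>" by (auto simp: a_kernel_def')
          then have sS: "s \<in> carrier S" using memE by blast
          have "q (p1 s) = \<zero>\<^bsub>Q\<^esub>" using s memE by simp
          then have "p1 s \<in> L" using Q(4) q.mem_kernel sS by auto
          then show "s \<in> i ` L" using ip[OF sS s(2)] by blast
        qed
      qed
      moreover have "p2 ` E = carrier M'"
      proof
        show "p2 ` E \<subseteq> carrier M'" using ES by auto
        show "carrier M' \<subseteq> p2 ` E"
        proof
          fix v assume v: "v \<in> carrier M'"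
          then have "\<phi> v \<in> q ` carrier M" using Q(3) by simp
          then obtain u where u: "u \<in> carrier M" "\<phi> v = q u" by blast
          obtain s where "s \<in> carrier S" "p1 s = u" "p2 s = v" using pair[OF u(1) v] by blast
          then show "v \<in> p2 ` E" using u memE by force
        qed
      qed
      ultimately have "short_exact G R (gsub M L) i (gsub S E) p2 M'"
        using p2.restrict_domain[OF ES] by (simp add: short_exact_def)
      then show ?thesis using ext L(3) M' gE unfolding closed_extensions_def by blast
    qed
    have "gsub M (p1 ` E) \<in> \<C>"
      using im EM M p1.restrict_domain[OF ES] unfolding closed_images_def gIm_def by fastforce
    moreover have "hsub G R M (p1 ` E)" by (rule p1.hsub_image[OF E])
    \<comment> \<open>A first coordinate u has q u in Ry, hence in q(N); so u differs from an
      element of N by an element of L, which is contained in N.\<close>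
    moreover have "p1 ` E \<subseteq> N"
    proof
      fix u assume "u \<in> p1 ` E"
      then obtain s where s: "s \<in> E" "u = p1 s" by blast
      then have sS: "s \<in> carrier S" and eq: "q u = \<phi> (p2 s)" using memE by auto
      have uM: "u \<in> carrier M" using s(2) sS by simp
      have "p2 s \<in> carrier M" using sS p2.f_closed cM' by simp
      then have "q u \<in> q ` N"
        using im_\<phi> eq q.N.cyclic_subset[OF W y(3)] by auto
      then obtain n where n: "n \<in> N" "q u = q n" by blast
      have nM: "n \<in> carrier M" using M.hsubD(3)[OF N n(1)] .
      have "u \<oplus>\<^bsub>M\<^esub> \<ominus>\<^bsub>M\<^esub> n \<in> N" using q.f_eq_iff[OF uM nM] n(2) Q(4) L(2) by auto
      then show "u \<in> N" using M.hsub_diff[OF N uM M.hsubD(6)[OF N n(1)]] by simp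
    qed
    moreover have "L \<subseteq> p1 ` E"
      using iL pi(1) M.hsubD(1)[OF L(1)] by (metis image_eqI subset_iff)
    ultimately have eq: "p1 ` E = L" by (intro max)
    \<comment> \<open>A lift of x to the pullback has its first coordinate m in L. This gives \<phi>
      x = q m = 0, contrary to the choice of x.\<close>
    have "\<phi> x \<in> q ` carrier M" using x(1) Q(3) cM' \<phi>.f_closed by simp
    then obtain m where m: "m \<in> carrier M" "\<phi> x = q m" by blast
    obtain s where s: "s \<in> carrier S" "p1 s = m" "p2 s = x" using pair[OF m(1)] x(1) cM' by auto
    then have "s \<in> E" using memE m by simp
    then have "m \<in> L" using eq s(2) by blast
    then show False using Q(4) q.mem_kernel m x(2) by auto
  qed
  then show ?thesis using L by simp
qed

section \<open>Closure under cokernels and extensions: membership is detected by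
  annihilators\<close>

text \<open>Among the members of the subcategory with a nonzero map to N, one with maximal
  annihilator A is taken. For homogeneous b in I the map kills bM, so it factors through M/bM, whose
  annihilator contains A and b. Maximality puts b into A.\<close>

lemma hom_killed_by_prime:
  assumes cok: "closed_cokernels G R \<C>"
    and M0: "M0 \<in> \<C>" "ann R M0 (carrier M0) \<subseteq> ann R N {y}"
    and N: "N \<in> gmod G R" and e: "e \<in> carrier G" and y: "y \<in> mgrade N e" "carrier N = cyclic R N y"
    and prime: "hprime (ann R N {y})"
  shows "\<exists>M\<in>\<C>. ann R N {y} \<subseteq> ann R M (carrier M) \<and>
    (\<exists>\<phi>\<in>ghom G R M N. \<exists>x\<in>carrier M. \<phi> x \<noteq> \<zero>\<^bsub>N\<^esub>)"
proof -
  interpret N: graded_module G R N by (rule gmodD(1)[OF N])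
  have yN: "y \<in> carrier N" by (rule N.H.D_closed[OF e y(1)])
  let ?I = "ann R N {y}"
  \<comment> \<open>By commutativity, Ann y annihilates the whole cyclic module N.\<close>
  have killN: "b \<odot>\<^bsub>N\<^esub> n = \<zero>\<^bsub>N\<^esub>" if "b \<in> ?I" "n \<in> carrier N" for b n
  proof -
    obtain c where c: "c \<in> carrier R" "n = c \<odot>\<^bsub>N\<^esub> y" using \<open>n \<in> carrier N\<close> unfolding y(2) by (rule cyclicE)
    have "b \<odot>\<^bsub>N\<^esub> (c \<odot>\<^bsub>N\<^esub> y) = c \<odot>\<^bsub>N\<^esub> (b \<odot>\<^bsub>N\<^esub> y)"
      using that(1) c yN by (intro N.M.smult_swap) (auto simp: ann_def)
    then show ?thesis using that(1) c by (simp add: ann_def)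
  qed
  define \<F> where "\<F> = {ann R M (carrier M) | M. M \<in> \<C> \<and>
    (\<exists>\<phi>\<in>ghom G R M N. \<exists>x\<in>carrier M. \<phi> x \<noteq> \<zero>\<^bsub>N\<^esub>)}"
  obtain g \<phi>0 x0 where g: "g \<in> carrier G" "\<phi>0 \<in> ghom G R (gshift G M0 g) N" "x0 \<in> carrier M0" "\<phi>0 x0 \<noteq> \<zero>\<^bsub>N\<^esub>"
    using nonzero_hom_from_shift[OF in_gmod[OF M0(1)] gmodD(1)[OF N] e y(1) prime M0(2)] by blast
  have "ann R (gshift G M0 g) (carrier (gshift G M0 g)) \<in> \<F>"
    unfolding \<F>_def mem_Collect_eq
    by (rule exI[of _ "gshift G M0 g"]) (use shift_mem[OF M0(1) g(1)] g in auto)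
  moreover have "\<F> \<subseteq> {I. hideal G R I}"
    using graded_module.hideal_ann_carrier in_graded_module by (auto simp: \<F>_def)
  ultimately have "\<exists>S\<in>\<F>. \<forall>T\<in>\<F>. S \<subseteq> T \<longrightarrow> T = S"
    by (intro acc_maximal[OF acc_hideals[OF noeth]]) auto
  then obtain A where A: "A \<in> \<F>" "\<And>T. T \<in> \<F> \<Longrightarrow> A \<subseteq> T \<Longrightarrow> T = A" by auto
  obtain M \<phi> x where M: "A = ann R M (carrier M)" "M \<in> \<C>" and \<phi>: "\<phi> \<in> ghom G R M N"
    and x: "x \<in> carrier M" "\<phi> x \<noteq> \<zero>\<^bsub>N\<^esub>" using A(1) unfolding \<F>_def by blast
  interpret \<phi>: graded_hom G R M N \<phi> by (intro graded_homI in_graded_module M N.graded_module_axioms \<phi>)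
  have homog: "b \<in> A" if d: "d \<in> carrier G" and b: "b \<in> rgrade R d" "b \<in> ?I" for b d
  proof -
    have bR: "b \<in> carrier R" using RG.D_closed d b by blast
    \<comment> \<open>The shift makes multiplication by b a degree-preserving map into M. Only
      homogeneous b can be treated in this way; general elements of I follow by components.\<close>
    have M': "gshift G M (inv\<^bsub>G\<^esub> d) \<in> \<C>" using shift_mem[OF M(2)] d by simp
    have bM: "(\<lambda>m. b \<odot>\<^bsub>M\<^esub> m) \<in> ghom G R (gshift G M (inv\<^bsub>G\<^esub> d)) M"
    proof (rule ghomI)
      fix k m assume k: "k \<in> carrier G" "m \<in> mgrade (gshift G M (inv\<^bsub>G\<^esub> d)) k"
      then have "b \<odot>\<^bsub>M\<^esub> m \<in> mgrade M (d \<otimes>\<^bsub>G\<^esub> (k \<otimes>\<^bsub>G\<^esub> inv\<^bsub>G\<^esub> d))"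
        using d by (intro \<phi>.M.mgrade_smult b) auto
      moreover have "d \<otimes>\<^bsub>G\<^esub> (k \<otimes>\<^bsub>G\<^esub> inv\<^bsub>G\<^esub> d) = k"
        using k(1) d by (simp add: G.m_comm[of k] G.m_assoc[symmetric])
      ultimately show "b \<odot>\<^bsub>M\<^esub> m \<in> mgrade M k" by simp
    qed (use bR in \<open>auto simp: \<phi>.M.M.smult_r_distr intro: \<phi>.M.M.smult_swap\<close>)
    obtain Q p where Q: "Q \<in> \<C>" "p \<in> ghom G R M Q" "p ` carrier M = carrier Q"
      "a_kernel M Q p = (\<lambda>m. b \<odot>\<^bsub>M\<^esub> m) ` carrier M"
      using cokernel_mem[OF cok M' M(2) bM] by auto
    interpret p: graded_hom G R M Q p by (intro graded_homI in_graded_module M Q)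
    have "a_kernel M Q p \<subseteq> a_kernel M N \<phi>"
      unfolding Q(4) using bR killN[OF b(2)] by (auto simp: \<phi>.mem_kernel \<phi>.f_smult)
    then obtain \<phi>' where \<phi>': "\<phi>' \<in> ghom G R Q N" "\<And>m. m \<in> carrier M \<Longrightarrow> \<phi>' (p m) = \<phi> m"
      using factor_through_surjection[OF in_graded_module[OF M(2)] gmodD(1)[OF N] in_graded_module[OF Q(1)] Q(2,3) \<phi>]
      by blast
    have "\<phi>' (p x) \<noteq> \<zero>\<^bsub>N\<^esub>" using \<phi>'(2) x by simp
    then have "ann R Q (carrier Q) \<in> \<F>" unfolding \<F>_def using Q(1) \<phi>'(1) p.f_closed[OF x(1)] by blast
    moreover have "A \<subseteq> ann R Q (carrier Q)"
      unfolding M(1) Q(3)[symmetric] by (auto simp: ann_def p.f_smult[symmetric])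
    ultimately have eq: "ann R Q (carrier Q) = A" by (rule A(2))
    have "b \<odot>\<^bsub>Q\<^esub> p m = \<zero>\<^bsub>Q\<^esub>" if "m \<in> carrier M" for m
    proof -
      have "b \<odot>\<^bsub>M\<^esub> m \<in> a_kernel M Q p" unfolding Q(4) using that by blast
      then show ?thesis using p.mem_kernel p.f_smult[OF bR that] by simp
    qed
    then have "b \<in> ann R Q (carrier Q)" unfolding Q(3)[symmetric] ann_def using bR by auto
    then show "b \<in> A" unfolding eq .
  qed
  have hA: "hideal G R A" unfolding M(1) by (rule \<phi>.M.hideal_ann_carrier)
  have hI: "hideal G R ?I" using prime by (simp add: hprime_def)
  interpret A: ideal A R using hA by (simp add: hideal_def)
  have "?I \<subseteq> A"
  proof
    fix b assume b: "b \<in> ?I"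
    then have bR: "b \<in> carrier R" by (simp add: ann_def)
    show "b \<in> A" using bR
    proof (rule RG.sum_of_comps)
      show "RG.component b g \<in> A" if "g \<in> carrier G" for g
        using homog[OF that RG.comp_mem[OF bR that]] hI b that by (auto simp: hideal_def)
    qed (auto intro: A.a_closed)
  qed
  then show ?thesis using M \<phi> x by blast
qed

text \<open>The hypothesis \<open>larger\<close> is the induction hypothesis of a noetherian
  induction on annihilators. It is applied to the kernel K of Q -> N and to the cokernel of this
  map; in between, Q/K is a cokernel, and N is an extension with submodule Q/K.\<close>

lemma prime_cyclic_mem:
  assumes cok: "closed_cokernels G R \<C>" and ext: "closed_extensions G R \<C>"
    and M0: "M0 \<in> \<C>" "ann R M0 (carrier M0) \<subseteq> ann R N {y}"
    and N: "N \<in> gmod G R" and e: "e \<in> carrier G" and y: "y \<in> mgrade N e" "carrier N = cyclic R N y"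
    and prime: "hprime (ann R N {y})"
    and larger: "\<And>N'. N' \<in> gmod G R \<Longrightarrow> ann R N {y} \<subset> ann R N' (carrier N') \<Longrightarrow> N' \<in> \<C>"
  shows "N \<in> \<C>"
proof -
  interpret N: graded_module G R N by (rule gmodD(1)[OF N])
  have yN: "y \<in> carrier N" by (rule N.H.D_closed[OF e y(1)])
  let ?I = "ann R N {y}"
  obtain M \<phi> where M: "M \<in> \<C>" and IM: "?I \<subseteq> ann R M (carrier M)" and \<phi>: "\<phi> \<in> ghom G R M N"
    and nz: "\<exists>x\<in>carrier M. \<phi> x \<noteq> \<zero>\<^bsub>N\<^esub>"
    using hom_killed_by_prime[OF cok M0 N e y prime] by blast
  interpret \<phi>: graded_hom G R M N \<phi> by (intro graded_homI in_graded_module M N.graded_module_axioms \<phi>)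
  have "\<exists>h\<in>carrier G. \<exists>x\<in>mgrade M h. \<phi> x \<noteq> \<zero>\<^bsub>N\<^esub>"
  proof (rule ccontr)
    assume *: "\<not> ?thesis"
    have "\<phi> x = \<zero>\<^bsub>N\<^esub>" if "x \<in> carrier M" for x
      using that by (induction x rule: \<phi>.M.H.homogeneous_induct) (use * in \<open>auto simp: \<phi>.f_add\<close>)
    then show False using nz by blast
  qed
  then obtain h x where h: "h \<in> carrier G" and x: "x \<in> mgrade M h" "\<phi> x \<noteq> \<zero>\<^bsub>N\<^esub>" by blast
  have xM: "x \<in> carrier M" by (rule \<phi>.M.H.D_closed[OF h x(1)])
  define d where "d = h \<otimes>\<^bsub>G\<^esub> inv\<^bsub>G\<^esub> e"
  have d: "d \<in> carrier G" using h e by (simp add: d_def)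
  obtain r where r: "r \<in> carrier R" "\<phi> x = r \<odot>\<^bsub>N\<^esub> y"
    using \<phi>.f_closed[OF xM] unfolding y(2) by (rule cyclicE)
  \<comment> \<open>Passing to the component of degree d = h e^-1 loses nothing, as \<phi> x and y
    are homogeneous of degrees h and e. It makes multiplication by a a morphism up to shift.\<close>
  define a where "a = RG.component r d"
  have a: "a \<in> rgrade R d" "a \<in> carrier R" using RG.comp_mem[OF r(1) d] RG.comp_closed[OF r(1) d] by (simp_all add: a_def)
  have ay: "\<phi> x = a \<odot>\<^bsub>N\<^esub> y"
  proof -
    have "\<phi> x = N.H.component (\<phi> x) h" using N.H.comp_homogeneous[OF h \<phi>.f_degree[OF h x(1)] h] by simp
    then show ?thesis using N.comp_smult_right'[OF e y(1) r(1) h] r(2) by (simp add: a_def d_def)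
  qed
  have aI: "a \<notin> ?I" using ay x(2) by (simp add: ann_def)
  \<comment> \<open>The homomorphism from N to M with y sent to x, of degree d. It is well defined
    because two coefficients of the same element differ by an element of I, and I annihilates
    M.\<close>
  define \<sigma> where "\<sigma> n = (SOME c. c \<in> carrier R \<and> n = c \<odot>\<^bsub>N\<^esub> y) \<odot>\<^bsub>M\<^esub> x" for n
  have \<sigma>: "\<sigma> (c \<odot>\<^bsub>N\<^esub> y) = c \<odot>\<^bsub>M\<^esub> x" if c: "c \<in> carrier R" for c
  proof -
    let ?c = "SOME c'. c' \<in> carrier R \<and> c \<odot>\<^bsub>N\<^esub> y = c' \<odot>\<^bsub>N\<^esub> y"
    have c': "?c \<in> carrier R \<and> c \<odot>\<^bsub>N\<^esub> y = ?c \<odot>\<^bsub>N\<^esub> y" by (rule someI[of _ c]) (use c in simp)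
    define b where "b = ?c"
    have b: "b \<in> carrier R" "c \<odot>\<^bsub>N\<^esub> y = b \<odot>\<^bsub>N\<^esub> y" using c' by (simp_all add: b_def)
    have "(b \<oplus>\<^bsub>R\<^esub> \<ominus>\<^bsub>R\<^esub> c) \<odot>\<^bsub>N\<^esub> y = \<zero>\<^bsub>N\<^esub>"
      using b c yN by (simp add: N.M.smult_l_distr N.M.smult_l_minus N.M.r_neg)
    then have "b \<oplus>\<^bsub>R\<^esub> \<ominus>\<^bsub>R\<^esub> c \<in> ?I" using b c by (simp add: ann_def)
    then have "b \<oplus>\<^bsub>R\<^esub> \<ominus>\<^bsub>R\<^esub> c \<in> ann R M (carrier M)" using IM by blast
    then have "b \<odot>\<^bsub>M\<^esub> x \<oplus>\<^bsub>M\<^esub> \<ominus>\<^bsub>M\<^esub> (c \<odot>\<^bsub>M\<^esub> x) = \<zero>\<^bsub>M\<^esub>"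
      using b c xM by (simp add: ann_def \<phi>.M.M.smult_l_distr \<phi>.M.M.smult_l_minus)
    then have "b \<odot>\<^bsub>M\<^esub> x = c \<odot>\<^bsub>M\<^esub> x"
      using \<phi>.M.M.minus_equality[of "b \<odot>\<^bsub>M\<^esub> x" "\<ominus>\<^bsub>M\<^esub> (c \<odot>\<^bsub>M\<^esub> x)"] b c xM by simp
    then show ?thesis by (simp add: \<sigma>_def b_def)
  qed
  have repr: "\<exists>c\<in>carrier R. n = c \<odot>\<^bsub>N\<^esub> y" if "n \<in> carrier N" for n
    using that unfolding y(2) by (meson cyclicE)
  have \<sigma>hom: "\<sigma> \<in> ghom G R N (gshift G M d)"
  proof (rule ghomI)
    show "\<sigma> n \<in> carrier (gshift G M d)" if "n \<in> carrier N" for n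
      using repr[OF that] \<sigma> xM by auto
    show "\<sigma> (m \<oplus>\<^bsub>N\<^esub> n) = \<sigma> m \<oplus>\<^bsub>gshift G M d\<^esub> \<sigma> n" if mn: "m \<in> carrier N" "n \<in> carrier N" for m n
    proof -
      obtain b c where bc: "b \<in> carrier R" "m = b \<odot>\<^bsub>N\<^esub> y" "c \<in> carrier R" "n = c \<odot>\<^bsub>N\<^esub> y"
        using repr[OF mn(1)] repr[OF mn(2)] by blast
      then have "m \<oplus>\<^bsub>N\<^esub> n = (b \<oplus>\<^bsub>R\<^esub> c) \<odot>\<^bsub>N\<^esub> y" using yN by (simp add: N.M.smult_l_distr)
      then show ?thesis using bc xM \<sigma>[of "b \<oplus>\<^bsub>R\<^esub> c"] \<sigma>[OF bc(1)] \<sigma>[OF bc(3)]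
        by (simp add: \<phi>.M.M.smult_l_distr)
    qed
    show "\<sigma> (b \<odot>\<^bsub>N\<^esub> n) = b \<odot>\<^bsub>gshift G M d\<^esub> \<sigma> n" if bn: "b \<in> carrier R" "n \<in> carrier N" for b n
    proof -
      obtain c where c: "c \<in> carrier R" "n = c \<odot>\<^bsub>N\<^esub> y" using repr[OF bn(2)] by blast
      then have "b \<odot>\<^bsub>N\<^esub> n = (b \<otimes>\<^bsub>R\<^esub> c) \<odot>\<^bsub>N\<^esub> y" using yN bn(1) by (simp add: N.M.smult_assoc1)
      then show ?thesis using c xM bn(1) \<sigma>[of "b \<otimes>\<^bsub>R\<^esub> c"] \<sigma>[OF c(1)]
        by (simp add: \<phi>.M.M.smult_assoc1)
    qed
    show "\<sigma> n \<in> mgrade (gshift G M d) k" if k: "k \<in> carrier G" "n \<in> mgrade N k" for k n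
    proof -
      obtain c where c: "c \<in> carrier R" "n = c \<odot>\<^bsub>N\<^esub> y" using repr[OF N.H.D_closed[OF k]] by blast
      define l where "l = k \<otimes>\<^bsub>G\<^esub> inv\<^bsub>G\<^esub> e"
      have l: "l \<in> carrier G" "l \<otimes>\<^bsub>G\<^esub> h = k \<otimes>\<^bsub>G\<^esub> d" using k e h by (simp_all add: l_def d_def G.m_ac)
      have "n = RG.component c l \<odot>\<^bsub>N\<^esub> y"
        using N.H.comp_homogeneous[OF k k(1)] N.comp_smult_right'[OF e y(1) c(1) k(1)] c(2) by (simp add: l_def)
      then have "\<sigma> n = RG.component c l \<odot>\<^bsub>M\<^esub> x" using \<sigma>[OF RG.comp_closed[OF c(1) l(1)]] by simp
      also have "\<dots> \<in> mgrade M (l \<otimes>\<^bsub>G\<^esub> h)"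
        by (rule \<phi>.M.mgrade_smult[OF l(1) h RG.comp_mem[OF c(1) l(1)] x(1)])
      finally show ?thesis unfolding l(2) by simp
    qed
  qed
  have gs: "graded_module G R (gshift G M d)" by (rule \<phi>.M.graded_module_gshift[OF d])
  interpret \<sigma>: graded_hom G R N "gshift G M d" \<sigma> by (intro graded_homI N.graded_module_axioms gs \<sigma>hom)
  have \<phi>\<sigma>: "\<phi> (\<sigma> n) = a \<odot>\<^bsub>N\<^esub> n" if n: "n \<in> carrier N" for n
  proof -
    obtain c where c: "c \<in> carrier R" "n = c \<odot>\<^bsub>N\<^esub> y" using repr[OF n] by blast
    then show ?thesis using \<sigma> \<phi>.f_smult[OF c(1) xM] ay N.M.smult_swap[OF c(1) a(2) yN] by simp
  qed
  have \<sigma>cl: "\<sigma> n \<in> carrier M" if "n \<in> carrier N" for n using \<sigma>.f_closed[OF that] by simp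
  define M' where "M' = gshift G M (inv\<^bsub>G\<^esub> d)"
  have M': "M' \<in> \<C>" unfolding M'_def by (rule shift_mem[OF M]) (use d in simp)
  \<comment> \<open>On N the composite \<phi> \<sigma> is multiplication by a, hence \<phi> \<psi> =
    a \<phi> - a \<phi> = 0. This is what lets \<phi> factor through the cokernel of \<psi>.\<close>
  define \<psi> where "\<psi> m = a \<odot>\<^bsub>M\<^esub> m \<oplus>\<^bsub>M\<^esub> \<ominus>\<^bsub>M\<^esub> \<sigma> (\<phi> m)" for m
  have \<sigma>add: "\<sigma> (m \<oplus>\<^bsub>N\<^esub> n) = \<sigma> m \<oplus>\<^bsub>M\<^esub> \<sigma> n" if "m \<in> carrier N" "n \<in> carrier N" for m n
    using \<sigma>.f_add[OF that] by simp
  have \<sigma>sm: "\<sigma> (b \<odot>\<^bsub>N\<^esub> n) = b \<odot>\<^bsub>M\<^esub> \<sigma> n" if "b \<in> carrier R" "n \<in> carrier N" for b n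
    using \<sigma>.f_smult[OF that] by simp
  have \<psi>: "\<psi> \<in> ghom G R M' M"
  proof (rule ghomI)
    show "\<psi> m \<in> carrier M" if "m \<in> carrier M'" for m using that a \<sigma>cl by (simp add: \<psi>_def M'_def)
    show "\<psi> (m \<oplus>\<^bsub>M'\<^esub> n) = \<psi> m \<oplus>\<^bsub>M\<^esub> \<psi> n" if "m \<in> carrier M'" "n \<in> carrier M'" for m n
      using that a \<sigma>cl by (simp add: \<psi>_def M'_def \<phi>.f_add \<sigma>add \<phi>.M.M.smult_r_distr \<phi>.M.M.minus_add \<phi>.M.M.a_ac)
    show "\<psi> (b \<odot>\<^bsub>M'\<^esub> m) = b \<odot>\<^bsub>M\<^esub> \<psi> m" if "b \<in> carrier R" "m \<in> carrier M'" for b m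
      using that a \<sigma>cl \<phi>.M.M.smult_swap[of a b m]
      by (simp add: \<psi>_def M'_def \<phi>.f_smult \<sigma>sm \<phi>.M.M.smult_r_distr \<phi>.M.M.smult_r_minus)
    show "\<psi> m \<in> mgrade M k" if k: "k \<in> carrier G" "m \<in> mgrade M' k" for k m
    proof -
      define l where "l = k \<otimes>\<^bsub>G\<^esub> inv\<^bsub>G\<^esub> d"
      have l: "l \<in> carrier G" "d \<otimes>\<^bsub>G\<^esub> l = k" "l \<otimes>\<^bsub>G\<^esub> d = k"
      proof -
        show "l \<in> carrier G" "l \<otimes>\<^bsub>G\<^esub> d = k" using k(1) d by (simp_all add: l_def G.m_assoc)
        then show "d \<otimes>\<^bsub>G\<^esub> l = k" using d G.m_comm[of d l] by simp
      qed
      have m: "m \<in> mgrade M l" using k(2) by (simp add: M'_def l_def)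
      have "a \<odot>\<^bsub>M\<^esub> m \<in> mgrade M k" using \<phi>.M.mgrade_smult[OF d l(1) a(1) m] l(2) by simp
      moreover have "\<sigma> (\<phi> m) \<in> mgrade M k"
        using \<sigma>.f_degree[OF l(1) \<phi>.f_degree[OF l(1) m]] l(3) by simp
      ultimately show ?thesis unfolding \<psi>_def by (intro \<phi>.M.H.D_add \<phi>.M.H.D_minus k(1))
    qed
  qed
  obtain Q p where Q: "Q \<in> \<C>" and p: "p \<in> ghom G R M Q" "p ` carrier M = carrier Q" "a_kernel M Q p = \<psi> ` carrier M"
    using cokernel_mem[OF cok M' M \<psi>] by (auto simp: M'_def)
  interpret p: graded_hom G R M Q p by (intro graded_homI in_graded_module M Q p)
  have "\<phi> (\<psi> m) = \<zero>\<^bsub>N\<^esub>" if m: "m \<in> carrier M" for m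
    using m a \<sigma>cl[OF \<phi>.f_closed[OF m]]
    by (simp add: \<psi>_def \<phi>.f_add \<phi>.f_minus \<phi>.f_smult \<phi>\<sigma> N.M.r_neg)
  then have "a_kernel M Q p \<subseteq> a_kernel M N \<phi>"
    using p.mem_kernel \<phi>.mem_kernel unfolding p(3) by (metis (no_types, lifting) imageE p(3) subsetI)
  then obtain \<phi>' where \<phi>': "\<phi>' \<in> ghom G R Q N" "\<And>m. m \<in> carrier M \<Longrightarrow> \<phi>' (p m) = \<phi> m"
    using factor_through_surjection[OF in_graded_module[OF M] gmodD(1)[OF N] in_graded_module[OF Q] p(1,2) \<phi>] by blast
  interpret \<phi>': graded_hom G R Q N \<phi>' by (intro graded_homI in_graded_module Q N.graded_module_axioms \<phi>')
  let ?K = "a_kernel Q N \<phi>'"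
  have K: "hsub G R Q ?K" by (rule \<phi>'.hsub_kernel)
  have killQ: "b \<odot>\<^bsub>Q\<^esub> z = \<zero>\<^bsub>Q\<^esub>" if b: "b \<in> ?I" and z: "z \<in> carrier Q" for b z
  proof -
    obtain m where m: "m \<in> carrier M" "z = p m" using z p(2) by blast
    have "b \<in> carrier R" "b \<odot>\<^bsub>M\<^esub> m = \<zero>\<^bsub>M\<^esub>" using b IM m by (auto simp: ann_def)
    then show ?thesis using p.f_smult[of b m] m by simp
  qed
  have "a \<odot>\<^bsub>Q\<^esub> z = \<zero>\<^bsub>Q\<^esub>" if z: "z \<in> ?K" for z
  proof -
    \<comment> \<open>On the kernel of \<phi> the correction term vanishes, so \<psi> m = a m there;
      its class in Q is zero, which says that a kills K.\<close>
    have zQ: "z \<in> carrier Q" "\<phi>' z = \<zero>\<^bsub>N\<^esub>" using z \<phi>'.mem_kernel by auto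
    obtain m where m: "m \<in> carrier M" "z = p m" using zQ(1) p(2) by blast
    have "\<phi> m = \<zero>\<^bsub>N\<^esub>" using \<phi>'(2) m zQ by simp
    moreover have "\<sigma> \<zero>\<^bsub>N\<^esub> = \<zero>\<^bsub>M\<^esub>" "\<ominus>\<^bsub>M\<^esub> \<zero>\<^bsub>M\<^esub> = \<zero>\<^bsub>M\<^esub>"
      using \<sigma>.f_zero \<phi>.M.M.minus_equality[of "\<zero>\<^bsub>M\<^esub>" "\<zero>\<^bsub>M\<^esub>"] by simp_all
    ultimately have "\<psi> m = a \<odot>\<^bsub>M\<^esub> m" using a m(1) by (simp add: \<psi>_def)
    then have "a \<odot>\<^bsub>M\<^esub> m \<in> a_kernel M Q p" unfolding p(3) using m by (metis imageI)
    then show ?thesis using p.mem_kernel p.f_smult[OF a(2) m(1)] m(2) by simp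
  qed
  then have "a \<in> ann R (gsub Q ?K) (carrier (gsub Q ?K))" using a by (simp add: ann_def)
  moreover have "?I \<subseteq> ann R (gsub Q ?K) (carrier (gsub Q ?K))"
    using killQ \<phi>'.mem_kernel by (auto simp: ann_def)
  ultimately have KC: "gsub Q ?K \<in> \<C>"
    using larger[OF gsub_gmod[OF in_gmod[OF Q] K]] aI by blast
  \<comment> \<open>Closure under images is not at hand. The quotient of Q by K, a cokernel of a map
    between members, stands in for the image of \<open>\<phi>'\<close>.\<close>
  obtain Q2 p2 where Q2: "Q2 \<in> \<C>" and p2: "p2 \<in> ghom G R Q Q2" "p2 ` carrier Q = carrier Q2" "a_kernel Q Q2 p2 = ?K"
    using cokernel_mem[OF cok KC Q p.N.inclusion_gsub[OF p.N.hsubD(1)[OF K]]] by auto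
  interpret p2: graded_hom G R Q Q2 p2 by (intro graded_homI in_graded_module Q Q2 p2)
  obtain i where i: "i \<in> ghom G R Q2 N" "\<And>z. z \<in> carrier Q \<Longrightarrow> i (p2 z) = \<phi>' z"
    using factor_through_surjection[OF in_graded_module[OF Q] gmodD(1)[OF N] in_graded_module[OF Q2] p2(1,2) \<phi>'(1)]
      p2(3) by blast
  interpret i: graded_hom G R Q2 N i by (intro graded_homI in_graded_module Q2 N.graded_module_axioms i)
  have "u = \<zero>\<^bsub>Q2\<^esub>" if u: "u \<in> carrier Q2" "i u = \<zero>\<^bsub>N\<^esub>" for u
  proof -
    obtain z where z: "z \<in> carrier Q" "u = p2 z" using u(1) p2(2) by blast
    then have "z \<in> ?K" using i(2) u(2) \<phi>'.mem_kernel by simp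
    then show ?thesis using p2(3) p2.mem_kernel z(2) by blast
  qed
  then have inj: "inj_on i (carrier Q2)" unfolding i.inj_on_iff_kernel by (auto simp: i.mem_kernel)
  let ?W = "i ` carrier Q2"
  have W: "hsub G R N ?W" by (rule i.hsub_image[OF p2.N.hsub_carrier])
  have \<phi>W: "\<phi> m \<in> ?W" if "m \<in> carrier M" for m
    using i(2)[of "p m"] \<phi>'(2)[OF that] that by (metis p.f_closed p2.f_closed image_eqI)
  \<comment> \<open>The quotient of N by the image is killed by I and also by a, because a y =
    \<phi> x lies in the image; its annihilator is thus strictly larger than I.\<close>
  obtain Q3 :: "('g, 'r, 'm) graded_module" and p3 where Q3: "Q3 \<in> gmod G R" and p3: "p3 \<in> ghom G R N Q3"
    "p3 ` carrier N = carrier Q3" "a_kernel N Q3 p3 = ?W"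
    using quotient_gmod_exists[OF N W] by blast
  interpret p3: graded_hom G R N Q3 p3 by (intro graded_homI N.graded_module_axioms gmodD(1)[OF Q3] p3)
  have "b \<odot>\<^bsub>Q3\<^esub> p3 n = \<zero>\<^bsub>Q3\<^esub>" if b: "b \<in> insert a ?I" and n: "n \<in> carrier N" for b n
  proof -
    obtain c where c: "c \<in> carrier R" "n = c \<odot>\<^bsub>N\<^esub> y" using repr[OF n] by blast
    have bR: "b \<in> carrier R" using b a by (auto simp: ann_def)
    have "b \<odot>\<^bsub>N\<^esub> n = c \<odot>\<^bsub>N\<^esub> (b \<odot>\<^bsub>N\<^esub> y)" using c N.M.smult_swap[OF bR c(1) yN] by simp
    moreover have "b \<odot>\<^bsub>N\<^esub> y \<in> ?W"
    proof (cases "b = a")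
      case True
      then show ?thesis using \<phi>W[OF xM] ay by simp
    next
      case False
      then have "b \<odot>\<^bsub>N\<^esub> y = \<zero>\<^bsub>N\<^esub>" using b by (simp add: ann_def)
      then show ?thesis using N.hsubD(2)[OF W] by simp
    qed
    ultimately have "b \<odot>\<^bsub>N\<^esub> n \<in> a_kernel N Q3 p3" using N.hsubD(5)[OF W c(1)] p3(3) by simp
    then show ?thesis using p3.mem_kernel p3.f_smult[OF bR n] by simp
  qed
  then have "insert a ?I \<subseteq> ann R Q3 (carrier Q3)"
    unfolding p3(2)[symmetric] using a by (auto simp: ann_def)
  then have "Q3 \<in> \<C>" using larger[OF Q3] aI by blast
  moreover have "short_exact G R Q2 i N p3 Q3"
    unfolding short_exact_def using i(1) p3 inj by simp
  ultimately show ?thesis using ext Q2 N unfolding closed_extensions_def by blast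
qed

text \<open>Phrasing membership through annihilators alone lets the induction run over homogeneous
  ideals of R. The modules compared need not be related by any homomorphism.\<close>

lemma mem_if_CE_closed:
  assumes add: "additive_subcategory G R \<C>" and cok: "closed_cokernels G R \<C>" and ext: "closed_extensions G R \<C>"
    and M0: "M0 \<in> \<C>" and N0: "N0 \<in> gmod G R" and le: "ann R M0 (carrier M0) \<subseteq> ann R N0 (carrier N0)"
  shows "N0 \<in> \<C>"
proof (rule ccontr)
  assume bad: "N0 \<notin> \<C>"
  define \<F> where "\<F> = {ann R N (carrier N) | N :: ('g, 'r, 'm) graded_module.
    N \<in> gmod G R \<and> N \<notin> \<C> \<and> ann R M0 (carrier M0) \<subseteq> ann R N (carrier N)}"
  have "ann R N0 (carrier N0) \<in> \<F>" unfolding \<F>_def using bad N0 le by blast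
  moreover have "\<F> \<subseteq> {I. hideal G R I}"
    using graded_module.hideal_ann_carrier gmodD(1) by (auto simp: \<F>_def)
  ultimately have "\<exists>S\<in>\<F>. \<forall>T\<in>\<F>. S \<subseteq> T \<longrightarrow> T = S"
    by (intro acc_maximal[OF acc_hideals[OF noeth]]) auto
  then obtain A where A: "A \<in> \<F>" "\<And>T. T \<in> \<F> \<Longrightarrow> A \<subseteq> T \<Longrightarrow> T = A" by auto
  obtain N :: "('g, 'r, 'm) graded_module" where N: "A = ann R N (carrier N)" "N \<in> gmod G R" "N \<notin> \<C>"
    "ann R M0 (carrier M0) \<subseteq> A" using A(1) unfolding \<F>_def by blast
  have larger: "N' \<in> \<C>" if N': "N' \<in> gmod G R" "A \<subset> ann R N' (carrier N')" for N'
  proof (rule ccontr)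
    assume "N' \<notin> \<C>"
    then have "ann R N' (carrier N') \<in> \<F>" unfolding \<F>_def using N' N(4) by blast
    then show False using A(2)[of "ann R N' (carrier N')"] N'(2) by blast
  qed
  interpret N: graded_module G R N by (rule gmodD(1)[OF N(2)])
  \<comment> \<open>The reduction to a cyclic module: once some nonzero Ry inside N/T is shown to be
    in the subcategory, its preimage in N is an extension of Ry by T and contradicts the maximality
    of T.\<close>
  obtain T where T: "hsub G R N T" "gsub N T \<in> \<C>"
    and maxT: "\<forall>U. hsub G R N U \<and> U \<subseteq> carrier N \<and> gsub N U \<in> \<C> \<and> T \<subseteq> U \<longrightarrow> U = T"
    using maximal_submodule_mem[OF add N(2) N.hsub_carrier] by auto
  have max: "U = T" if "hsub G R N U" "gsub N U \<in> \<C>" "T \<subseteq> U" for U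
    using maxT that N.hsubD(1)[OF that(1)] by simp
  have "T \<noteq> carrier N"
  proof
    assume "T = carrier N"
    then have "(\<lambda>x. x) \<in> ghom G R (gsub N T) N" "bij_betw (\<lambda>x. x) (carrier (gsub N T)) (carrier N)"
      using N.inclusion_gsub by (simp_all add: bij_betw_def)
    then show False using iso_closed[OF T(2) N(2)] N(3) by blast
  qed
  then obtain z0 where z0: "z0 \<in> carrier N" "z0 \<notin> T" using N.hsubD(1)[OF T(1)] by blast
  obtain g z where z: "g \<in> carrier G" "z \<in> mgrade N g" "z \<notin> T"
    using N.hsub_homogeneous_notin[OF T(1) z0] .
  obtain Q :: "('g, 'r, 'm) graded_module" and p where Q: "Q \<in> gmod G R" and p: "p \<in> ghom G R N Q"
    "p ` carrier N = carrier Q" "a_kernel N Q p = T"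
    using quotient_gmod_exists[OF N(2) T(1)] by blast
  interpret p: graded_hom G R N Q p by (intro graded_homI N.graded_module_axioms gmodD(1)[OF Q] p)
  have pz: "p z \<noteq> \<zero>\<^bsub>Q\<^esub>" using z(3) p(3) p.mem_kernel N.H.D_closed[OF z(1,2)] by blast
  obtain e y where y: "e \<in> carrier G" "y \<in> mgrade Q e" "y \<noteq> \<zero>\<^bsub>Q\<^esub>" "hprime (ann R Q {y})"
    using exists_prime_annihilator[OF gmodD(1)[OF Q] p.N.M.smult_closed z(1) p.f_degree[OF z(1,2)] _ pz]
      p.f_closed N.H.D_closed[OF z(1,2)] by blast
  have yQ: "y \<in> carrier Q" by (rule p.N.H.D_closed[OF y(1,2)])
  have cy: "hsub G R Q (cyclic R Q y)" by (rule p.N.hsub_cyclic[OF y(1,2)])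
  define Y where "Y = gsub Q (cyclic R Q y)"
  have Y: "Y \<in> gmod G R" unfolding Y_def by (rule gsub_gmod[OF Q cy])
  have yY: "y \<in> mgrade Y e" using y(2) p.N.self_in_cyclic[OF yQ] by (simp add: Y_def)
  have cyc: "carrier Y = cyclic R Y y" by (simp add: Y_def cyclic_def)
  have annY: "ann R Y {y} = ann R Q {y}" by (simp add: Y_def ann_def)
  have AY: "A \<subseteq> ann R Y (carrier Y)"
  proof
    fix r assume "r \<in> A"
    then have r: "r \<in> carrier R" "\<And>n. n \<in> carrier N \<Longrightarrow> r \<odot>\<^bsub>N\<^esub> n = \<zero>\<^bsub>N\<^esub>" using N(1) by (auto simp: ann_def)
    have "r \<odot>\<^bsub>Q\<^esub> u = \<zero>\<^bsub>Q\<^esub>" if "u \<in> cyclic R Q y" for u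
    proof -
      have "u \<in> carrier Q" using p.N.hsubD(3)[OF cy that] .
      then obtain n where "n \<in> carrier N" "u = p n" using p(2) by blast
      then show ?thesis using r p.f_smult[of r n] by simp
    qed
    then show "r \<in> ann R Y (carrier Y)" using r(1) by (simp add: Y_def ann_def)
  qed
  also have "ann R Y (carrier Y) \<subseteq> ann R Y {y}"
    using p.N.self_in_cyclic[OF yQ] by (auto simp: Y_def ann_def)
  finally have Ay: "A \<subseteq> ann R Y {y}" .
  \<comment> \<open>Since A is contained in Ann y, every annihilator strictly above Ann y is
    strictly above A, so the maximal choice of A provides the induction hypothesis.\<close>
  have "Y \<in> \<C>"
  proof (rule prime_cyclic_mem[OF cok ext M0 _ Y y(1) yY cyc])
    show "ann R M0 (carrier M0) \<subseteq> ann R Y {y}" using N(4) Ay by blast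
    show "hprime (ann R Y {y})" using y(4) annY by simp
    show "N' \<in> \<C>" if "N' \<in> gmod G R" "ann R Y {y} \<subset> ann R N' (carrier N')" for N'
      using larger[OF that(1)] that(2) Ay by blast
  qed
  define U where "U = {n \<in> carrier N. p n \<in> cyclic R Q y}"
  have U: "hsub G R N U" unfolding U_def by (rule p.hsub_vimage[OF cy])
  have "p n = \<zero>\<^bsub>Q\<^esub>" "n \<in> carrier N" if "n \<in> T" for n using that p(3) p.mem_kernel by auto
  then have TU: "T \<subseteq> U" using p.N.hsubD(2)[OF cy] by (auto simp: U_def)
  have "gsub N U \<in> \<C>"
  proof (rule extension_mem[OF ext gsub_gmod[OF N(2) U] \<open>Y \<in> \<C>\<close>])
    show "p \<in> ghom G R (gsub N U) Y"
      unfolding Y_def by (rule p.restrict_both) (auto simp: U_def)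
    show "p ` carrier (gsub N U) = carrier Y"
    proof
      show "p ` carrier (gsub N U) \<subseteq> carrier Y" by (auto simp: U_def Y_def)
      show "carrier Y \<subseteq> p ` carrier (gsub N U)"
      proof
        fix u assume u: "u \<in> carrier Y"
        then have "u \<in> cyclic R Q y" by (simp add: Y_def)
        moreover from this obtain n where "n \<in> carrier N" "u = p n"
          using p.N.hsubD(3)[OF cy] p(2) by blast
        ultimately show "u \<in> p ` carrier (gsub N U)" by (simp add: U_def)
      qed
    qed
    have "a_kernel (gsub N U) Y p = T"
      using p(3) TU p.mem_kernel by (auto simp: a_kernel_def' Y_def U_def)
    then show "gsub (gsub N U) (a_kernel (gsub N U) Y p) \<in> \<C>" using T(2) gsub_gsub[OF TU, of N] by simp
  qed
  then have "U = T" by (rule max[OF U _ TU])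
  obtain n where n: "n \<in> carrier N" "y = p n" using yQ p(2) by blast
  then have "n \<in> U" using p.N.self_in_cyclic[OF yQ] by (simp add: U_def)
  then show False using \<open>U = T\<close> p(3) p.mem_kernel n(2) y(3) by blast
qed

text \<open>Passing to a subobject or to a quotient can only enlarge the annihilator, so
  \<open>mem_if_CE_closed\<close> applies to both.\<close>

lemma closed_subobjects_quotients_if_CE_closed:
  assumes add: "additive_subcategory G R \<C>" and cok: "closed_cokernels G R \<C>" and ext: "closed_extensions G R \<C>"
  shows "closed_subobjects G R \<C>" "closed_quotients G R \<C>"
proof -
  show "closed_subobjects G R \<C>"
    unfolding closed_subobjects_def
  proof (intro ballI impI)
    fix M L :: "('g, 'r, 'm) graded_module" and i
    assume M: "M \<in> \<C>" and L: "L \<in> gmod G R" and i: "i \<in> ghom G R L M" "inj_on i (carrier L)"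
    interpret i: graded_hom G R L M i by (intro graded_homI gmodD(1)[OF L] in_graded_module M i)
    have "r \<odot>\<^bsub>L\<^esub> x = \<zero>\<^bsub>L\<^esub>" if "r \<in> ann R M (carrier M)" "x \<in> carrier L" for r x
    proof -
      have "i (r \<odot>\<^bsub>L\<^esub> x) = i \<zero>\<^bsub>L\<^esub>" using that i.f_smult[of r x] by (simp add: ann_def)
      then show ?thesis using inj_onD[OF i(2)] that by (auto simp: ann_def)
  qed
  then have "ann R M (carrier M) \<subseteq> ann R L (carrier L)" by (auto simp: ann_def)
  then show "L \<in> \<C>" by (rule mem_if_CE_closed[OF assms M L])
  qed
  show "closed_quotients G R \<C>"
    unfolding closed_quotients_def
  proof (intro ballI impI)
    fix M N :: "('g, 'r, 'm) graded_module" and p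
    assume M: "M \<in> \<C>" and N: "N \<in> gmod G R" and p: "p \<in> ghom G R M N" "p ` carrier M = carrier N"
    interpret p: graded_hom G R M N p by (intro graded_homI gmodD(1)[OF N] in_graded_module M p)
    have "ann R M (carrier M) \<subseteq> ann R N (carrier N)"
      unfolding p(2)[symmetric] by (auto simp: ann_def p.f_smult[symmetric])
    then show "N \<in> \<C>" by (rule mem_if_CE_closed[OF assms M N])
  qed
qed

lemma closed_subobjects_if_IE_closed:
  assumes "additive_subcategory G R \<C>" "closed_images G R \<C>" "closed_extensions G R \<C>"
  shows "closed_subobjects G R \<C>"
  using closed_subobjects_if_gsub gsub_mem_if_IE_closed[OF assms] by blast

end

theorem corollary6p3:
  fixes G :: "'g monoid"
    and R :: "('g, 'r) graded_ring"
    and \<C> :: "('g, 'r, 'm) graded_module set"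
  assumes "graded_cring G R"
    and "graded_noetherian G R"
    and "infinite (UNIV :: 'm set)"
    and "\<exists>\<iota> :: 'r \<Rightarrow> 'm. inj_on \<iota> (carrier R)"
    and "subcategory G R \<C>"
    and "shift_closed G \<C>"
  shows "(serre_subcategory G R \<C> \<longleftrightarrow> torsion_class G R \<C>) \<and>
         (torsion_class G R \<C> \<longleftrightarrow> wide_subcategory G R \<C>) \<and>
         (wide_subcategory G R \<C> \<longleftrightarrow> ICE_closed G R \<C>) \<and>
         (ICE_closed G R \<C> \<longleftrightarrow> CE_closed G R \<C>) \<and>
         (torsion_free_class G R \<C> \<longleftrightarrow> IKE_closed G R \<C>) \<and>
         (IKE_closed G R \<C> \<longleftrightarrow> IE_closed G R \<C>)"
proof -
  interpret graded_subcategory G R \<C>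
    by (intro graded_subcategory.intro noetherian_graded_cring.intro
        noetherian_graded_cring_axioms.intro graded_subcategory_axioms.intro assms)
  \<comment> \<open>Only the implications from the weakest to the strongest notion of each list have
    content. The rest is formal: quotients give cokernels, and subobjects give kernels and
    images.\<close>
  have CE: "CE_closed G R \<C> \<Longrightarrow> serre_subcategory G R \<C>"
    using closed_subobjects_quotients_if_CE_closed by (auto simp: CE_closed_def serre_subcategory_def)
  have IE: "IE_closed G R \<C> \<Longrightarrow> torsion_free_class G R \<C>"
    using closed_subobjects_if_IE_closed by (auto simp: IE_closed_def torsion_free_class_def)
  show ?thesis
    using CE IE closed_cokernels_if_quotients closed_kernels_images_if_subobjects
    unfolding serre_subcategory_def torsion_class_def wide_subcategory_def ICE_closed_def CE_closed_def
      torsion_free_class_def IKE_closed_def IE_closed_def by argo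
qed

end
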